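(* Let $Z_1,\dots,Z_n$ be i.i.d. with distribution $Q$ on a measurable space $\mathcal Z$, $Z\sim Q$, let $\psi:\mathcal Z\to\mathbb R^r$ be measurable with $\int\|\psi\|^2dQ<\infty$ and $\theta=\int\psi\,dQ$. Let $m_n\to\infty$, let $u_1,u_2,\dots$ be measurable real functions on $\mathcal Z$, $u_n=(u_1,\dots,u_{m_n})^\top$, with $\int\|u_n\|^2dQ<\infty$, $\int u_n\,dQ=0$ and $W_n=\int u_nu_n^\top dQ$ nonsingular for each $n$, the sequence $(W_n)$ being regular. Let $\hat u_n$ be an estimator of $u_n$ (a random function $\mathcal Z\to\mathbb R^{m_n}$ which may depend on the sample) and $\hat W_n=\frac1n\sum_{j=1}^n\hat u_n(Z_j)\hat u_n(Z_j)^\top$. Assume (i) $\max_{1\le j\le n}\|\hat u_n(Z_j)\|=o_p(m_n^{-3/2}n^{1/2})$; (ii) $|\hat W_n-W_n|_o=o_p(m_n^{-1})$; (iii) $\frac1n\sum_{j=1}^n\big(\psi(Z_j)\hat u_n(Z_j)^\top-E[\psi(Z_j)\hat u_n(Z_j)^\top]\big)=o_p(m_n^{-1/2})$; and that there are measurable real functions $v_1,v_2,\dots$ on $\mathcal Z$ such that $v_n=(v_1,\dots,v_{m_n})^\top$ satisfies $\int\|v_n\|^2dQ<\infty$, $\int v_n\,dQ=0$, $\int v_nv_n^\top dQ$ nonsingular, $|U_n|_o=O(1)$ where $U_n=W_n^{-1/2}\big(\int v_nv_n^\top dQ\big)W_n^{-1/2}$, and (iv) $\frac1n\sum_{j=1}^nE\big(\|\hat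 u_n(Z_j)-v_n(Z_j)\|^2\big)=o(m_n^{-1})$; (v) $\frac1n\sum_{j=1}^n\hat u_n(Z_j)=\frac1n\sum_{j=1}^nv_n(Z_j)+o_p(m_n^{-1/2}n^{-1/2})$. Then, with probability tending to one, there is a unique $\hat\zeta_n\in\mathbb R^{m_n}$ with $1+\hat u_n(Z_j)^\top\hat\zeta_n>0$ for all $j$ and $\frac1n\sum_{j=1}^n\hat u_n(Z_j)/(1+\hat u_n(Z_j)^\top\hat\zeta_n)=0$, and $$\hat\theta_n=\frac1n\sum_{j=1}^n\frac{\psi(Z_j)}{1+\hat u_n(Z_j)^\top\hat\zeta_n}=\bar\psi-\bar\varphi+o_p(n^{-1/2}),$$ where $\varphi=\Pi(\psi\mid[v_\infty])$, $\bar\varphi=\frac1n\sum_j\varphi(Z_j)$, $\bar\psi=\frac1n\sum_j\psi(Z_j)$. Consequently, if $\Sigma=\mathrm{Var}(\psi(Z))-\mathrm{Var}(\varphi(Z))$ is nonsingular, then $\sqrt n(\hat\theta_n-\theta)\Rightarrow N(0,\Sigma)$.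
   Context: A sequence of $m_n\times m_n$ dispersion matrices $W_n$ is called regular if $0<\inf_n\inf_{\|a\|=1}a^\top W_na\le\sup_n\sup_{\|a\|=1}a^\top W_na<\infty$. $|A|_o$ is the spectral (operator) norm. $[v_\infty]$ is the closed linear span in $L_2(Q)$ of $v_1,v_2,\dots$ and $\Pi(\psi\mid[v_\infty])$ the componentwise orthogonal projection of $\psi$ onto it. Expectations involving $\hat u_n$ are with respect to the joint distribution of the sample. *)

theory Defs
  imports "HOL-Probability.Probability" "HOL-Library.Landau_Symbols"
begin

text \<open>A vector in R^m is represented by a function nat => real of which only the
  components k < m matter; an m x m matrix by nat => nat => real, entries i,k < m.\<close>

definition vnorm :: "nat \<Rightarrow> (nat \<Rightarrow> real) \<Rightarrow> real" where
  "vnorm m x = sqrt (\<Sum>k<m. (x k)\<^sup>2)"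

definition dotp :: "nat \<Rightarrow> (nat \<Rightarrow> real) \<Rightarrow> (nat \<Rightarrow> real) \<Rightarrow> real" where
  "dotp m x y = (\<Sum>k<m. x k * y k)"

definition mvec :: "nat \<Rightarrow> (nat \<Rightarrow> nat \<Rightarrow> real) \<Rightarrow> (nat \<Rightarrow> real) \<Rightarrow> (nat \<Rightarrow> real)" where
  "mvec m A x = (\<lambda>i. \<Sum>k<m. A i k * x k)"

definition mmul :: "nat \<Rightarrow> (nat \<Rightarrow> nat \<Rightarrow> real) \<Rightarrow> (nat \<Rightarrow> nat \<Rightarrow> real) \<Rightarrow> (nat \<Rightarrow> nat \<Rightarrow> real)" where
  "mmul m A B = (\<lambda>i j. \<Sum>k<m. A i k * B k j)"

definition idm :: "nat \<Rightarrow> nat \<Rightarrow> real" where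
  "idm i j = (if i = j then 1 else 0)"

definition nonsingular :: "nat \<Rightarrow> (nat \<Rightarrow> nat \<Rightarrow> real) \<Rightarrow> bool" where
  "nonsingular m A \<longleftrightarrow> (\<exists>B. \<forall>i<m. \<forall>j<m. mmul m A B i j = idm i j \<and> mmul m B A i j = idm i j)"

definition opnorm :: "nat \<Rightarrow> (nat \<Rightarrow> nat \<Rightarrow> real) \<Rightarrow> real" where
  "opnorm m A = Sup {vnorm m (mvec m A a) | a. vnorm m a = 1}"

text \<open>A^{-1/2} for a symmetric positive definite m x m matrix A: the unique symmetric
  positive definite S (normalised to vanish outside the index range) with S A S = I.\<close>
definition inv_sqrt :: "nat \<Rightarrow> (nat \<Rightarrow> nat \<Rightarrow> real) \<Rightarrow> (nat \<Rightarrow> nat \<Rightarrow> real)" where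
  "inv_sqrt m A = (THE S. (\<forall>i j. (m \<le> i \<or> m \<le> j) \<longrightarrow> S i j = 0)
      \<and> (\<forall>i<m. \<forall>j<m. S i j = S j i)
      \<and> (\<forall>a. (\<exists>k<m. a k \<noteq> 0) \<longrightarrow> 0 < dotp m a (mvec m S a))
      \<and> (\<forall>i<m. \<forall>j<m. mmul m (mmul m S A) S i j = idm i j))"

definition regular_seq :: "(nat \<Rightarrow> nat) \<Rightarrow> (nat \<Rightarrow> nat \<Rightarrow> nat \<Rightarrow> real) \<Rightarrow> bool" where
  "regular_seq m W \<longleftrightarrow>
     (\<exists>c>0. \<forall>n a. vnorm (m n) a = 1 \<longrightarrow> c \<le> dotp (m n) a (mvec (m n) (W n) a)) \<and>
     (\<exists>C. \<forall>n a. vnorm (m n) a = 1 \<longrightarrow> dotp (m n) a (mvec (m n) (W n) a) \<le> C)"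

text \<open>X n = o_p(a n): for every eps > 0, P(|X n| > eps * a n) -> 0, with outer probability
  (coincides with the usual notion for measurable X n).\<close>
definition op_small :: "'a measure \<Rightarrow> (nat \<Rightarrow> 'a \<Rightarrow> real) \<Rightarrow> (nat \<Rightarrow> real) \<Rightarrow> bool" where
  "op_small M X a \<longleftrightarrow> (\<forall>\<epsilon>>0. \<exists>B. (\<forall>n. B n \<in> sets M \<and> {\<omega>\<in>space M. \<epsilon> * a n < \<bar>X n \<omega>\<bar>} \<subseteq> B n)
       \<and> (\<lambda>n. measure M (B n)) \<longlonglongrightarrow> 0)"

definition outer_exp :: "'a measure \<Rightarrow> ('a \<Rightarrow> real) \<Rightarrow> real" where
  "outer_exp M g = Inf {integral\<^sup>L M h | h. integrable M h \<and> (\<forall>\<omega>\<in>space M. g \<omega> \<le> h \<omega>)}"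

definition weak_conv_outer :: "'a measure \<Rightarrow> (nat \<Rightarrow> 'a \<Rightarrow> 'b::euclidean_space) \<Rightarrow> 'b measure \<Rightarrow> bool" where
  "weak_conv_outer M X L \<longleftrightarrow> (\<forall>f. continuous_on UNIV f \<and> bounded (range f) \<longrightarrow>
      (\<lambda>n. outer_exp M (\<lambda>\<omega>. f (X n \<omega>))) \<longlonglongrightarrow> integral\<^sup>L L f)"

definition psd_sqrt :: "real^'r^'r \<Rightarrow> real^'r^'r" where
  "psd_sqrt S = (THE A. transpose A = A \<and> (\<forall>x. 0 \<le> x \<bullet> (A *v x)) \<and> A ** A = S)"

definition mvnormal :: "real^'r^'r \<Rightarrow> (real^'r) measure" where
  "mvnormal S = distr (PiM UNIV (\<lambda>_::'r. std_normal_distribution)) borel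
                  (\<lambda>x. psd_sqrt S *v (\<chi> i. x i))"

definition in_closed_span :: "'z measure \<Rightarrow> (nat \<Rightarrow> 'z \<Rightarrow> real) \<Rightarrow> ('z \<Rightarrow> real) \<Rightarrow> bool" where
  "in_closed_span Q v f \<longleftrightarrow> f \<in> borel_measurable Q \<and> integrable Q (\<lambda>z. (f z)\<^sup>2) \<and>
     (\<forall>\<epsilon>>0. \<exists>K c. integral\<^sup>L Q (\<lambda>z. (f z - (\<Sum>k<K. c k * v k z))\<^sup>2) < \<epsilon>)"

definition l2_proj :: "'z measure \<Rightarrow> (nat \<Rightarrow> 'z \<Rightarrow> real) \<Rightarrow> ('z \<Rightarrow> real) \<Rightarrow> ('z \<Rightarrow> real) \<Rightarrow> bool" where
  "l2_proj Q v g f \<longleftrightarrow> in_closed_span Q v f \<and> (\<forall>k. integral\<^sup>L Q (\<lambda>z. (g z - f z) * v k z) = 0)"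

definition covmat :: "'z measure \<Rightarrow> ('z \<Rightarrow> real^'r) \<Rightarrow> real^'r^'r" where
  "covmat Q f = (\<chi> i j. integral\<^sup>L Q (\<lambda>z. (f z $ i - (integral\<^sup>L Q f) $ i) * (f z $ j - (integral\<^sup>L Q f) $ j)))"


definition gram :: "'z measure \<Rightarrow> (nat \<Rightarrow> 'z \<Rightarrow> real) \<Rightarrow> nat \<Rightarrow> nat \<Rightarrow> real" where
  "gram Q u = (\<lambda>i k. integral\<^sup>L Q (\<lambda>z. u i z * u k z))"

definition el_sol :: "nat \<Rightarrow> nat \<Rightarrow> (nat \<Rightarrow> nat \<Rightarrow> real) \<Rightarrow> (nat \<Rightarrow> real) \<Rightarrow> bool" where
  "el_sol p n x \<zeta> \<longleftrightarrow> (\<forall>k. p \<le> k \<longrightarrow> \<zeta> k = 0)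
      \<and> (\<forall>j<n. 0 < 1 + dotp p (x j) \<zeta>)
      \<and> (\<forall>k<p. (\<Sum>j<n. x j k / (1 + dotp p (x j) \<zeta>)) / real n = 0)"

end

(*
  With x_j the value of the estimated constraint function at Z_j, the weights come from maximising
  zeta |-> sum_j ln (1 + x_j . zeta), which is strictly concave; on the sphere of a radius r of order
  (m/n)^(1/2) it decreases outwards, so there is a unique critical point zeta, with |zeta| <= r.
  Expanding 1/(1+t) to second order gives zeta = W^{-1} (mean of v) up to o_p((mn)^(-1/2)).  Moreover
  W is also the Gram matrix of v, so substituting zeta into the second order expansion of the
  weighted mean of psi produces the mean of the projection of psi onto span(v_1,...,v_m); the latter
  is replaced by phi at the cost of a variance that tends to 0.
  Asymptotic normality follows from a multivariate central limit theorem and Slutsky's lemma for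
  outer expectations.  The former is obtained from convergence of characteristic functions: after
  wrapping a large ball around a torus, a bounded continuous function is uniformly close there to a
  trigonometric polynomial, by the Tietze and Stone-Weierstrass theorems.
*)
theory Submission
  imports Defs
begin

section \<open>Finite vectors and the empirical likelihood equations\<close>

text \<open>The rates fit together as follows. With r of order (m/n)^(1/2), condition (i) makes
  every x_j . zeta uniformly o_p(1/m), and the second order remainder, of size max |x_j| times r^2,
  is o_p((mn)^(-1/2)). The spectral error in (ii) times r has the same order, and so has (v). The
  error of the cross moments is only o_p(m^(-1/2)), which times r is exactly o_p(n^(-1/2)). The
  inverse of W enters only through a vector solving the normal equations, whose norm stays bounded
  in n; so the expansion needs W zeta rather than zeta itself. The obstacle is measurability: the
  estimator depends on omega in an arbitrary way, so maxima, spectral norms and zeta need not be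
  measurable. All analysis of the equations is therefore carried out for one fixed sample with
  explicit constants (\<open>el_data\<close>). Probability enters only through events
  \<open>fails_rarely\<close>, which use measurable covers and a fixed level, so that finitely many
  of them are intersected by adding their levels.\<close>

lemma vnorm_L2: "vnorm m x = L2_set x {..<m}"
  by (simp add: vnorm_def L2_set_def)

lemma vnorm_nonneg [simp]: "0 \<le> vnorm m x"
  by (simp add: vnorm_L2)

lemma vnorm_sq: "(vnorm m x)\<^sup>2 = (\<Sum>k<m. (x k)\<^sup>2)"
  by (simp add: vnorm_def sum_nonneg)

lemma vnorm_triangle: "vnorm m (\<lambda>k. x k + y k) \<le> vnorm m x + vnorm m y"
  by (simp add: vnorm_L2 L2_set_triangle_ineq)

lemma vnorm_triangle_diff: "vnorm m x \<le> vnorm m (\<lambda>k. x k - y k) + vnorm m y"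
  using vnorm_triangle[of m "\<lambda>k. x k - y k" y] by simp

lemma vnorm_scale: "vnorm m (\<lambda>k. c * x k) = \<bar>c\<bar> * vnorm m x"
  by (simp add: vnorm_def power_mult_distrib sum_distrib_left[symmetric] real_sqrt_mult)

lemma component_le_vnorm: "k < m \<Longrightarrow> \<bar>x k\<bar> \<le> vnorm m x"
  using member_le_L2_set[of "{..<m}" k "\<lambda>k. \<bar>x k\<bar>"] by (simp add: vnorm_def L2_set_def)

lemma vnorm_eq_0D: "vnorm m x = 0 \<Longrightarrow> k < m \<Longrightarrow> x k = 0"
  using component_le_vnorm[of k m x] by simp

lemma dotp_commute: "dotp m x y = dotp m y x"
  by (simp add: dotp_def mult.commute)

lemma dotp_self: "dotp m x x = (vnorm m x)\<^sup>2"
  unfolding vnorm_sq by (simp add: dotp_def power2_eq_square)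

lemma dotp_le: "\<bar>dotp m x y\<bar> \<le> vnorm m x * vnorm m y"
proof -
  have "\<bar>dotp m x y\<bar> \<le> (\<Sum>k<m. \<bar>x k\<bar> * \<bar>y k\<bar>)"
    unfolding dotp_def by (rule order_trans[OF sum_abs]) (simp add: abs_mult)
  also have "\<dots> \<le> vnorm m x * vnorm m y"
    unfolding vnorm_L2 by (rule L2_set_mult_ineq)
  finally show ?thesis .
qed

lemma dotp_diff_left: "dotp m (\<lambda>k. x k - y k) z = dotp m x z - dotp m y z"
  by (simp add: dotp_def left_diff_distrib sum_subtractf)

lemma dotp_add_right: "dotp m z (\<lambda>k. x k + y k) = dotp m z x + dotp m z y"
  by (simp add: dotp_def distrib_left sum.distrib)

lemma dotp_diff_right: "dotp m z (\<lambda>k. x k - y k) = dotp m z x - dotp m z y"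
  by (simp add: dotp_def right_diff_distrib sum_subtractf)

lemma dotp_scale_right: "dotp m z (\<lambda>k. c * x k) = c * dotp m z x"
  by (simp add: dotp_def sum_distrib_left mult_ac)

lemma dotp_cong: "(\<And>k. k < m \<Longrightarrow> x k = x' k) \<Longrightarrow> (\<And>k. k < m \<Longrightarrow> y k = y' k) \<Longrightarrow> dotp m x y = dotp m x' y'"
  by (simp add: dotp_def)

text \<open>Remainders below are known only through inner products; pairing such a vector with
  itself and cancelling one factor of its norm bounds it. The zero case is separate because of that
  division.\<close>

lemma vnorm_le_of_dotp:
  assumes "(vnorm m x)\<^sup>2 \<le> B * vnorm m x" "0 \<le> B"
  shows "vnorm m x \<le> B"
proof (cases "vnorm m x = 0")
  case False
  then have "0 < vnorm m x" by (simp add: order_less_le)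
  with assms(1) show ?thesis by (simp add: power2_eq_square)
qed (use assms in simp)

text \<open>Cauchy-Schwarz in each row. The value of the constant does not matter: its existence
  makes the set in \<open>opnorm\<close> bounded above, so that \<open>Sup\<close> is a genuine
  supremum.\<close>

lemma mvec_frobenius: "vnorm m (mvec m A x) \<le> sqrt (\<Sum>i<m. (vnorm m (A i))\<^sup>2) * vnorm m x"
proof -
  have "(\<Sum>i<m. (mvec m A x i)\<^sup>2) \<le> (\<Sum>i<m. (vnorm m (A i))\<^sup>2 * (vnorm m x)\<^sup>2)"
  proof (rule sum_mono)
    fix i
    have "mvec m A x i = dotp m (A i) x" by (simp add: mvec_def dotp_def)
    then have "\<bar>mvec m A x i\<bar> \<le> vnorm m (A i) * vnorm m x" using dotp_le by simp
    then show "(mvec m A x i)\<^sup>2 \<le> (vnorm m (A i))\<^sup>2 * (vnorm m x)\<^sup>2"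
      using power_mono[of "\<bar>mvec m A x i\<bar>" "vnorm m (A i) * vnorm m x" 2] by (simp add: power_mult_distrib)
  qed
  then have "vnorm m (mvec m A x) \<le> sqrt ((\<Sum>i<m. (vnorm m (A i))\<^sup>2) * (vnorm m x)\<^sup>2)"
    unfolding vnorm_def[of m "mvec m A x"] sum_distrib_right[symmetric] by simp
  then show ?thesis by (simp add: real_sqrt_mult)
qed

lemma mvec_scale: "mvec m A (\<lambda>k. c * x k) = (\<lambda>i. c * mvec m A x i)"
  by (simp add: mvec_def sum_distrib_left mult_ac)

lemma opnorm_bound: "vnorm m (mvec m A x) \<le> opnorm m A * vnorm m x"
proof (cases "vnorm m x = 0")
  \<comment> \<open>This case also covers m = 0, where there is no unit vector and
    \<open>opnorm\<close> is the \<open>Sup\<close> of an empty set.\<close>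
  case True
  then show ?thesis using mvec_frobenius[of m A x] by simp
next
  case False
  then have pos: "0 < vnorm m x" by (simp add: order_less_le)
  define a where "a = (\<lambda>k. inverse (vnorm m x) * x k)"
  have a1: "vnorm m a = 1" unfolding a_def vnorm_scale using pos by simp
  have "bdd_above {vnorm m (mvec m A a) | a. vnorm m a = 1}"
  proof (rule bdd_aboveI)
    fix y assume "y \<in> {vnorm m (mvec m A a) | a. vnorm m a = 1}"
    then obtain b where "y = vnorm m (mvec m A b)" "vnorm m b = 1" by blast
    then show "y \<le> sqrt (\<Sum>i<m. (vnorm m (A i))\<^sup>2)" using mvec_frobenius[of m A b] by simp
  qed
  then have "vnorm m (mvec m A a) \<le> opnorm m A"
    unfolding opnorm_def using a1 by (intro cSup_upper) auto
  moreover have "vnorm m (mvec m A a) = inverse (vnorm m x) * vnorm m (mvec m A x)"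
    unfolding a_def mvec_scale vnorm_scale using pos by simp
  ultimately show ?thesis using pos by (simp add: field_simps)
qed

section \<open>Averages over a sample\<close>

lemma mean_cauchy_schwarz:
  fixes f g :: "nat \<Rightarrow> real"
  assumes "(\<Sum>j<n. (f j)\<^sup>2) / real n \<le> A\<^sup>2" "(\<Sum>j<n. (g j)\<^sup>2) / real n \<le> B\<^sup>2" "0 \<le> A" "0 \<le> B"
  shows "(\<Sum>j<n. \<bar>f j\<bar> * \<bar>g j\<bar>) / real n \<le> A * B"
proof (cases "n = 0")
  case False
  then have n: "0 < real n" by simp
  have 1: "L2_set f {..<n} \<le> sqrt (real n) * A" "L2_set g {..<n} \<le> sqrt (real n) * B"
  proof -
    have *: "L2_set h {..<n} \<le> sqrt (real n) * D" if "(\<Sum>j<n. (h j)\<^sup>2) / real n \<le> D\<^sup>2" "0 \<le> D" for h D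
    proof -
      have "(\<Sum>j<n. (h j)\<^sup>2) \<le> (sqrt (real n) * D)\<^sup>2"
        using that n by (simp add: pos_divide_le_eq power_mult_distrib mult.commute)
      then show ?thesis unfolding L2_set_def using that by (intro real_le_lsqrt) (auto simp: sum_nonneg)
    qed
    show "L2_set f {..<n} \<le> sqrt (real n) * A" "L2_set g {..<n} \<le> sqrt (real n) * B"
      using * assms by auto
  qed
  have "(\<Sum>j<n. \<bar>f j\<bar> * \<bar>g j\<bar>) \<le> L2_set f {..<n} * L2_set g {..<n}"
    by (rule L2_set_mult_ineq)
  also have "\<dots> \<le> (sqrt (real n) * A) * (sqrt (real n) * B)"
    using 1 assms by (intro mult_mono) (auto simp: L2_set_nonneg)
  also have "\<dots> = real n * (A * B)" by simp
  finally show ?thesis using n by (simp add: field_simps)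
qed (use assms in simp)

lemma mean_mono:
  assumes "\<And>j. j < n \<Longrightarrow> f j \<le> (g j :: real)"
  shows "(\<Sum>j<n. f j) / real n \<le> (\<Sum>j<n. g j) / real n"
  using assms by (intro divide_right_mono sum_mono) auto

lemma mean_abs: "\<bar>(\<Sum>j<n. f j) / real n\<bar> \<le> (\<Sum>j<n. \<bar>f j :: real\<bar>) / real n"
  by (auto intro: divide_right_mono sum_abs)

lemma dotp_mean:
  "dotp p (\<lambda>k. (\<Sum>j<n. c j * x j k) / real n) y = (\<Sum>j<n. c j * dotp p (x j) y) / real n"
proof -
  have "dotp p (\<lambda>k. (\<Sum>j<n. c j * x j k) / real n) y = (\<Sum>k<p. \<Sum>j<n. c j * x j k * y k) / real n"
    by (simp add: dotp_def sum_divide_distrib sum_distrib_right)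
  also have "\<dots> = (\<Sum>j<n. \<Sum>k<p. c j * x j k * y k) / real n"
    by (subst sum.swap) simp
  finally show ?thesis by (simp add: dotp_def sum_distrib_left mult.assoc)
qed

lemma dotp_mean1:
  "dotp p (\<lambda>k. (\<Sum>j<n. x j k) / real n) y = (\<Sum>j<n. dotp p (x j) y) / real n"
  using dotp_mean[where c="\<lambda>_. 1"] by simp

section \<open>Unique solvability of the likelihood equations\<close>

lemma el_sol_dotp:
  assumes "el_sol p n x \<zeta>"
  shows "(\<Sum>j<n. dotp p (x j) a / (1 + dotp p (x j) \<zeta>)) / real n = 0"
proof -
  have "(\<Sum>j<n. dotp p (x j) a / (1 + dotp p (x j) \<zeta>)) / real n
      = dotp p (\<lambda>k. (\<Sum>j<n. inverse (1 + dotp p (x j) \<zeta>) * x j k) / real n) a"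
    unfolding dotp_mean by (simp add: divide_inverse mult.commute)
  also have "\<dots> = dotp p (\<lambda>k. 0) a"
    using assms unfolding el_sol_def by (intro dotp_cong) (auto simp: divide_inverse mult.commute)
  finally show ?thesis by (simp add: dotp_def)
qed

text \<open>Strict concavity in the form of monotonicity: the two systems tested against d differ by
  a sum of squares with positive weights. Hence every x_j . d vanishes, and definiteness of the
  empirical Gram matrix gives d = 0. Equality as functions is possible because \<open>el_sol\<close>
  fixes the coordinates from p on.\<close>

lemma el_sol_unique:
  assumes "n > 0" "c0 > 0"
    and pd: "\<And>a. c0 * (vnorm p a)\<^sup>2 \<le> (\<Sum>j<n. (dotp p (x j) a)\<^sup>2) / real n"
    and s: "el_sol p n x \<zeta>" "el_sol p n x \<xi>"
  shows "\<zeta> = \<xi>"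
proof -
  define d where "d = (\<lambda>k. \<zeta> k - \<xi> k)"
  let ?s = "\<lambda>j. dotp p (x j) \<zeta>" and ?t = "\<lambda>j. dotp p (x j) \<xi>"
  have pos: "0 < 1 + ?s j" "0 < 1 + ?t j" if "j < n" for j
    using s that by (auto simp: el_sol_def)
  have dd: "dotp p (x j) d = ?s j - ?t j" for j by (simp add: d_def dotp_diff_right)
  have "(\<Sum>j<n. dotp p (x j) d / (1 + ?t j)) = 0" "(\<Sum>j<n. dotp p (x j) d / (1 + ?s j)) = 0"
    using el_sol_dotp[OF s(1), of d] el_sol_dotp[OF s(2), of d] \<open>n > 0\<close> by auto
  then have "(\<Sum>j<n. dotp p (x j) d / (1 + ?t j) - dotp p (x j) d / (1 + ?s j)) = 0"
    by (simp add: sum_subtractf)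
  moreover have "dotp p (x j) d / (1 + ?t j) - dotp p (x j) d / (1 + ?s j)
      = (dotp p (x j) d)\<^sup>2 / ((1 + ?t j) * (1 + ?s j))" if "j < n" for j
    using pos[OF that] unfolding dd by (simp add: field_simps power2_eq_square)
  ultimately have "(\<Sum>j<n. (dotp p (x j) d)\<^sup>2 / ((1 + ?t j) * (1 + ?s j))) = 0" by simp
  then have "\<forall>j\<in>{..<n}. (dotp p (x j) d)\<^sup>2 / ((1 + ?t j) * (1 + ?s j)) = 0"
    by (subst (asm) sum_nonneg_eq_0_iff) (auto intro!: divide_nonneg_pos mult_pos_pos pos)
  then have "dotp p (x j) d = 0" if "j < n" for j using pos[OF that] that by fastforce
  then have "c0 * (vnorm p d)\<^sup>2 \<le> 0" using pd[of d] by simp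
  then have "vnorm p d = 0" using \<open>c0 > 0\<close> by (simp add: mult_le_0_iff power2_less_eq_zero_iff)
  then have "\<zeta> k = \<xi> k" for k
    using vnorm_eq_0D[of p d k] s by (cases "k < p") (auto simp: d_def el_sol_def)
  then show ?thesis by auto
qed

text \<open>Finite vectors are functions on nat, so compactness comes from Tychonoff: the ball is
  closed in a product of intervals that degenerate to {0} from index p on. The maximiser of the log
  likelihood is sought in this set.\<close>

lemma compact_vball: "compact {\<zeta>. (\<forall>k. p \<le> k \<longrightarrow> \<zeta> k = 0) \<and> vnorm p \<zeta> \<le> r}"
proof -
  define C where "C = Pi\<^sub>E UNIV (\<lambda>k::nat. if k < p then {-r..r} else {0::real})"
  have "compactin (product_topology (\<lambda>_. euclidean) UNIV) C"
    unfolding C_def compactin_PiE by auto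
  then have "compact C" by (simp add: euclidean_product_topology)
  moreover have "closed {\<zeta>. vnorm p \<zeta> \<le> r}"
    unfolding vnorm_def by (intro closed_Collect_le continuous_intros continuous_on_product_coordinates)
  ultimately have "compact (C \<inter> {\<zeta>. vnorm p \<zeta> \<le> r})" by (rule compact_Int_closed)
  moreover have "C \<inter> {\<zeta>. vnorm p \<zeta> \<le> r} = {\<zeta>. (\<forall>k. p \<le> k \<longrightarrow> \<zeta> k = 0) \<and> vnorm p \<zeta> \<le> r}"
  proof (intro equalityI subsetI)
    fix \<zeta> :: "nat \<Rightarrow> real" assume "\<zeta> \<in> C \<inter> {\<zeta>. vnorm p \<zeta> \<le> r}"
    then have "vnorm p \<zeta> \<le> r" and *: "\<And>k. \<zeta> k \<in> (if k < p then {-r..r} else {0})"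
      unfolding C_def by (auto simp only: PiE_iff UNIV_I Int_iff mem_Collect_eq)
    moreover have "\<zeta> k = 0" if "p \<le> k" for k
      using *[of k] that by simp
    ultimately show "\<zeta> \<in> {\<zeta>. (\<forall>k. p \<le> k \<longrightarrow> \<zeta> k = 0) \<and> vnorm p \<zeta> \<le> r}" by simp
  next
    fix \<zeta> :: "nat \<Rightarrow> real" assume "\<zeta> \<in> {\<zeta>. (\<forall>k. p \<le> k \<longrightarrow> \<zeta> k = 0) \<and> vnorm p \<zeta> \<le> r}"
    then have z: "\<And>k. p \<le> k \<Longrightarrow> \<zeta> k = 0" and r: "vnorm p \<zeta> \<le> r" by auto
    have "\<zeta> k \<in> (if k < p then {-r..r} else {0})" for k
      using component_le_vnorm[of k p \<zeta>] z r by (auto simp: not_less)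
    then show "\<zeta> \<in> C \<inter> {\<zeta>. vnorm p \<zeta> \<le> r}" using r by (auto simp: C_def PiE_iff)
  qed
  ultimately show ?thesis by simp
qed

text \<open>The hypothesis \<open>small\<close> keeps 1 + x_j . zeta at least 1/2 on the closed
  ball, so the logarithms are continuous there. The bound on the mean forces the maximiser off the
  boundary; in the interior all directional derivatives vanish, and these are the equations.\<close>

lemma el_sol_exists:
  assumes n: "n > 0" and r: "r > 0"
    and small: "\<And>j. j < n \<Longrightarrow> vnorm p (x j) * r \<le> 1/2"
    and pd: "\<And>a. c0 * (vnorm p a)\<^sup>2 \<le> (\<Sum>j<n. (dotp p (x j) a)\<^sup>2) / real n"
    and mean: "vnorm p (\<lambda>k. (\<Sum>j<n. x j k) / real n) < 2/3 * c0 * r"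
  shows "\<exists>\<zeta>. el_sol p n x \<zeta> \<and> vnorm p \<zeta> \<le> r"
proof -
  define B where "B = {\<zeta>. (\<forall>k. p \<le> k \<longrightarrow> \<zeta> k = 0) \<and> vnorm p \<zeta> \<le> r}"
  define F where "F \<zeta> = (\<Sum>j<n. ln (1 + dotp p (x j) \<zeta>))" for \<zeta>
  have tb: "\<bar>dotp p (x j) \<zeta>\<bar> \<le> 1/2" if "j < n" "vnorm p \<zeta> \<le> r" for j \<zeta>
    using dotp_le[of p "x j" \<zeta>] small[OF that(1)] mult_left_mono[OF that(2) vnorm_nonneg[of p "x j"]] by linarith
  have tpos: "0 < 1 + dotp p (x j) \<zeta>" if "j < n" "vnorm p \<zeta> \<le> r" for j \<zeta>
    using tb[OF that] by linarith
  have "continuous_on B (\<lambda>\<zeta>. dotp p (x j) \<zeta>)" for j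
    unfolding dotp_def
    by (intro continuous_intros continuous_on_product_coordinates continuous_on_subset[OF continuous_on_product_coordinates]) auto
  then have "continuous_on B F"
    unfolding F_def
    by (intro continuous_on_sum continuous_on_ln continuous_on_add continuous_on_const)
       (use tpos in \<open>auto simp: B_def less_le\<close>)
  moreover have "compact B" unfolding B_def by (rule compact_vball)
  moreover have "(\<lambda>_. 0) \<in> B" using r by (auto simp: B_def vnorm_def)
  ultimately obtain \<zeta> where \<zeta>: "\<zeta> \<in> B" and max: "\<And>\<xi>. \<xi> \<in> B \<Longrightarrow> F \<xi> \<le> F \<zeta>"
    using continuous_attains_sup[of B F] by blast
  have \<zeta>r: "vnorm p \<zeta> \<le> r" and \<zeta>0: "\<And>k. p \<le> k \<Longrightarrow> \<zeta> k = 0" using \<zeta> by (auto simp: B_def)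
  have der: "((\<lambda>s. F (\<lambda>k. \<zeta> k + s * a k)) has_real_derivative
      (\<Sum>j<n. dotp p (x j) a / (1 + dotp p (x j) \<zeta>))) (at 0)" for a
    unfolding F_def dotp_add_right dotp_scale_right
    using tpos[OF _ \<zeta>r] by (auto intro!: derivative_eq_intros sum.cong)
  \<comment> \<open>On the sphere of radius r the objective decreases radially outwards.\<close>
  have interior: "vnorm p \<zeta> < r"
  proof (rule ccontr)
    assume "\<not> ?thesis"
    then have eq: "vnorm p \<zeta> = r" using \<zeta>r by simp
    let ?t = "\<lambda>j. dotp p (x j) \<zeta>"
    \<comment> \<open>Equivalent to t^2 (1/3 - 2/3 t) >= 0, so 2/3 is the best constant valid up to
      t = 1/2; it is the 2/3 in the hypothesis \<open>mean\<close>.\<close>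
    have le: "?t j / (1 + ?t j) \<le> ?t j - 2/3 * (?t j)\<^sup>2" if "j < n" for j
    proof -
      have "0 \<le> (?t j)\<^sup>2 * (1/3 - 2/3 * ?t j)" using tb[OF that \<zeta>r] by (intro mult_nonneg_nonneg) auto
      then have "?t j \<le> (?t j - 2/3 * (?t j)\<^sup>2) * (1 + ?t j)" by (simp add: algebra_simps power2_eq_square)
      then show ?thesis using tpos[OF that \<zeta>r] by (simp add: field_simps)
    qed
    have "(\<Sum>j<n. ?t j / (1 + ?t j)) / real n \<le> (\<Sum>j<n. ?t j - 2/3 * (?t j)\<^sup>2) / real n"
      by (rule mean_mono[OF le])
    also have "\<dots> = dotp p (\<lambda>k. (\<Sum>j<n. x j k) / real n) \<zeta> - 2/3 * ((\<Sum>j<n. (?t j)\<^sup>2) / real n)"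
      unfolding dotp_mean1 by (simp add: sum_subtractf sum_distrib_left diff_divide_distrib sum_divide_distrib)
    also have "\<dots> \<le> vnorm p (\<lambda>k. (\<Sum>j<n. x j k) / real n) * r - 2/3 * (c0 * r\<^sup>2)"
      using dotp_le[of p "\<lambda>k. (\<Sum>j<n. x j k) / real n" \<zeta>] pd[of \<zeta>] eq by auto
    also have "\<dots> < 0" using mult_strict_right_mono[OF mean r] by (simp add: power2_eq_square)
    finally have neg: "(\<Sum>j<n. ?t j / (1 + ?t j)) < 0" using n by (simp add: divide_less_0_iff)
    have "((\<lambda>s. F (\<lambda>k. \<zeta> k + s * \<zeta> k)) has_real_derivative (\<Sum>j<n. ?t j / (1 + ?t j))) (at 0)"
      by (rule der)
    from DERIV_neg_dec_left[OF this neg] obtain d where d: "d > 0"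
      and dec: "\<And>h. 0 < h \<Longrightarrow> h < d \<Longrightarrow> F (\<lambda>k. \<zeta> k + 0 * \<zeta> k) < F (\<lambda>k. \<zeta> k + (0 - h) * \<zeta> k)" by blast
    \<comment> \<open>The cap at 1 keeps the factor 1 - h nonnegative, so the shrunken vector
      remains in the ball.\<close>
    define h where "h = min (d/2) 1"
    have h: "0 < h" "h < d" "h \<le> 1" using d by (auto simp: h_def)
    have "(\<lambda>k. \<zeta> k + (0 - h) * \<zeta> k) = (\<lambda>k. (1 - h) * \<zeta> k)" by (auto simp: algebra_simps)
    moreover have "(\<lambda>k. (1 - h) * \<zeta> k) \<in> B"
      using \<zeta>0 h eq r by (auto simp: B_def vnorm_scale mult_le_cancel_right1)
    ultimately show False using max dec[OF h(1,2)] by fastforce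
  qed
  have crit: "(\<Sum>j<n. dotp p (x j) a / (1 + dotp p (x j) \<zeta>)) = 0" if a0: "\<And>k. p \<le> k \<Longrightarrow> a k = 0" for a
  proof -
    \<comment> \<open>Steps shorter than d in direction a stay in the ball; the added 1 avoids
      division by zero when a vanishes.\<close>
    define d where "d = (r - vnorm p \<zeta>) / (vnorm p a + 1)"
    have d: "d > 0" using interior by (auto simp: d_def intro!: divide_pos_pos add_nonneg_pos)
    have "\<forall>s. \<bar>0 - s\<bar> < d \<longrightarrow> F (\<lambda>k. \<zeta> k + s * a k) \<le> F (\<lambda>k. \<zeta> k + 0 * a k)"
    proof (intro allI impI)
      fix s assume s: "\<bar>0 - s\<bar> < d"
      have "vnorm p (\<lambda>k. \<zeta> k + s * a k) \<le> vnorm p \<zeta> + \<bar>s\<bar> * vnorm p a"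
        using vnorm_triangle[of p \<zeta> "\<lambda>k. s * a k"] by (simp add: vnorm_scale)
      also have "\<bar>s\<bar> * vnorm p a \<le> d * (vnorm p a + 1)"
        using s vnorm_nonneg[of p a] by (intro mult_mono) auto
      also have "d * (vnorm p a + 1) = r - vnorm p \<zeta>"
      proof -
        have "vnorm p a + 1 \<noteq> 0" using vnorm_nonneg[of p a] by linarith
        then show ?thesis by (simp add: d_def)
      qed
      finally have "(\<lambda>k. \<zeta> k + s * a k) \<in> B" using \<zeta>0 a0 by (auto simp: B_def)
      from max[OF this] show "F (\<lambda>k. \<zeta> k + s * a k) \<le> F (\<lambda>k. \<zeta> k + 0 * a k)" by simp
    qed
    from DERIV_local_max[OF der d this] show ?thesis .
  qed
  have "(\<Sum>j<n. x j k / (1 + dotp p (x j) \<zeta>)) = 0" if "k < p" for k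
  proof -
    have "dotp p (x j) (\<lambda>i. if i = k then 1 else 0) = x j k" for j
      using that by (simp add: dotp_def if_distrib cong: if_cong)
    then show ?thesis using crit[of "\<lambda>i. if i = k then 1 else 0"] that by auto
  qed
  then have "el_sol p n x \<zeta>" using \<zeta>0 tpos[OF _ \<zeta>r] by (auto simp: el_sol_def)
  then show ?thesis using \<zeta>r by auto
qed

section \<open>Second order expansion of the weights\<close>

lemma el_sol_bound:
  assumes X: "\<And>j. j < n \<Longrightarrow> vnorm p (x j) \<le> X" and r: "vnorm p \<zeta> \<le> r" "0 \<le> r" "X * r \<le> 1/2"
    and j: "j < n"
  shows "\<bar>dotp p (x j) \<zeta>\<bar> \<le> X * r" "1/2 \<le> 1 + dotp p (x j) \<zeta>"
proof -
  have "\<bar>dotp p (x j) \<zeta>\<bar> \<le> vnorm p (x j) * vnorm p \<zeta>" by (rule dotp_le)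
  also have "\<dots> \<le> X * r"
    using X[OF j] r order_trans[OF vnorm_nonneg X[OF j]] by (intro mult_mono) auto
  finally show "\<bar>dotp p (x j) \<zeta>\<bar> \<le> X * r" .
  with r(3) show "1/2 \<le> 1 + dotp p (x j) \<zeta>" by linarith
qed

text \<open>Of the two factors t in t^2, one is bounded uniformly by X r and the other is paired
  with f by Cauchy-Schwarz; the denominators, at least 1/2, cost the factor 2. This way only a
  single factor X, the worst of the rates, appears.\<close>

lemma el_second_order_bound:
  assumes X: "\<And>j. j < n \<Longrightarrow> vnorm p (x j) \<le> X" and r: "vnorm p \<zeta> \<le> r" "0 \<le> r" "X * r \<le> 1/2"
    and "0 \<le> X" "0 \<le> L" "0 \<le> F"
    and up: "(\<Sum>j<n. (dotp p (x j) \<zeta>)\<^sup>2) / real n \<le> L\<^sup>2 * (vnorm p \<zeta>)\<^sup>2"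
    and f: "(\<Sum>j<n. (f j)\<^sup>2) / real n \<le> F\<^sup>2"
  shows "\<bar>(\<Sum>j<n. f j * ((dotp p (x j) \<zeta>)\<^sup>2 / (1 + dotp p (x j) \<zeta>))) / real n\<bar> \<le> 2 * X * r\<^sup>2 * F * L"
proof -
  let ?t = "\<lambda>j. dotp p (x j) \<zeta>"
  have b: "\<bar>f j * ((?t j)\<^sup>2 / (1 + ?t j))\<bar> \<le> 2 * (X * r) * (\<bar>f j\<bar> * \<bar>?t j\<bar>)" if "j < n" for j
  proof -
    have t: "\<bar>?t j\<bar> \<le> X * r" "1/2 \<le> 1 + ?t j"
      using el_sol_bound[where x=x and n=n and p=p and X=X, OF _ r that] X by blast+
    have "\<bar>(?t j)\<^sup>2 / (1 + ?t j)\<bar> \<le> \<bar>?t j\<bar>\<^sup>2 / (1/2)"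
      using t(2) by (simp only: abs_divide power2_abs abs_power2) (intro divide_left_mono; simp)
    also have "\<dots> = 2 * \<bar>?t j\<bar> * \<bar>?t j\<bar>" by (simp add: power2_eq_square)
    also have "\<dots> \<le> 2 * (X * r) * \<bar>?t j\<bar>" using t(1) by (intro mult_right_mono) auto
    finally show ?thesis
      unfolding abs_mult[of "f j"] mult.left_commute[of "2 * (X * r)"] by (rule mult_left_mono) simp
  qed
  have "(\<Sum>j<n. (?t j)\<^sup>2) / real n \<le> (L * r)\<^sup>2"
    using up mult_left_mono[OF power_mono[OF r(1) vnorm_nonneg, of 2], of "L\<^sup>2"] by (simp add: power_mult_distrib)
  then have cs: "(\<Sum>j<n. \<bar>f j\<bar> * \<bar>?t j\<bar>) / real n \<le> F * (L * r)"
    using f assms by (intro mean_cauchy_schwarz) auto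
  have "\<bar>(\<Sum>j<n. f j * ((?t j)\<^sup>2 / (1 + ?t j))) / real n\<bar>
      \<le> (\<Sum>j<n. 2 * (X * r) * (\<bar>f j\<bar> * \<bar>?t j\<bar>)) / real n"
    by (rule order_trans[OF mean_abs mean_mono[OF b]])
  also have "\<dots> = 2 * (X * r) * ((\<Sum>j<n. \<bar>f j\<bar> * \<bar>?t j\<bar>) / real n)"
    by (simp add: sum_distrib_left)
  also have "\<dots> \<le> 2 * (X * r) * (F * (L * r))"
    using cs assms by (intro mult_left_mono) auto
  finally show ?thesis by (simp add: power2_eq_square mult_ac)
qed

text \<open>By 1/(1+t) = 1 - t + t^2/(1+t) the vector estimated here is exactly the mean of
  t^2/(1+t) times x. It is bounded by pairing it with itself.\<close>

lemma el_score_expansion: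
  assumes sol: "el_sol p n x \<zeta>"
    and X: "\<And>j. j < n \<Longrightarrow> vnorm p (x j) \<le> X" and r: "vnorm p \<zeta> \<le> r" "0 \<le> r" "X * r \<le> 1/2"
    and "0 \<le> X" "0 \<le> L"
    and up: "\<And>a. (\<Sum>j<n. (dotp p (x j) a)\<^sup>2) / real n \<le> L\<^sup>2 * (vnorm p a)\<^sup>2"
  shows "vnorm p (\<lambda>k. (\<Sum>j<n. x j k * dotp p (x j) \<zeta>) / real n - (\<Sum>j<n. x j k) / real n) \<le> 2 * X * r\<^sup>2 * L\<^sup>2"
    (is "vnorm p ?R \<le> _")
proof -
  let ?t = "\<lambda>j. dotp p (x j) \<zeta>"
  have R: "?R k = (\<Sum>j<n. ((?t j)\<^sup>2 / (1 + ?t j)) * x j k) / real n" if "k < p" for k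
  proof -
    have "x j k / (1 + ?t j) = x j k - x j k * ?t j + ((?t j)\<^sup>2 / (1 + ?t j)) * x j k" if "j < n" for j
    proof -
      have "1/2 \<le> 1 + ?t j"
        using el_sol_bound(2)[where x=x and n=n and p=p and X=X, OF _ r that] X by blast
      then have "1 + ?t j \<noteq> 0" by linarith
      then have "x j k / (1 + s) = x j k - x j k * s + (s\<^sup>2 / (1 + s)) * x j k" if "s = ?t j" for s
        using that by (simp add: field_simps power2_eq_square)
      then show ?thesis by blast
    qed
    then have "(\<Sum>j<n. x j k / (1 + ?t j)) / real n
       = (\<Sum>j<n. x j k - x j k * ?t j + ((?t j)\<^sup>2 / (1 + ?t j)) * x j k) / real n" by simp
    moreover have "(\<Sum>j<n. x j k / (1 + ?t j)) / real n = 0" using sol that by (auto simp: el_sol_def)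
    ultimately show ?thesis by (simp add: sum.distrib sum_subtractf diff_divide_distrib add_divide_distrib)
  qed
  have "(vnorm p ?R)\<^sup>2 = dotp p ?R ?R" by (simp only: dotp_self)
  also have "\<dots> = dotp p (\<lambda>k. (\<Sum>j<n. ((?t j)\<^sup>2 / (1 + ?t j)) * x j k) / real n) ?R"
    by (rule dotp_cong) (use R in auto)
  also have "\<dots> = (\<Sum>j<n. dotp p (x j) ?R * ((?t j)\<^sup>2 / (1 + ?t j))) / real n"
    unfolding dotp_mean by (simp add: mult.commute)
  \<comment> \<open>The previous bound with f j = x_j . R, whose mean square is at most (L |R|)^2 by
    \<open>up\<close>.\<close>
  also have "\<dots> \<le> 2 * X * r\<^sup>2 * (L * vnorm p ?R) * L"
    by (rule order_trans[OF abs_ge_self el_second_order_bound])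
       (use assms in \<open>auto simp: power_mult_distrib\<close>)
  also have "\<dots> = (2 * X * r\<^sup>2 * L\<^sup>2) * vnorm p ?R" by (simp add: power2_eq_square mult_ac)
  finally show ?thesis using assms by (intro vnorm_le_of_dotp) auto
qed

section \<open>The empirical Gram matrix and deterministic estimates for one sample\<close>

definition emp_gram :: "nat \<Rightarrow> (nat \<Rightarrow> nat \<Rightarrow> real) \<Rightarrow> nat \<Rightarrow> nat \<Rightarrow> real" where
  "emp_gram n x i k = (\<Sum>j<n. x j i * x j k) / real n"

lemma mvec_emp_gram: "mvec p (emp_gram n x) a k = (\<Sum>j<n. x j k * dotp p (x j) a) / real n"
proof -
  have "mvec p (emp_gram n x) a k = (\<Sum>i<p. \<Sum>j<n. x j k * x j i * a i) / real n"
    by (simp add: mvec_def emp_gram_def sum_divide_distrib sum_distrib_right)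
  also have "\<dots> = (\<Sum>j<n. \<Sum>i<p. x j k * x j i * a i) / real n" by (subst sum.swap) simp
  finally show ?thesis by (simp add: dotp_def sum_distrib_left mult.assoc)
qed

lemma quad_emp_gram: "dotp p a (mvec p (emp_gram n x) a) = (\<Sum>j<n. (dotp p (x j) a)\<^sup>2) / real n"
proof -
  have "dotp p a (mvec p (emp_gram n x) a) = dotp p (\<lambda>k. (\<Sum>j<n. dotp p (x j) a * x j k) / real n) a"
    unfolding dotp_commute[of p a] by (intro dotp_cong) (auto simp: mvec_emp_gram mult.commute)
  then show ?thesis unfolding dotp_mean by (simp add: power2_eq_square)
qed

lemma dotp_mvec_unit: "k < p \<Longrightarrow> dotp p (\<lambda>i. if i = k then 1 else 0) (mvec p A (\<lambda>i. if i = k then 1 else 0)) = A k k"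
  by (simp add: dotp_def mvec_def if_distrib if_distribR cong: if_cong)

lemma vnorm_unit: "k < p \<Longrightarrow> vnorm p (\<lambda>i. if i = k then 1 else 0) = 1"
  by (simp add: vnorm_def if_distrib[of "\<lambda>y. y\<^sup>2"] cong: if_cong)

lemma opnorm_nonneg:
  assumes "0 < p"
  shows "0 \<le> opnorm p A"
  using order_trans[OF vnorm_nonneg opnorm_bound[of p A "\<lambda>i. if i = 0 then 1 else 0"]] vnorm_unit[OF assms]
  by simp

lemma mvec_diff_matrix: "mvec p (\<lambda>i k. A i k - B i k) a = (\<lambda>k. mvec p A a k - mvec p B a k)"
  by (simp add: mvec_def left_diff_distrib sum_subtractf)

lemma dotp_mvec_sym:
  assumes "\<And>i k. A i k = A k i"
  shows "dotp p (mvec p A a) b = dotp p a (mvec p A b)"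
proof -
  have "dotp p (mvec p A a) b = (\<Sum>i<p. \<Sum>k<p. A i k * a k * b i)"
    by (simp add: dotp_def mvec_def sum_distrib_right)
  also have "\<dots> = (\<Sum>k<p. \<Sum>i<p. A k i * a k * b i)"
    by (subst sum.swap) (simp add: assms)
  also have "\<dots> = dotp p a (mvec p A b)"
    by (simp add: dotp_def mvec_def sum_distrib_left mult_ac)
  finally show ?thesis .
qed

text \<open>One fixed sample, no probability. X bounds the vectors, r is the radius searched, c and
  C bound the quadratic form of W, d bounds the spectral error. \<open>d \<le> c / 2\<close> leaves
  c / 2 as lower bound of the empirical form and \<open>d \<le> 1\<close> gives C + 1 as upper
  bound; c / 3 is 2/3 of c / 2, the threshold in \<open>el_sol_exists\<close>.\<close>

locale el_data =
  fixes n p :: nat and x :: "nat \<Rightarrow> nat \<Rightarrow> real" and W :: "nat \<Rightarrow> nat \<Rightarrow> real" and X r c C d :: real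
  assumes n: "0 < n" and p: "0 < p" and r: "0 < r" and c: "0 < c" and C: "0 \<le> C"
    and X: "\<And>j. j < n \<Longrightarrow> vnorm p (x j) \<le> X" and Xr: "X * r \<le> 1/2"
    and lower: "\<And>a. c * (vnorm p a)\<^sup>2 \<le> dotp p a (mvec p W a)"
    and upper: "\<And>a. dotp p a (mvec p W a) \<le> C * (vnorm p a)\<^sup>2"
    and d: "opnorm p (\<lambda>i k. emp_gram n x i k - W i k) \<le> d" "d \<le> c / 2" "d \<le> 1"
    and mean: "vnorm p (\<lambda>k. (\<Sum>j<n. x j k) / real n) < c / 3 * r"
begin

lemma gram_error: "vnorm p (\<lambda>k. mvec p (emp_gram n x) a k - mvec p W a k) \<le> d * vnorm p a"
  using opnorm_bound[of p "\<lambda>i k. emp_gram n x i k - W i k" a] mult_right_mono[OF d(1) vnorm_nonneg[of p a]]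
  by (simp add: mvec_diff_matrix)

lemma quad_error: "\<bar>(\<Sum>j<n. (dotp p (x j) a)\<^sup>2) / real n - dotp p a (mvec p W a)\<bar> \<le> d * (vnorm p a)\<^sup>2"
proof -
  have "(\<Sum>j<n. (dotp p (x j) a)\<^sup>2) / real n - dotp p a (mvec p W a)
      = dotp p a (\<lambda>k. mvec p (emp_gram n x) a k - mvec p W a k)"
    by (simp add: quad_emp_gram dotp_diff_right)
  also have "\<bar>\<dots>\<bar> \<le> vnorm p a * (d * vnorm p a)"
    by (rule order_trans[OF dotp_le mult_left_mono[OF gram_error vnorm_nonneg]])
  finally show ?thesis by (simp add: power2_eq_square mult_ac)
qed

lemma emp_lower: "c / 2 * (vnorm p a)\<^sup>2 \<le> (\<Sum>j<n. (dotp p (x j) a)\<^sup>2) / real n"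
  using quad_error[of a] lower[of a] mult_right_mono[OF d(2) zero_le_power2[of "vnorm p a"]] by argo

lemma emp_upper: "(\<Sum>j<n. (dotp p (x j) a)\<^sup>2) / real n \<le> (sqrt (C + 1))\<^sup>2 * (vnorm p a)\<^sup>2"
proof -
  have "(sqrt (C + 1))\<^sup>2 * (vnorm p a)\<^sup>2 = C * (vnorm p a)\<^sup>2 + 1 * (vnorm p a)\<^sup>2"
    using C by (simp add: distrib_right)
  then show ?thesis
    using quad_error[of a] upper[of a] mult_right_mono[OF d(3) zero_le_power2[of "vnorm p a"]] by argo
qed

lemma solution: "\<exists>!\<zeta>. el_sol p n x \<zeta>" and solution_bound: "el_sol p n x \<zeta> \<Longrightarrow> vnorm p \<zeta> \<le> r"
proof -
  have "\<exists>\<zeta>. el_sol p n x \<zeta> \<and> vnorm p \<zeta> \<le> r"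
  proof (rule el_sol_exists[OF n r _ emp_lower])
    show "vnorm p (x j) * r \<le> 1 / 2" if "j < n" for j
      using mult_right_mono[OF X[OF that], of r] r Xr by linarith
  qed (use mean in simp)
  then obtain \<xi> where \<xi>: "el_sol p n x \<xi>" "vnorm p \<xi> \<le> r" by blast
  have unique: "\<zeta> = \<xi>" if "el_sol p n x \<zeta>" for \<zeta>
    using el_sol_unique[OF n _ emp_lower that \<xi>(1)] c by simp
  show "\<exists>!\<zeta>. el_sol p n x \<zeta>" using \<xi>(1) unique by blast
  show "el_sol p n x \<zeta> \<Longrightarrow> vnorm p \<zeta> \<le> r" using \<xi>(2) unique by blast
qed

text \<open>Here \<alpha> stands for W^{-1} g. Symmetry gives g . zeta = \<alpha> . (W zeta), so it
  is enough that W zeta is close to \<open>vb\<close>; zeta itself is never approximated. In the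
  application \<alpha> . \<open>vb\<close> is the sample mean of the projection of a component of
  psi.\<close>

lemma linearization:
  assumes sym: "\<And>i k. W i k = W k i" and sol: "el_sol p n x \<zeta>"
    and \<alpha>: "\<And>k. k < p \<Longrightarrow> mvec p W \<alpha> k = g k" "vnorm p \<alpha> \<le> A"
    and \<beta>: "vnorm p (\<lambda>k. (\<Sum>j<n. x j k) / real n - vb k) \<le> \<beta>"
    and \<gamma>: "vnorm p (\<lambda>k. (\<Sum>j<n. f j * x j k) / real n - g k) \<le> \<gamma>"
    and F: "(\<Sum>j<n. (f j)\<^sup>2) / real n \<le> F\<^sup>2" "0 \<le> F"
  shows "\<bar>(\<Sum>j<n. f j / (1 + dotp p (x j) \<zeta>)) / real n - ((\<Sum>j<n. f j) / real n - dotp p \<alpha> vb)\<bar>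
    \<le> 2 * X * r\<^sup>2 * F * sqrt (C + 1) + \<gamma> * r + A * (\<beta> + 2 * X * r\<^sup>2 * (C + 1) + d * r)"
proof -
  let ?t = "\<lambda>j. dotp p (x j) \<zeta>"
  let ?xb = "\<lambda>k. (\<Sum>j<n. x j k) / real n"
  let ?G = "\<lambda>k. (\<Sum>j<n. f j * x j k) / real n"
  have \<zeta>: "vnorm p \<zeta> \<le> r" by (rule solution_bound[OF sol])
  have X0: "0 \<le> X" using order_trans[OF vnorm_nonneg X[OF n]] .
  have A0: "0 \<le> A" using order_trans[OF vnorm_nonneg \<alpha>(2)] .
  define R where "R = (\<Sum>j<n. f j * ((?t j)\<^sup>2 / (1 + ?t j))) / real n"
  have R: "\<bar>R\<bar> \<le> 2 * X * r\<^sup>2 * F * sqrt (C + 1)"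
    unfolding R_def using X \<zeta> r Xr X0 C F emp_upper by (intro el_second_order_bound) auto
  have e: "f j / (1 + s) = f j - f j * s + f j * (s\<^sup>2 / (1 + s))" if "1/2 \<le> 1 + s" for j s
  proof -
    have "1 + s \<noteq> 0" using that by linarith
    then show ?thesis by (simp add: field_simps power2_eq_square)
  qed
  have t: "1/2 \<le> 1 + ?t j" if "j < n" for j
    using el_sol_bound(2)[where x=x and n=n and p=p and X=X, OF _ \<zeta> less_imp_le[OF r] Xr that] X by blast
  have "(\<Sum>j<n. f j / (1 + ?t j)) / real n = (\<Sum>j<n. f j - f j * ?t j + f j * ((?t j)\<^sup>2 / (1 + ?t j))) / real n"
    using e[OF t] by (intro arg_cong[where f="\<lambda>y. y / real n"] sum.cong) auto
  also have "\<dots> = (\<Sum>j<n. f j) / real n - dotp p ?G \<zeta> + R"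
    unfolding R_def dotp_mean by (simp only: sum.distrib sum_subtractf add_divide_distrib diff_divide_distrib)
  finally have 1: "(\<Sum>j<n. f j / (1 + ?t j)) / real n = (\<Sum>j<n. f j) / real n - dotp p ?G \<zeta> + R" .
  have "dotp p ?G \<zeta> = dotp p (\<lambda>k. ?G k - g k) \<zeta> + dotp p g \<zeta>" by (simp add: dotp_diff_left)
  also have "dotp p g \<zeta> = dotp p \<alpha> (mvec p W \<zeta>)"
    using dotp_mvec_sym[where p=p and a=\<alpha> and b=\<zeta>, OF sym] dotp_cong[of p g "mvec p W \<alpha>" \<zeta> \<zeta>] \<alpha>(1) by simp
  finally have 2: "dotp p ?G \<zeta> = dotp p (\<lambda>k. ?G k - g k) \<zeta> + dotp p \<alpha> (mvec p W \<zeta>)" .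
  have 3: "\<bar>dotp p (\<lambda>k. ?G k - g k) \<zeta>\<bar> \<le> \<gamma> * r"
    by (rule order_trans[OF dotp_le mult_mono[OF \<gamma> \<zeta>]]) (use order_trans[OF vnorm_nonneg \<gamma>] in auto)
  \<comment> \<open>W zeta is compared with the empirical Gram matrix applied to zeta, then with the
    mean of x, then with \<open>vb\<close>; the errors are d r, the score remainder and
    \<beta>.\<close>
  have "vnorm p (\<lambda>k. mvec p W \<zeta> k - vb k) \<le> \<beta> + 2 * X * r\<^sup>2 * (C + 1) + d * r"
  proof -
    let ?S = "mvec p (emp_gram n x) \<zeta>"
    have "vnorm p (\<lambda>k. mvec p W \<zeta> k - ?S k) \<le> d * vnorm p \<zeta>"
      using gram_error[of \<zeta>] vnorm_scale[of p "-1" "\<lambda>k. ?S k - mvec p W \<zeta> k"] by simp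
    also have "\<dots> \<le> d * r"
      using opnorm_nonneg[OF p] d(1) by (intro mult_left_mono[OF \<zeta>]) (rule order_trans)
    finally have a: "vnorm p (\<lambda>k. mvec p W \<zeta> k - ?S k) \<le> d * r" .
    have b: "vnorm p (\<lambda>k. ?S k - ?xb k) \<le> 2 * X * r\<^sup>2 * (sqrt (C + 1))\<^sup>2"
      unfolding mvec_emp_gram using X \<zeta> r Xr X0 C sol emp_upper by (intro el_score_expansion) auto
    have "vnorm p (\<lambda>k. mvec p W \<zeta> k - vb k)
        \<le> vnorm p (\<lambda>k. mvec p W \<zeta> k - ?S k) + (vnorm p (\<lambda>k. ?S k - ?xb k) + vnorm p (\<lambda>k. ?xb k - vb k))"
      using vnorm_triangle[of p "\<lambda>k. mvec p W \<zeta> k - ?S k" "\<lambda>k. ?S k - vb k"]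
        vnorm_triangle[of p "\<lambda>k. ?S k - ?xb k" "\<lambda>k. ?xb k - vb k"] by simp
    then show ?thesis using a b \<beta> C by simp
  qed
  then have 4: "\<bar>dotp p \<alpha> (mvec p W \<zeta>) - dotp p \<alpha> vb\<bar> \<le> A * (\<beta> + 2 * X * r\<^sup>2 * (C + 1) + d * r)"
    unfolding dotp_diff_right[symmetric]
    by (intro order_trans[OF dotp_le] mult_mono \<alpha>(2) A0) auto
  show ?thesis unfolding 1 2 using R 3 4 by argo
qed

end

section \<open>Square roots of positive semidefinite matrices\<close>

text \<open>A parabola through 0 that is nowhere negative has zero slope there. This is the first
  variation argument at a maximum of a Rayleigh quotient.\<close>

lemma psd_form_null:
  fixes g b :: real
  assumes "\<And>t. 0 \<le> 2 * t * b + t\<^sup>2 * g"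
  shows "b = 0"
proof (rule ccontr)
  assume b: "b \<noteq> 0"
  have g: "0 \<le> g" using assms[of 1] assms[of "-1"] by simp
  \<comment> \<open>The quadratic is smallest at t = - b / g; the shift by 1 allows g = 0 and still
    gives a negative value at t = - h.\<close>
  define h where "h = b / (g + 1)"
  have h: "h \<noteq> 0" "b = h * (g + 1)" using b g by (auto simp: h_def)
  have "2 * (- h) * b + (- h)\<^sup>2 * g = - (h\<^sup>2 * (g + 2))"
    unfolding h(2) by (simp add: algebra_simps power2_eq_square)
  moreover have "0 < h\<^sup>2 * (g + 2)" using h g by (intro mult_pos_pos) auto
  ultimately show False using assms[of "- h"] by linarith
qed

text \<open>Maximise x . f x on the unit sphere of S. The perturbation tested is the residual w = f
  x - l x itself, which lies in S by invariance; stationarity yields l (x . w) = f x . w, hence w .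
  w = 0.\<close>

lemma self_adjoint_eigenvector:
  fixes f :: "'a::euclidean_space \<Rightarrow> 'a"
  assumes lin: "linear f" and sym: "\<And>x y. f x \<bullet> y = x \<bullet> f y"
    and S: "subspace S" "\<And>x. x \<in> S \<Longrightarrow> f x \<in> S" "S \<noteq> {0}"
  obtains x l where "x \<in> S" "norm x = 1" "f x = l *\<^sub>R x"
proof -
  interpret linear f by fact
  from S obtain z where z: "z \<in> S" "z \<noteq> 0" using subspace_0[OF S(1)] by auto
  have "compact (sphere 0 1 \<inter> S)" by (intro compact_Int_closed compact_sphere closed_subspace S(1))
  moreover have "(1 / norm z) *\<^sub>R z \<in> sphere 0 1 \<inter> S" using z S by (auto intro: subspace_scale)
  moreover have "continuous_on (sphere 0 1 \<inter> S) (\<lambda>x. x \<bullet> f x)"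
    by (intro continuous_intros linear_continuous_on linear_conv_bounded_linear[THEN iffD1] lin)
  ultimately obtain x where "x \<in> sphere 0 1 \<inter> S" "\<forall>y\<in>sphere 0 1 \<inter> S. y \<bullet> f y \<le> x \<bullet> f x"
    using continuous_attains_sup[of "sphere 0 1 \<inter> S" "\<lambda>x. x \<bullet> f x"] by blast
  then have x: "x \<in> S" "norm x = 1"
    and max: "\<And>y. y \<in> S \<Longrightarrow> norm y = 1 \<Longrightarrow> y \<bullet> f y \<le> x \<bullet> f x"
    by auto
  define l where "l = x \<bullet> f x"
  have form: "0 \<le> l * (y \<bullet> y) - y \<bullet> f y" if y: "y \<in> S" for y
  proof (cases "y = 0")
    case False
    have "((1 / norm y) *\<^sub>R y) \<bullet> f ((1 / norm y) *\<^sub>R y) \<le> l"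
      unfolding l_def using False y S by (intro max) (auto intro: subspace_scale)
    then have "(y \<bullet> f y) / (norm y)\<^sup>2 \<le> l" by (simp add: scaleR power2_eq_square)
    then show ?thesis using False by (simp add: pos_divide_le_eq power2_norm_eq_inner)
  qed simp
  define w where "w = f x - l *\<^sub>R x"
  have w: "w \<in> S" unfolding w_def using x S by (auto intro: subspace_diff subspace_scale)
  have xx: "x \<bullet> x = 1" using x by (simp add: dot_square_norm)
  have "l * (x \<bullet> w) - f x \<bullet> w = 0"
  proof (rule psd_form_null)
    fix t :: real
    have "x + t *\<^sub>R w \<in> S" using x w S by (auto intro: subspace_add subspace_scale)
    from form[OF this] show "0 \<le> 2 * t * (l * (x \<bullet> w) - f x \<bullet> w) + t\<^sup>2 * (l * (w \<bullet> w) - w \<bullet> f w)"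
      using xx by (simp add: add scaleR inner_add_left inner_add_right l_def algebra_simps
          power2_eq_square sym[of x w, symmetric] inner_commute[of w "f x"] inner_commute[of w x])
  qed
  moreover have "f x = w + l *\<^sub>R x" by (simp add: w_def)
  ultimately have "w \<bullet> w = 0" by (simp add: inner_add_left)
  then have "f x = l *\<^sub>R x" by (simp add: w_def)
  with x that show ?thesis by blast
qed

text \<open>By symmetry the complement of an eigenvector within S is invariant again. Stating the
  result for invariant subspaces lets the induction on the dimension pass to that
  complement.\<close>

theorem self_adjoint_eigenbasis:
  fixes f :: "'a::euclidean_space \<Rightarrow> 'a"
  assumes lin: "linear f" and sym: "\<And>x y. f x \<bullet> y = x \<bullet> f y"
    and "subspace S" "\<And>x. x \<in> S \<Longrightarrow> f x \<in> S"
  shows "\<exists>B. finite B \<and> B \<subseteq> S \<and> pairwise orthogonal B \<and> (\<forall>b\<in>B. norm b = 1)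
      \<and> span B = S \<and> (\<forall>b\<in>B. \<exists>l. f b = l *\<^sub>R b)"
  using assms(3,4)
proof (induction "dim S" arbitrary: S rule: less_induct)
  case less
  show ?case
  proof (cases "S = {0}")
    case True
    then show ?thesis by (intro exI[of _ "{}"]) auto
  next
    case False
    obtain x l where x: "x \<in> S" "norm x = 1" "f x = l *\<^sub>R x"
      using self_adjoint_eigenvector[OF lin sym less.prems False] by blast
    have xx: "x \<bullet> x = 1" using x by (simp add: dot_square_norm)
    define T where "T = {y \<in> S. x \<bullet> y = 0}"
    have subT: "subspace T"
      using less.prems(1) unfolding T_def subspace_def by (auto simp: inner_add_right)
    have fT: "f y \<in> T" if "y \<in> T" for y
      using that less.prems(2) sym[of x y] x by (auto simp: T_def)
    have "x \<notin> T" using xx by (simp add: T_def)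
    moreover have "T \<subseteq> S" by (auto simp: T_def)
    ultimately have "T \<subset> S" using x(1) by blast
    then have "dim T < dim S" using less.prems(1) subT by (intro dim_psubset) (simp add: span_eq_iff[THEN iffD2])
    from less.hyps[OF this subT fT] obtain B where B: "finite B" "B \<subseteq> T" "pairwise orthogonal B"
      "\<forall>b\<in>B. norm b = 1" "span B = T" "\<forall>b\<in>B. \<exists>l. f b = l *\<^sub>R b" by blast
    have "span (insert x B) = S"
    proof
      show "span (insert x B) \<subseteq> S"
        using x B less.prems(1) by (intro span_minimal) (auto simp: T_def)
      show "S \<subseteq> span (insert x B)"
      proof
        fix y assume y: "y \<in> S"
        have "y - (x \<bullet> y) *\<^sub>R x \<in> T"
          using y x less.prems(1) xx by (auto simp: T_def inner_diff_right intro: subspace_diff subspace_scale)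
        then show "y \<in> span (insert x B)" using B(5) by (auto simp: span_insert)
      qed
    qed
    moreover have "pairwise orthogonal (insert x B)"
      using B(2,3) by (auto simp: pairwise_insert T_def orthogonal_def inner_commute)
    ultimately show ?thesis using B x by (intro exI[of _ "insert x B"]) (auto simp: T_def)
  qed
qed

lemma symmetric_matrix_inner:
  fixes A :: "real^'n^'n"
  assumes "transpose A = A"
  shows "(A *v x) \<bullet> y = x \<bullet> (A *v y)"
  using dot_lmul_matrix[of x A y] assms by (metis inner_commute transpose_matrix_vector)

lemma symmetric_matrix_eigenbasis:
  fixes A :: "real^'n^'n"
  assumes "transpose A = A"
  obtains B l where "finite B" "pairwise orthogonal B" "\<And>b. b \<in> B \<Longrightarrow> norm b = 1" "span B = UNIV"
    "\<And>b. b \<in> B \<Longrightarrow> A *v b = l b *\<^sub>R b"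
proof -
  obtain B where "finite B" "pairwise orthogonal B" "\<forall>b\<in>B. norm b = 1" "span B = UNIV"
    "\<forall>b\<in>B. \<exists>l. A *v b = l *\<^sub>R b"
    using self_adjoint_eigenbasis[of "(*v) A" UNIV] symmetric_matrix_inner[OF assms] by auto
  then show ?thesis using that by metis
qed

lemma matrix_eq_on_basis:
  fixes A B :: "real^'n^'n"
  assumes "span X = UNIV" "\<And>b. b \<in> X \<Longrightarrow> A *v b = B *v b"
  shows "A = B"
  using linear_eq_on_span[of "(*v) A" "(*v) B" X] assms by (auto simp: matrix_eq)

lemma psd_sqrt_exists:
  fixes S :: "real^'n^'n"
  assumes sym: "transpose S = S" and psd: "\<And>x. 0 \<le> x \<bullet> (S *v x)"
  shows "\<exists>A. transpose A = A \<and> (\<forall>x. 0 \<le> x \<bullet> (A *v x)) \<and> A ** A = S"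
proof -
  obtain B l where B: "finite B" "pairwise orthogonal B" "\<And>b. b \<in> B \<Longrightarrow> norm b = 1" "span B = UNIV"
    and l: "\<And>b. b \<in> B \<Longrightarrow> S *v b = l b *\<^sub>R b"
    using symmetric_matrix_eigenbasis[OF sym] by blast
  have inner: "b \<bullet> c = (if b = c then 1 else 0)" if "b \<in> B" "c \<in> B" for b c
    using that B by (auto simp: pairwise_def orthogonal_def dot_square_norm)
  have l0: "0 \<le> l b" if "b \<in> B" for b using psd[of b] l[OF that] inner[OF that that] by simp
  \<comment> \<open>On b this multiplies by the root of its eigenvalue; written through inner
    products it is linear and symmetric by inspection.\<close>
  define f where "f x = (\<Sum>b\<in>B. (sqrt (l b) * (b \<bullet> x)) *\<^sub>R b)" for x
  have lin: "linear f"
    unfolding f_def by (intro linearI)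
      (auto simp: inner_add_right distrib_left scaleR_add_left sum.distrib scaleR_sum_right mult_ac)
  define A where "A = matrix f"
  have A: "A *v x = f x" for x using lin by (simp add: A_def)
  have fsym: "x \<bullet> f y = f x \<bullet> y" for x y
    unfolding f_def inner_sum_left inner_sum_right by (intro sum.cong) (auto simp: inner_commute)
  have fb: "f b = sqrt (l b) *\<^sub>R b" if "b \<in> B" for b
  proof -
    have "f b = (\<Sum>c\<in>B. if c = b then sqrt (l b) *\<^sub>R b else 0)"
      unfolding f_def using inner that by (intro sum.cong) auto
    then show ?thesis using B that by simp
  qed
  have "transpose A = A"
  proof -
    have "(transpose A *v x) \<bullet> y = (A *v x) \<bullet> y" for x y
      by (metis A dot_lmul_matrix fsym transpose_matrix_vector)
    then show ?thesis by (metis matrix_eq vector_eq_rdot)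
  qed
  moreover have "0 \<le> x \<bullet> (A *v x)" for x
    unfolding A f_def inner_sum_right using l0
    by (intro sum_nonneg) (simp add: inner_commute[of x] mult.assoc)
  moreover have "A ** A = S"
    using B(4)
  proof (rule matrix_eq_on_basis)
    fix b assume b: "b \<in> B"
    then show "(A ** A) *v b = S *v b"
      using l0[OF b] by (simp add: matrix_vector_mul_assoc[symmetric] A fb linear_scale[OF lin] l)
  qed
  ultimately show ?thesis by blast
qed

text \<open>On an eigenvector b of B with eigenvalue l, the factorisation A^2 - l^2 = (A + l)(A - l)
  gives A y = - l y for y = A b - l b. Positivity of A forces y = 0 when l > 0, and for l = 0 one
  has |A b|^2 = b . A^2 b = 0. This avoids a common eigenbasis of A and B.\<close>

lemma psd_sqrt_unique:
  fixes A B :: "real^'n^'n"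
  assumes A: "transpose A = A" "\<And>x. 0 \<le> x \<bullet> (A *v x)"
    and B: "transpose B = B" "\<And>x. 0 \<le> x \<bullet> (B *v x)"
    and eq: "A ** A = B ** B"
  shows "A = B"
proof -
  obtain X l where X: "finite X" "pairwise orthogonal X" "\<And>b. b \<in> X \<Longrightarrow> norm b = 1" "span X = UNIV"
    and l: "\<And>b. b \<in> X \<Longrightarrow> B *v b = l b *\<^sub>R b"
    using symmetric_matrix_eigenbasis[OF B(1)] by blast
  have "A *v b = B *v b" if b: "b \<in> X" for b
  proof -
    have l0: "0 \<le> l b" using B(2)[of b] l[OF b] X(3)[OF b] by (simp add: dot_square_norm)
    have AAb: "A *v (A *v b) = (l b * l b) *\<^sub>R b"
      using eq l[OF b] by (simp add: matrix_vector_mul_assoc) (simp add: matrix_vector_mul_assoc[symmetric] matrix_vector_mult_scaleR)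
    define y where "y = A *v b - l b *\<^sub>R b"
    have Ay: "A *v y = - (l b *\<^sub>R y)"
      by (simp add: y_def matrix_vector_mult_diff_distrib matrix_vector_mult_scaleR AAb algebra_simps)
    have "y = 0"
    proof (cases "l b = 0")
      case True
      have "(A *v b) \<bullet> (A *v b) = b \<bullet> (A *v (A *v b))" by (rule symmetric_matrix_inner[OF A(1)])
      also have "\<dots> = 0" using AAb True by simp
      finally show ?thesis using True by (simp add: y_def)
    next
      case False
      have "0 \<le> - (l b * (y \<bullet> y))" using A(2)[of y] Ay by simp
      then have "y \<bullet> y \<le> 0" using False l0 by (simp add: mult_le_0_iff)
      then show ?thesis by (metis inner_eq_zero_iff inner_ge_zero order_antisym)
    qed
    then show ?thesis using l[OF b] by (simp add: y_def)
  qed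
  then show ?thesis by (rule matrix_eq_on_basis[OF X(4)])
qed

lemma psd_sqrt_properties:
  fixes S :: "real^'n^'n"
  assumes "transpose S = S" "\<And>x. 0 \<le> x \<bullet> (S *v x)"
  shows "transpose (psd_sqrt S) = psd_sqrt S" "psd_sqrt S ** psd_sqrt S = S"
proof -
  have "\<exists>!A. transpose A = A \<and> (\<forall>x. 0 \<le> x \<bullet> (A *v x)) \<and> A ** A = S"
    using psd_sqrt_exists[OF assms] psd_sqrt_unique by blast
  from theI'[OF this] show "transpose (psd_sqrt S) = psd_sqrt S" "psd_sqrt S ** psd_sqrt S = S"
    unfolding psd_sqrt_def by auto
qed

section \<open>Multivariate weak convergence\<close>

text \<open>The phase s covers sines (s = - pi/2) as well as constants (t = 0), so finite sums of
  such waves suffice and their integrals are determined by the characteristic function.\<close>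

inductive trig_poly :: "('b::real_inner \<Rightarrow> real) \<Rightarrow> bool" where
  wave: "trig_poly (\<lambda>x. c * cos (t \<bullet> x + s))"
| add: "trig_poly f \<Longrightarrow> trig_poly g \<Longrightarrow> trig_poly (\<lambda>x. f x + g x)"

lemma trig_poly_const: "trig_poly (\<lambda>_. c)"
  using trig_poly.wave[of c 0 0] by simp

lemma trig_poly_sum:
  "finite I \<Longrightarrow> (\<And>i. i \<in> I \<Longrightarrow> trig_poly (f i)) \<Longrightarrow> trig_poly (\<lambda>x. \<Sum>i\<in>I. f i x)"
  by (induction I rule: finite_induct) (auto intro: trig_poly_const trig_poly.add)

text \<open>The product to sum formula. With closure under sums it puts every polynomial in the
  coordinates of the torus map below into this class.\<close>

lemma trig_poly_mult:
  assumes "trig_poly f" "trig_poly g"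
  shows "trig_poly (\<lambda>x. f x * g x)"
  using assms(1)
proof induction
  case (wave c t s)
  show ?case
    using assms(2)
  proof induction
    case (wave d u r)
    have "trig_poly (\<lambda>x. (c * d / 2) * cos ((t - u) \<bullet> x + (s - r)) + (c * d / 2) * cos ((t + u) \<bullet> x + (s + r)))"
      by (intro trig_poly.intros)
    moreover have "(c * d / 2) * cos ((t - u) \<bullet> x + (s - r)) + (c * d / 2) * cos ((t + u) \<bullet> x + (s + r))
        = c * cos (t \<bullet> x + s) * (d * cos (u \<bullet> x + r))" for x
    proof -
      have "cos (t \<bullet> x + s) * cos (u \<bullet> x + r)
          = (cos ((t \<bullet> x + s) - (u \<bullet> x + r)) + cos ((t \<bullet> x + s) + (u \<bullet> x + r))) / 2"
        by (rule cos_times_cos)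
      moreover have "(t \<bullet> x + s) - (u \<bullet> x + r) = (t - u) \<bullet> x + (s - r)"
        "(t \<bullet> x + s) + (u \<bullet> x + r) = (t + u) \<bullet> x + (s + r)"
        by (simp_all add: inner_diff_left inner_add_left)
      ultimately have "cos (t \<bullet> x + s) * cos (u \<bullet> x + r)
          = (cos ((t - u) \<bullet> x + (s - r)) + cos ((t + u) \<bullet> x + (s + r))) / 2" by simp
      then have "c * d * (cos (t \<bullet> x + s) * cos (u \<bullet> x + r))
          = c * d * ((cos ((t - u) \<bullet> x + (s - r)) + cos ((t + u) \<bullet> x + (s + r))) / 2)" by simp
      then show ?thesis by (simp add: algebra_simps)
    qed
    ultimately show ?case by simp
  next
    case (add f g)
    then show ?case using trig_poly.add[OF add.IH] by (simp add: distrib_left)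
  qed
next
  case (add f h)
  then show ?case using trig_poly.add[OF add.IH] by (simp add: distrib_right)
qed

text \<open>The integral of a wave is the real part of a fixed phase times the characteristic
  function, so convergence passes to finite sums.\<close>

lemma trig_poly_integral_tendsto:
  fixes \<mu> :: "nat \<Rightarrow> 'b::euclidean_space measure"
  assumes \<mu>: "\<And>n. prob_space (\<mu> n)" "\<And>n. sets (\<mu> n) = sets borel"
    and L: "prob_space L" "sets L = sets borel"
    and conv: "\<And>t. (\<lambda>n. integral\<^sup>L (\<mu> n) (\<lambda>x. iexp (t \<bullet> x))) \<longlonglongrightarrow> integral\<^sup>L L (\<lambda>x. iexp (t \<bullet> x))"
    and f: "trig_poly f"
  shows "(\<lambda>n. integral\<^sup>L (\<mu> n) f) \<longlonglongrightarrow> integral\<^sup>L L f"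
    and "\<And>n. integrable (\<mu> n) f" and "integrable L f"
proof -
  have wave_int: "integrable N (\<lambda>x. c * cos (t \<bullet> x + s))"
      "integral\<^sup>L N (\<lambda>x. c * cos (t \<bullet> x + s)) = c * Re (iexp s * integral\<^sup>L N (\<lambda>x. iexp (t \<bullet> x)))"
    if N: "prob_space N" "sets N = sets borel" for N :: "'b measure" and c t s
  proof -
    interpret prob_space N by fact
    note [measurable_cong] = N(2)
    have i: "integrable N (\<lambda>x. iexp (t \<bullet> x))"
      by (rule integrable_const_bound[where B=1]) auto
    have e: "cos (t \<bullet> x + s) = Re (iexp s * iexp (t \<bullet> x))" for x
      by (simp add: exp_add[symmetric] distrib_left[symmetric] add.commute Re_exp)
    have i2: "integrable N (\<lambda>x. iexp s * iexp (t \<bullet> x))" using i by simp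
    show "integrable N (\<lambda>x. c * cos (t \<bullet> x + s))"
      unfolding e using integrable_Re[OF i2] by simp
    have "integral\<^sup>L N (\<lambda>x. c * cos (t \<bullet> x + s)) = c * integral\<^sup>L N (\<lambda>x. Re (iexp s * iexp (t \<bullet> x)))"
      unfolding e by simp
    also have "\<dots> = c * Re (iexp s * integral\<^sup>L N (\<lambda>x. iexp (t \<bullet> x)))"
      using integral_Re[OF i2] i by simp
    finally show "integral\<^sup>L N (\<lambda>x. c * cos (t \<bullet> x + s)) = c * Re (iexp s * integral\<^sup>L N (\<lambda>x. iexp (t \<bullet> x)))" .
  qed
  have "(\<lambda>n. integral\<^sup>L (\<mu> n) f) \<longlonglongrightarrow> integral\<^sup>L L f \<and> (\<forall>n. integrable (\<mu> n) f) \<and> integrable L f"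
    using f
  proof induction
    case (wave c t s)
    show ?case
      using wave_int(1)[OF \<mu>] wave_int(1)[OF L] unfolding wave_int(2)[OF \<mu>] wave_int(2)[OF L]
      by (intro conjI allI tendsto_intros conv) auto
  next
    case (add f g)
    then show ?case by (auto intro!: tendsto_add)
  qed
  then show "(\<lambda>n. integral\<^sup>L (\<mu> n) f) \<longlonglongrightarrow> integral\<^sup>L L f" "\<And>n. integrable (\<mu> n) f" "integrable L f" by auto
qed

text \<open>The bound outside the ball is what lets tightness control the error there: a trigonometric
  polynomial that is close to f on a ball only could be arbitrarily large elsewhere.\<close>

lemma uniform_trig_approx_on_ball:
  fixes f :: "'b::euclidean_space \<Rightarrow> real"
  assumes f: "continuous_on UNIV f" "\<And>x. \<bar>f x\<bar> \<le> C" and R: "R > 0" and e: "e > 0"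
  obtains g where "trig_poly g" "\<And>x. norm x \<le> R \<Longrightarrow> \<bar>f x - g x\<bar> \<le> e" "\<And>x. \<bar>g x\<bar> \<le> C + e"
proof -
  \<comment> \<open>For |x| <= R each a x_i lies in [- pi/2, pi/2], where the sine is injective. The
    sine half of T therefore separates the points of the ball.\<close>
  define a where "a = pi / (2 * R)"
  define T :: "'b \<Rightarrow> 'b \<times> 'b" where
    "T x = ((\<Sum>i\<in>Basis. cos (a * (x \<bullet> i)) *\<^sub>R i), (\<Sum>i\<in>Basis. sin (a * (x \<bullet> i)) *\<^sub>R i))" for x
  have a: "a > 0" "a * R = pi / 2" using R by (auto simp: a_def)
  have contT: "continuous_on S T" for S unfolding T_def by (intro continuous_intros)
  have inj: "inj_on T (cball 0 R)"
  proof (rule inj_onI)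
    fix x y assume xy: "x \<in> cball 0 R" "y \<in> cball 0 R" "T x = T y"
    show "x = y"
    proof (rule euclidean_eqI)
      fix i :: 'b assume i: "i \<in> Basis"
      have "snd (T x) \<bullet> i = snd (T y) \<bullet> i" using xy by simp
      then have s: "sin (a * (x \<bullet> i)) = sin (a * (y \<bullet> i))"
        using i by (simp add: T_def)
      have bd: "\<bar>a * (z \<bullet> i)\<bar> \<le> pi / 2" if "z \<in> cball 0 R" for z
      proof -
        have "\<bar>z \<bullet> i\<bar> \<le> R" using that Basis_le_norm[OF i, of z] by simp
        then have "a * \<bar>z \<bullet> i\<bar> \<le> a * R" using a(1) by (intro mult_left_mono) auto
        then show ?thesis using a by (simp add: abs_mult)
      qed
      have "a * (x \<bullet> i) = a * (y \<bullet> i)"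
        using abs_le_D1[OF bd[OF xy(1)]] abs_le_D2[OF bd[OF xy(1)]]
          abs_le_D1[OF bd[OF xy(2)]] abs_le_D2[OF bd[OF xy(2)]]
        by (intro sin_inj_pi[OF _ _ _ _ s]) linarith+
      then show "x \<bullet> i = y \<bullet> i" using a by simp
    qed
  qed
  define K where "K = T ` cball 0 R"
  define G where "G = f \<circ> inv_into (cball 0 R) T"
  have "continuous_on K (inv_into (cball 0 R) T)"
    unfolding K_def by (rule continuous_on_inv[OF contT compact_cball]) (simp add: inv_into_f_f[OF inj])
  then have "continuous_on K G"
    unfolding G_def by (rule continuous_on_compose[OF _ continuous_on_subset[OF f(1) subset_UNIV]])
  moreover have "closedin (top_of_set UNIV) K"
    unfolding K_def by (simp add: closed_closedin[symmetric] compact_imp_closed compact_continuous_image contT)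
  moreover have "0 \<le> C" using f(2)[of 0] by linarith
  moreover have "norm (G y) \<le> C" for y using f(2) by (simp add: G_def)
  \<comment> \<open>Tietze preserves the bound C off the image of the ball; this is the source of
    the bound on g everywhere.\<close>
  ultimately obtain F where F: "continuous_on UNIV F" "\<And>y. y \<in> K \<Longrightarrow> F y = G y" "\<And>y. norm (F y) \<le> C"
    using Tietze[of K G UNIV C] by auto
  have FT: "F (T x) = f x" if "norm x \<le> R" for x
  proof -
    have "x \<in> cball 0 R" using that by simp
    then show ?thesis using F(2)[of "T x"] inj by (auto simp: K_def G_def inv_into_f_f)
  qed
  \<comment> \<open>Each half of T x has norm at most the dimension, so T maps the whole space into
    one compact ball, on which Stone-Weierstrass applies.\<close>
  define b where "b = 2 * real DIM('b)"
  have Tb: "T x \<in> cball 0 b" for x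
  proof -
    have "norm (fst (T x)) \<le> (\<Sum>i\<in>(Basis::'b set). 1)" "norm (snd (T x)) \<le> (\<Sum>i\<in>(Basis::'b set). 1)"
      unfolding T_def fst_conv snd_conv by (intro sum_norm_le; simp)+
    then show ?thesis using norm_Pair_le[of "fst (T x)" "snd (T x)"] by (simp add: b_def)
  qed
  obtain P where P: "real_polynomial_function P" "\<And>y. y \<in> cball 0 b \<Longrightarrow> \<bar>F y - P y\<bar> < e"
    using Stone_Weierstrass_real_polynomial_function[OF compact_cball continuous_on_subset[OF F(1) subset_UNIV] e]
    by blast
  have "trig_poly (\<lambda>x. P (T x))"
    using P(1)
  proof induction
    case (linear h)
    interpret bounded_linear h by fact
    have "h (T x) = (\<Sum>i\<in>Basis. h (i, 0) * cos ((a *\<^sub>R i) \<bullet> x + 0))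
        + (\<Sum>i\<in>Basis. h (0, i) * cos ((a *\<^sub>R i) \<bullet> x + (- pi / 2)))" for x
    proof -
      have "T x = (\<Sum>i\<in>Basis. cos (a * (x \<bullet> i)) *\<^sub>R (i, 0)) + (\<Sum>i\<in>Basis. sin (a * (x \<bullet> i)) *\<^sub>R (0, i))"
        by (simp add: T_def prod_eq_iff fst_sum snd_sum)
      then have "h (T x) = (\<Sum>i\<in>Basis. cos (a * (x \<bullet> i)) * h (i, 0)) + (\<Sum>i\<in>Basis. sin (a * (x \<bullet> i)) * h (0, i))"
        by (simp only: add sum scaleR real_scaleR_def)
      then show ?thesis by (simp add: inner_commute[of _ x] mult.commute[of "h _"] cos_diff)
    qed
    moreover have "trig_poly (\<lambda>x. (\<Sum>i\<in>Basis. h (i, 0) * cos ((a *\<^sub>R i) \<bullet> x + 0))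
        + (\<Sum>i\<in>Basis. h (0, i) * cos ((a *\<^sub>R i) \<bullet> x + (- pi / 2))))"
      by (intro trig_poly.add trig_poly_sum trig_poly.wave finite_Basis)
    ultimately show ?case by simp
  next
    case (const c)
    show ?case by (rule trig_poly_const)
  next
    case (add f g)
    from add.IH show ?case by (rule trig_poly.add)
  next
    case (mult f g)
    from mult.IH show ?case by (rule trig_poly_mult)
  qed
  moreover have FP: "\<bar>F (T x) - P (T x)\<bar> < e" for x using P(2) Tb by blast
  moreover have "\<bar>f x - P (T x)\<bar> \<le> e" if "norm x \<le> R" for x
    using FT[OF that] FP[of x] by simp
  moreover have "\<bar>P (T x)\<bar> \<le> C + e" for x
    using F(3)[of "T x"] FP[of x] unfolding real_norm_def by linarith
  ultimately show ?thesis using that[of "\<lambda>x. P (T x)"] by blast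
qed

lemma prob_space_tight:
  fixes L :: "'b::euclidean_space measure"
  assumes "prob_space L" "sets L = sets borel" "e > 0"
  obtains R where "measure L {x. norm x > R} \<le> e"
proof -
  interpret prob_space L by fact
  note [measurable_cong] = assms(2)
  have sp: "space L = UNIV" using sets_eq_imp_space_eq[OF assms(2)] by simp
  have "(\<lambda>n::nat. measure L {x. norm x > real n}) \<longlonglongrightarrow> measure L (\<Inter>n::nat. {x. norm x > real n})"
    by (rule finite_Lim_measure_decseq) (auto simp: decseq_def assms(2))
  moreover have "(\<Inter>n::nat. {x::'b. norm x > real n}) = {}"
  proof -
    have "\<exists>n. \<not> real n < norm x" for x :: 'b
      using reals_Archimedean2[of "norm x"] less_asym by blast
    then show ?thesis by blast
  qed
  ultimately have "\<forall>\<^sub>F n::nat in sequentially. measure L {x. norm x > real n} < e"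
    using assms(3) order_tendstoD(2) by fastforce
  then obtain n :: nat where "measure L {x. norm x > real n} < e" by (auto simp: eventually_sequentially)
  then show ?thesis using that less_imp_le by blast
qed

text \<open>Tightness is a hypothesis because in the application it follows from second moments by
  Chebyshev. It makes the mass outside one ball small for all n, and there f and its trigonometric
  approximation differ by at most 2 C + d.\<close>

theorem levy_continuity_multivariate:
  fixes \<mu> :: "nat \<Rightarrow> 'b::euclidean_space measure"
  assumes \<mu>: "\<And>n. prob_space (\<mu> n)" "\<And>n. sets (\<mu> n) = sets borel"
    and L: "prob_space L" "sets L = sets borel"
    and conv: "\<And>t. (\<lambda>n. integral\<^sup>L (\<mu> n) (\<lambda>x. iexp (t \<bullet> x))) \<longlonglongrightarrow> integral\<^sup>L L (\<lambda>x. iexp (t \<bullet> x))"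
    and tight: "\<And>e. e > 0 \<Longrightarrow> \<exists>R. \<forall>n. measure (\<mu> n) {x. norm x > R} \<le> e"
    and f: "continuous_on UNIV f" "bounded (range f)"
  shows "(\<lambda>n. integral\<^sup>L (\<mu> n) f) \<longlonglongrightarrow> integral\<^sup>L L (f :: 'b \<Rightarrow> real)"
proof (rule LIMSEQ_I)
  fix e :: real assume e: "e > 0"
  obtain C where C: "\<And>x. \<bar>f x\<bar> \<le> C" using f(2) by (auto simp: bounded_iff)
  have C0: "0 \<le> C" using C[of 0] by linarith
  \<comment> \<open>The total error is 2 (d + (2 C + d) d) + d, which for d <= 1 is below (6 C + 10)
    d <= e.\<close>
  define d where "d = min 1 (e / (6 * C + 10))"
  have "d \<le> e / (6 * C + 10)" by (simp add: d_def)
  then have "d * (6 * C + 10) \<le> e" using C0 by (subst (asm) pos_le_divide_eq) auto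
  moreover have "0 < d" "d \<le> 1" using e C0 by (auto simp: d_def)
  ultimately have d: "0 < d" "d \<le> 1" "d * (6 * C + 10) \<le> e" by auto
  obtain R1 where R1: "\<And>n. measure (\<mu> n) {x. norm x > R1} \<le> d" using tight[OF d(1)] by blast
  obtain R2 where R2: "measure L {x. norm x > R2} \<le> d" using prob_space_tight[OF L d(1)] by blast
  define R where "R = Max {R1, R2, 1}"
  have R: "R \<ge> R1" "R \<ge> R2" "R > 0" by (auto simp: R_def less_max_iff_disj)
  obtain g where g: "trig_poly g" "\<And>x. norm x \<le> R \<Longrightarrow> \<bar>f x - g x\<bar> \<le> d" "\<And>x. \<bar>g x\<bar> \<le> C + d"
    using uniform_trig_approx_on_ball[OF f(1) C R(3) d(1)] by blast
  note gt = trig_poly_integral_tendsto[OF \<mu> L conv g(1)]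
  have appr: "\<bar>integral\<^sup>L N f - integral\<^sup>L N g\<bar> \<le> d + (2 * C + d) * d"
    if N: "prob_space N" "sets N = sets borel" "integrable N g" "measure N {x. norm x > R} \<le> d" for N
  proof -
    interpret prob_space N by fact
    note [measurable_cong] = N(2)
    have [measurable]: "f \<in> borel_measurable N"
      using borel_measurable_continuous_onI[OF f(1)] by simp
    have fi: "integrable N f" by (rule integrable_const_bound[where B=C]) (use C in auto)
    have S: "{x. norm x > R} \<in> sets N" by (simp add: N(2))
    have hi: "integrable N (\<lambda>x. d + (2 * C + d) * indicator {x. norm x > R} x)"
      using S by (auto simp: less_top[symmetric])
    have "\<bar>integral\<^sup>L N f - integral\<^sup>L N g\<bar> = \<bar>integral\<^sup>L N (\<lambda>x. f x - g x)\<bar>"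
      using fi N(3) by simp
    also have "\<dots> \<le> integral\<^sup>L N (\<lambda>x. d + (2 * C + d) * indicator {x. norm x > R} x)"
    proof (rule integral_abs_bound[THEN order_trans], rule integral_mono[OF _ hi])
      show "integrable N (\<lambda>x. \<bar>f x - g x\<bar>)" using fi N(3) by simp
      fix x
      show "\<bar>f x - g x\<bar> \<le> d + (2 * C + d) * indicator {x. norm x > R} x"
        using g(2)[of x] g(3)[of x] C[of x] d(1) by (cases "norm x \<le> R") auto
    qed
    also have "\<dots> = d + (2 * C + d) * measure N {x. norm x > R}"
      using S by (simp add: prob_space less_top[symmetric])
    also have "\<dots> \<le> d + (2 * C + d) * d"
      using N(4) C0 d by (intro add_left_mono mult_left_mono) auto
    finally show ?thesis .
  qed
  have meas_le: "measure N {x. norm x > R} \<le> measure N {x. norm x > r}"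
    if "prob_space N" "sets N = sets borel" "r \<le> R" for N r
    using that by (intro finite_measure.finite_measure_mono prob_space.finite_measure) auto
  obtain n0 where n0: "\<And>n. n \<ge> n0 \<Longrightarrow> \<bar>integral\<^sup>L (\<mu> n) g - integral\<^sup>L L g\<bar> < d"
    using LIMSEQ_D[OF gt(1) d(1)] by auto
  show "\<exists>no. \<forall>n\<ge>no. norm (integral\<^sup>L (\<mu> n) f - integral\<^sup>L L f) < e"
  proof (intro exI allI impI)
    fix n assume n: "n \<ge> n0"
    have 1: "\<bar>integral\<^sup>L (\<mu> n) f - integral\<^sup>L (\<mu> n) g\<bar> \<le> d + (2 * C + d) * d"
      using order_trans[OF meas_le[OF \<mu>, OF R(1)] R1] by (intro appr \<mu> gt)
    have 2: "\<bar>integral\<^sup>L L f - integral\<^sup>L L g\<bar> \<le> d + (2 * C + d) * d"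
      using order_trans[OF meas_le[OF L R(2)] R2] by (intro appr L gt)
    have "d * d \<le> d" using mult_left_mono[of d 1 d] d by simp
    moreover have "d * d = d\<^sup>2" "0 \<le> C * d" using C0 d by (simp_all add: power2_eq_square)
    moreover have "2 * (d + (2 * C + d) * d) + d = 3 * d + 4 * (C * d) + 2 * d\<^sup>2"
      "d * (6 * C + 10) = 6 * (C * d) + 10 * d" by (simp_all add: algebra_simps power2_eq_square)
    ultimately have "2 * (d + (2 * C + d) * d) + d < e" using d(1,3) by linarith
    then show "norm (integral\<^sup>L (\<mu> n) f - integral\<^sup>L L f) < e"
      using 1 2 n0[OF n] unfolding real_norm_def by argo
  qed
qed

section \<open>The multivariate normal law\<close>

lemma gauss_vector_measurable [measurable]:
  "(\<lambda>x. A *v (\<chi> i. x i)) \<in> PiM UNIV (\<lambda>_::'r::finite. std_normal_distribution) \<rightarrow>\<^sub>M (borel :: (real^'r) measure)"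
proof -
  have "A *v (\<chi> i. x i) = (\<Sum>i\<in>UNIV. x i *\<^sub>R (A *v axis i 1))" for x
  proof -
    have "(\<chi> i. x i) = (\<Sum>i\<in>UNIV. x i *\<^sub>R (axis i 1 :: real^'r))"
      by (simp add: vec_eq_iff axis_def if_distrib cong: if_cong)
    then show ?thesis by (simp add: linear_sum[OF matrix_vector_mul_linear] o_def scalar_mult_eq_scaleR matrix_vector_mult_scaleR)
  qed
  then show ?thesis by simp
qed

lemma mvnormal_prob_space: "prob_space (mvnormal S)" and sets_mvnormal [simp]: "sets (mvnormal S) = sets borel"
proof -
  interpret product_prob_space "\<lambda>_. std_normal_distribution" UNIV
    by (intro product_prob_spaceI) (simp add: prob_space_normal_density)
  show "prob_space (mvnormal S)"
    unfolding mvnormal_def by (rule prob_space_distr) measurable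
  show "sets (mvnormal S) = sets borel" by (simp add: mvnormal_def)
qed

text \<open>Moving the symmetric root A of S to the other side turns t . (A x) into a . x with a = A
  t, a sum over independent coordinates. The integral factorises, and a . a = t . (S t).\<close>

lemma mvnormal_char:
  fixes S :: "real^'r^'r"
  assumes S: "transpose S = S" "\<And>x. 0 \<le> x \<bullet> (S *v x)"
  shows "integral\<^sup>L (mvnormal S) (\<lambda>x. iexp (t \<bullet> x)) = complex_of_real (exp (- (t \<bullet> (S *v t)) / 2))"
proof -
  interpret product_prob_space "\<lambda>_::'r. std_normal_distribution" UNIV
    by (intro product_prob_spaceI) (simp add: prob_space_normal_density)
  define A where "A = psd_sqrt S"
  note A = psd_sqrt_properties[OF S, folded A_def]
  define a where "a = A *v t"
  have aa: "a \<bullet> a = t \<bullet> (S *v t)"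
    unfolding a_def symmetric_matrix_inner[OF A(1)] by (simp add: matrix_vector_mul_assoc A(2))
  have "integral\<^sup>L (mvnormal S) (\<lambda>x. iexp (t \<bullet> x))
      = (\<integral>x. iexp (t \<bullet> (A *v (\<chi> i. x i))) \<partial>PiM UNIV (\<lambda>_::'r. std_normal_distribution))"
    unfolding mvnormal_def A_def by (rule integral_distr) measurable
  also have "\<dots> = (\<integral>x. (\<Prod>i\<in>UNIV. iexp (a $ i * x i)) \<partial>PiM UNIV (\<lambda>_::'r. std_normal_distribution))"
  proof (rule Bochner_Integration.integral_cong[OF refl])
    fix x :: "'r \<Rightarrow> real"
    have "t \<bullet> (A *v (\<chi> i. x i)) = a \<bullet> (\<chi> i. x i)"
      unfolding a_def symmetric_matrix_inner[OF A(1)] ..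
    also have "\<dots> = (\<Sum>i\<in>UNIV. a $ i * x i)" by (simp add: inner_vec_def)
    finally show "iexp (t \<bullet> (A *v (\<chi> i. x i))) = (\<Prod>i\<in>UNIV. iexp (a $ i * x i))"
      by (simp add: exp_sum[symmetric] sum_distrib_left)
  qed
  also have "\<dots> = (\<Prod>i\<in>UNIV. integral\<^sup>L std_normal_distribution (\<lambda>y. iexp (a $ i * y)))"
    by (rule product_integral_prod)
      (auto intro!: finite_measure.integrable_const_bound[where B=1] prob_space.finite_measure prob_space_normal_density)
  also have "\<dots> = (\<Prod>i\<in>UNIV. complex_of_real (exp (- ((a $ i)\<^sup>2) / 2)))"
    using char_std_normal_distribution unfolding char_def fun_eq_iff by simp
  also have "\<dots> = complex_of_real (exp (\<Sum>i\<in>UNIV. - ((a $ i)\<^sup>2) / 2))"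
    by (simp add: exp_sum)
  also have "(\<Sum>i\<in>UNIV. - ((a $ i)\<^sup>2) / 2) = - (a \<bullet> a) / 2"
    by (simp add: inner_vec_def power2_eq_square sum_negf sum_divide_distrib)
  finally show ?thesis by (simp add: aa)
qed

section \<open>Sums of independent observations and the central limit theorem\<close>

locale iid_sample = prob_space M for M :: "'a measure" +
  fixes Q :: "'z measure" and Z :: "nat \<Rightarrow> 'a \<Rightarrow> 'z"
  assumes Z: "\<And>j. Z j \<in> measurable M Q" "\<And>j. distr M Q (Z j) = Q" "indep_vars (\<lambda>_. Q) Z UNIV"
begin

sublocale Q: prob_space Q
  using prob_space_distr[OF Z(1)[of 0]] Z(2) by simp

lemma integrable_comp_Z: "integrable Q g \<Longrightarrow> integrable M (\<lambda>\<omega>. g (Z j \<omega>) :: real)"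
  using integrable_distr_eq[OF Z(1), of g j] by (simp add: Z(2) borel_measurable_integrable)

lemma integral_comp_Z: "g \<in> borel_measurable Q \<Longrightarrow> expectation (\<lambda>\<omega>. g (Z j \<omega>)) = (integral\<^sup>L Q g :: real)"
  using integral_distr[OF Z(1), of g j] by (simp add: Z(2))

lemma iid_sum_second_moment:
  assumes f: "f \<in> borel_measurable Q" "integrable Q (\<lambda>z. (f z)\<^sup>2)" "integral\<^sup>L Q f = 0"
  shows "integrable M (\<lambda>\<omega>. (\<Sum>j<n. f (Z j \<omega>))\<^sup>2)"
    and "expectation (\<lambda>\<omega>. (\<Sum>j<n. f (Z j \<omega>))\<^sup>2) = real n * integral\<^sup>L Q (\<lambda>z. (f z)\<^sup>2)"
proof -
  note [measurable] = Z(1) f(1)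
  have sq: "integrable M (\<lambda>\<omega>. (f (Z j \<omega>))\<^sup>2)" "expectation (\<lambda>\<omega>. (f (Z j \<omega>))\<^sup>2) = integral\<^sup>L Q (\<lambda>z. (f z)\<^sup>2)" for j
    using integrable_comp_Z[OF f(2)] integral_comp_Z[OF borel_measurable_integrable[OF f(2)]] .
  have int: "integrable M (\<lambda>\<omega>. f (Z j \<omega>))" for j
    by (rule square_integrable_imp_integrable[OF _ sq(1)]) measurable
  have zero: "expectation (\<lambda>\<omega>. f (Z j \<omega>)) = 0" for j
    using integral_comp_Z[OF f(1)] f(3) by simp
  have cross: "integrable M (\<lambda>\<omega>. f (Z i \<omega>) * f (Z j \<omega>))
     \<and> expectation (\<lambda>\<omega>. f (Z i \<omega>) * f (Z j \<omega>)) = (if i = j then integral\<^sup>L Q (\<lambda>z. (f z)\<^sup>2) else 0)" for i j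
  proof (cases "i = j")
    case True
    then show ?thesis using sq[of j] by (simp add: power2_eq_square)
  next
    case False
    have "indep_vars (\<lambda>_. borel) (\<lambda>j \<omega>. f (Z j \<omega>)) UNIV"
      by (rule indep_vars_compose2[OF Z(3)]) measurable
    then have ind: "indep_vars (\<lambda>_. borel) (\<lambda>j \<omega>. f (Z j \<omega>)) {i, j}"
      by (rule indep_vars_subset) simp
    show ?thesis
      using indep_vars_integrable[OF _ ind] indep_vars_lebesgue_integral[OF _ ind] int zero False by simp
  qed
  have e: "(\<Sum>j<n. f (Z j \<omega>))\<^sup>2 = (\<Sum>i<n. \<Sum>j<n. f (Z i \<omega>) * f (Z j \<omega>))" for \<omega>
    by (simp add: power2_eq_square sum_product)
  show "integrable M (\<lambda>\<omega>. (\<Sum>j<n. f (Z j \<omega>))\<^sup>2)"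
    unfolding e using cross by (intro Bochner_Integration.integrable_sum) auto
  have "expectation (\<lambda>\<omega>. (\<Sum>j<n. f (Z j \<omega>))\<^sup>2)
      = (\<Sum>i<n. \<Sum>j<n. if i = j then integral\<^sup>L Q (\<lambda>z. (f z)\<^sup>2) else 0)"
    unfolding e using cross by (subst Bochner_Integration.integral_sum; (intro Bochner_Integration.integrable_sum)?; simp)+
  also have "\<dots> = real n * integral\<^sup>L Q (\<lambda>z. (f z)\<^sup>2)" by simp
  finally show "expectation (\<lambda>\<omega>. (\<Sum>j<n. f (Z j \<omega>))\<^sup>2) = real n * integral\<^sup>L Q (\<lambda>z. (f z)\<^sup>2)" .
qed

text \<open>The scalar central limit theorem concerns sums normalised by \<sigma>; evaluating
  characteristic functions at the point \<sigma> cancels the normalisation and leaves exp(-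
  \<sigma>^2 / 2).\<close>

lemma iid_sum_char_tendsto:
  assumes f: "f \<in> borel_measurable Q" "integrable Q (\<lambda>z. (f z)\<^sup>2)" "integral\<^sup>L Q f = 0"
    and s: "0 < integral\<^sup>L Q (\<lambda>z. (f z)\<^sup>2)"
  shows "(\<lambda>n. expectation (\<lambda>\<omega>. iexp ((\<Sum>j<n. f (Z j \<omega>)) / sqrt (real n))))
     \<longlonglongrightarrow> complex_of_real (exp (- integral\<^sup>L Q (\<lambda>z. (f z)\<^sup>2) / 2))"
proof -
  note [measurable] = Z(1) f(1)
  define \<sigma> where "\<sigma> = sqrt (integral\<^sup>L Q (\<lambda>z. (f z)\<^sup>2))"
  have \<sigma>: "\<sigma> > 0" "\<sigma>\<^sup>2 = integral\<^sup>L Q (\<lambda>z. (f z)\<^sup>2)" using s by (auto simp: \<sigma>_def)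
  have Qd: "distr M borel (\<lambda>\<omega>. f (Z j \<omega>)) = distr Q borel f" for j
    using distr_distr[of f Q borel "Z j" M] by (simp add: Z(2) comp_def)
  have ex: "expectation (\<lambda>\<omega>. f (Z j \<omega>)) = 0" for j
    using integral_comp_Z[OF f(1)] f(3) by simp
  have sq: "integrable M (\<lambda>\<omega>. (f (Z j \<omega>))\<^sup>2)" "expectation (\<lambda>\<omega>. (f (Z j \<omega>))\<^sup>2) = \<sigma>\<^sup>2" for j
    unfolding \<sigma>(2)
    using integrable_comp_Z[OF f(2)] integral_comp_Z[OF borel_measurable_integrable[OF f(2)]] .
  have wc: "weak_conv_m (\<lambda>n. distr M borel (\<lambda>\<omega>. (\<Sum>j<n. f (Z j \<omega>)) / sqrt (real n * \<sigma>\<^sup>2))) std_normal_distribution"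
  proof (rule central_limit_theorem_zero_mean)
    show "indep_vars (\<lambda>i. borel) (\<lambda>j \<omega>. f (Z j \<omega>)) UNIV"
      by (rule indep_vars_compose2[OF Z(3)]) measurable
  qed (use ex sq Qd \<sigma> in auto)
  have "(\<lambda>n. char (distr M borel (\<lambda>\<omega>. (\<Sum>j<n. f (Z j \<omega>)) / sqrt (real n * \<sigma>\<^sup>2))) \<sigma>) \<longlonglongrightarrow> char std_normal_distribution \<sigma>"
    by (rule levy_continuity1[OF _ _ wc]) (auto intro!: real_distribution_distr real_dist_normal_dist)
  moreover have "char (distr M borel (\<lambda>\<omega>. (\<Sum>j<n. f (Z j \<omega>)) / sqrt (real n * \<sigma>\<^sup>2))) \<sigma>
      = expectation (\<lambda>\<omega>. iexp ((\<Sum>j<n. f (Z j \<omega>)) / sqrt (real n)))" for n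
    unfolding char_def using \<sigma>(1)
    by (subst integral_distr) (auto simp: real_sqrt_mult field_simps intro!: Bochner_Integration.integral_cong arg_cong[where f=exp])
  ultimately show ?thesis by (simp add: char_std_normal_distribution \<sigma>(2))
qed

text \<open>Cramer-Wold through characteristic functions: t . Y is a normalised scalar sum of
  summands with variance t . (S t). The scalar theorem wants this variance positive for t nonzero,
  which is why S is positive definite; t = 0 is treated apart.\<close>

lemma clt_multivariate:
  fixes h :: "'z \<Rightarrow> real^'r" and S :: "real^'r^'r"
  assumes h: "h \<in> borel_measurable Q" "integrable Q (\<lambda>z. (norm (h z))\<^sup>2)" "integral\<^sup>L Q h = 0"
    and S: "transpose S = S" "\<And>t. integral\<^sup>L Q (\<lambda>z. (t \<bullet> h z)\<^sup>2) = t \<bullet> (S *v t)"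
    and pd: "\<And>t. t \<noteq> 0 \<Longrightarrow> 0 < t \<bullet> (S *v t)"
  defines "Y \<equiv> \<lambda>n \<omega>. (1 / sqrt (real n)) *\<^sub>R (\<Sum>j<n. h (Z j \<omega>))"
  shows "\<And>e. e > 0 \<Longrightarrow> \<exists>R>0. \<forall>n. prob {\<omega> \<in> space M. norm (Y n \<omega>) > R} \<le> e"
    and "continuous_on UNIV f \<Longrightarrow> bounded (range f) \<Longrightarrow>
      (\<lambda>n. expectation (\<lambda>\<omega>. f (Y n \<omega>))) \<longlonglongrightarrow> integral\<^sup>L (mvnormal S) (f :: real^'r \<Rightarrow> real)"
proof -
  note [measurable] = Z(1) h(1)
  have Ymeas [measurable]: "Y n \<in> borel_measurable M" for n unfolding Y_def by measurable
  have psd: "0 \<le> t \<bullet> (S *v t)" for t using pd[of t] by (cases "t = 0") auto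
  have hint: "integrable Q h"
    using Q.square_integrable_imp_integrable[of "\<lambda>z. norm (h z)"] h(2) by (simp add: integrable_norm_iff)
  have th: "(\<lambda>z. t \<bullet> h z) \<in> borel_measurable Q" "integrable Q (\<lambda>z. (t \<bullet> h z)\<^sup>2)" "integral\<^sup>L Q (\<lambda>z. t \<bullet> h z) = 0" for t
  proof -
    show "(\<lambda>z. t \<bullet> h z) \<in> borel_measurable Q" using h(1) by (intro borel_measurable_inner) auto
    show "integrable Q (\<lambda>z. (t \<bullet> h z)\<^sup>2)"
    proof (rule Bochner_Integration.integrable_bound[of _ "\<lambda>z. (norm t)\<^sup>2 * (norm (h z))\<^sup>2"])
      show "AE z in Q. norm ((t \<bullet> h z)\<^sup>2) \<le> norm ((norm t)\<^sup>2 * (norm (h z))\<^sup>2)"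
      proof (rule AE_I2)
        fix z
        show "norm ((t \<bullet> h z)\<^sup>2) \<le> norm ((norm t)\<^sup>2 * (norm (h z))\<^sup>2)"
          using power_mono[OF Cauchy_Schwarz_ineq2[of t "h z"], of 2]
          by (simp only: real_norm_def power2_abs power_mult_distrib abs_ge_zero abs_mult abs_power2)
      qed
    next
      show "integrable Q (\<lambda>z. (norm t)\<^sup>2 * (norm (h z))\<^sup>2)"
        using h(2) by (rule integrable_mult_right)
      show "(\<lambda>z. (t \<bullet> h z)\<^sup>2) \<in> borel_measurable Q"
        using h(1) by (intro borel_measurable_power borel_measurable_inner) auto
    qed
    show "integral\<^sup>L Q (\<lambda>z. t \<bullet> h z) = 0" 
      by (subst integral_inner_right) (simp_all only: hint h(3) inner_zero_right)
  qed
  have tY: "t \<bullet> Y n \<omega> = (\<Sum>j<n. t \<bullet> h (Z j \<omega>)) / sqrt (real n)" for t n \<omega>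
    by (simp add: Y_def inner_sum_right)
  define \<tau> where "\<tau> = (\<Sum>i\<in>Basis. integral\<^sup>L Q (\<lambda>z. (i \<bullet> h z)\<^sup>2))"
  have \<tau>0: "0 \<le> \<tau>" unfolding \<tau>_def by (intro sum_nonneg) simp
  have norm2: "(norm x)\<^sup>2 = (\<Sum>i\<in>Basis. (i \<bullet> x)\<^sup>2)" for x :: "real^'r"
    unfolding power2_norm_eq_inner euclidean_inner[of x x]
    by (simp add: power2_eq_square inner_commute[of x])
  have Y2: "integrable M (\<lambda>\<omega>. (norm (Y n \<omega>))\<^sup>2)" "expectation (\<lambda>\<omega>. (norm (Y n \<omega>))\<^sup>2) \<le> \<tau>" for n
  proof -
    have i: "integrable M (\<lambda>\<omega>. (i \<bullet> Y n \<omega>)\<^sup>2)"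
      "expectation (\<lambda>\<omega>. (i \<bullet> Y n \<omega>)\<^sup>2) \<le> integral\<^sup>L Q (\<lambda>z. (i \<bullet> h z)\<^sup>2)" for i
      using iid_sum_second_moment[OF th[of i], of n] unfolding tY
      by (auto simp: power_divide)
    show "integrable M (\<lambda>\<omega>. (norm (Y n \<omega>))\<^sup>2)" unfolding norm2 using i(1) by simp
    show "expectation (\<lambda>\<omega>. (norm (Y n \<omega>))\<^sup>2) \<le> \<tau>"
      unfolding norm2 \<tau>_def using i by (subst Bochner_Integration.integral_sum) (auto intro!: sum_mono)
  qed
  show tight: "\<exists>R>0. \<forall>n. prob {\<omega> \<in> space M. norm (Y n \<omega>) > R} \<le> e" if e: "e > 0" for e
  proof (intro exI conjI allI)
    \<comment> \<open>The added 1 makes R positive even for \<tau> = 0, while \<tau> / R^2 <= e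
      remains true.\<close>
    define R where "R = sqrt (\<tau> / e + 1)"
    have R2: "R\<^sup>2 = \<tau> / e + 1" "R > 0" using e \<tau>0 by (auto simp: R_def add_nonneg_pos)
    show "R > 0" by (rule R2)
    fix n
    have "prob {\<omega> \<in> space M. norm (Y n \<omega>) > R} \<le> prob {\<omega> \<in> space M. (norm (Y n \<omega>))\<^sup>2 \<ge> R\<^sup>2}"
      using R2(2) by (intro finite_measure_mono) (auto intro: power_mono)
    also have "\<dots> \<le> expectation (\<lambda>\<omega>. (norm (Y n \<omega>))\<^sup>2) / R\<^sup>2"
      using R2(2) by (intro integral_Markov_inequality_measure[where A="space M"] Y2(1)) auto
    also have "\<dots> \<le> \<tau> / R\<^sup>2" by (intro divide_right_mono Y2(2)) simp
    also have "\<dots> \<le> e" unfolding R2(1) using e \<tau>0 by (simp add: field_simps add_pos_nonneg)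
    finally show "prob {\<omega> \<in> space M. norm (Y n \<omega>) > R} \<le> e" .
  qed
  assume f: "continuous_on UNIV f" "bounded (range f)"
  have "(\<lambda>n. integral\<^sup>L (distr M borel (Y n)) f) \<longlonglongrightarrow> integral\<^sup>L (mvnormal S) f"
  proof (rule levy_continuity_multivariate[OF _ _ mvnormal_prob_space sets_mvnormal _ _ f])
    fix n show "prob_space (distr M borel (Y n))" by (rule prob_space_distr) measurable
    show "sets (distr M borel (Y n)) = sets borel" by simp
  next
    fix t
    have "integral\<^sup>L (distr M borel (Y n)) (\<lambda>x. iexp (t \<bullet> x)) = expectation (\<lambda>\<omega>. iexp (t \<bullet> Y n \<omega>))" for n
      by (rule integral_distr) measurable
    moreover have "(\<lambda>n. expectation (\<lambda>\<omega>. iexp (t \<bullet> Y n \<omega>))) \<longlonglongrightarrow> integral\<^sup>L (mvnormal S) (\<lambda>x. iexp (t \<bullet> x))"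
    proof (cases "t = 0")
      case True
      interpret N: prob_space "mvnormal S" by (rule mvnormal_prob_space)
      show ?thesis using True by (simp add: prob_space N.prob_space)
    next
      case False
      then show ?thesis
        using iid_sum_char_tendsto[OF th[of t]] pd[OF False]
        unfolding tY mvnormal_char[OF S(1) psd] S(2) by simp
    qed
    ultimately show "(\<lambda>n. integral\<^sup>L (distr M borel (Y n)) (\<lambda>x. iexp (t \<bullet> x))) \<longlonglongrightarrow> integral\<^sup>L (mvnormal S) (\<lambda>x. iexp (t \<bullet> x))"
      by simp
  next
    fix e :: real assume "e > 0"
    then obtain R where "\<And>n. prob {\<omega> \<in> space M. norm (Y n \<omega>) > R} \<le> e" using tight by blast
    moreover have "measure (distr M borel (Y n)) {x. norm x > R} = prob {\<omega> \<in> space M. norm (Y n \<omega>) > R}" for n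
      by (subst measure_distr) (auto intro!: arg_cong[where f=prob])
    ultimately show "\<exists>R. \<forall>n. measure (distr M borel (Y n)) {x. norm x > R} \<le> e"
      by (intro exI[of _ R]) simp
  qed
  moreover have "integral\<^sup>L (distr M borel (Y n)) f = expectation (\<lambda>\<omega>. f (Y n \<omega>))" for n
    using borel_measurable_continuous_onI[OF f(1)] by (intro integral_distr) auto
  ultimately show "(\<lambda>n. expectation (\<lambda>\<omega>. f (Y n \<omega>))) \<longlonglongrightarrow> integral\<^sup>L (mvnormal S) f" by simp
qed

end

section \<open>Outer expectations and Slutsky's lemma\<close>

context prob_space begin

text \<open>f need not be measurable, but the integrable functions g - d and g + d enclose it: every
  integrable majorant of f dominates g - d, and g + d is such a majorant.\<close>

lemma outer_exp_near:
  assumes g: "integrable M g" "integrable M d" and fg: "\<And>\<omega>. \<omega> \<in> space M \<Longrightarrow> \<bar>f \<omega> - g \<omega>\<bar> \<le> d \<omega>"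
  shows "\<bar>outer_exp M f - expectation g\<bar> \<le> expectation d"
proof -
  let ?A = "{integral\<^sup>L M h | h. integrable M h \<and> (\<forall>\<omega>\<in>space M. f \<omega> \<le> h \<omega>)}"
  have lower: "expectation g - expectation d \<le> y" if y: "y \<in> ?A" for y
  proof -
    obtain h where "y = expectation h" "integrable M h \<and> (\<forall>\<omega>\<in>space M. f \<omega> \<le> h \<omega>)"
      using y by blast
    then have h: "y = expectation h" "integrable M h" "\<And>\<omega>. \<omega> \<in> space M \<Longrightarrow> f \<omega> \<le> h \<omega>"
      by auto
    have "expectation (\<lambda>\<omega>. g \<omega> - d \<omega>) \<le> expectation h"
      using g h(2) by (intro integral_mono) (use fg h(3) in \<open>fastforce simp: abs_le_iff\<close>)+
    then show ?thesis using g h(1) by simp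
  qed
  have mem: "expectation (\<lambda>\<omega>. g \<omega> + d \<omega>) \<in> ?A"
    using g fg by (intro CollectI exI[of _ "\<lambda>\<omega>. g \<omega> + d \<omega>"]) (fastforce simp: abs_le_iff)
  have "outer_exp M f \<le> expectation (\<lambda>\<omega>. g \<omega> + d \<omega>)"
    unfolding outer_exp_def by (rule cInf_lower[OF mem]) (rule bdd_belowI[OF lower])
  moreover have "expectation g - expectation d \<le> outer_exp M f"
    unfolding outer_exp_def using mem lower by (intro cInf_greatest) auto
  ultimately show ?thesis using g by (simp add: abs_le_iff)
qed

text \<open>Off an exceptional set X and Y lie in one ball, where f is uniformly continuous; on it
  the two values of f differ by at most 2 C. Only Y is assumed measurable, so the exceptional set is
  built from Y and from the covers in \<open>op_small\<close>.\<close>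

lemma slutsky_outer:
  fixes X Y :: "nat \<Rightarrow> 'a \<Rightarrow> 'b::euclidean_space"
  assumes Y: "\<And>n. Y n \<in> borel_measurable M"
    and tight: "\<And>e. e > 0 \<Longrightarrow> \<exists>R>0. \<forall>n. prob {\<omega> \<in> space M. norm (Y n \<omega>) > R} \<le> e"
    and conv: "\<And>f :: 'b \<Rightarrow> real. continuous_on UNIV f \<Longrightarrow> bounded (range f) \<Longrightarrow>
        (\<lambda>n. expectation (\<lambda>\<omega>. f (Y n \<omega>))) \<longlonglongrightarrow> integral\<^sup>L L f"
    and small: "op_small M (\<lambda>n \<omega>. norm (X n \<omega> - Y n \<omega>)) (\<lambda>_. 1)"
  shows "weak_conv_outer M X L"
  unfolding weak_conv_outer_def
proof (intro allI impI)
  fix f :: "'b \<Rightarrow> real" assume f: "continuous_on UNIV f \<and> bounded (range f)"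
  note [measurable] = Y borel_measurable_continuous_onI[OF conjunct1[OF f]]
  obtain C where C: "\<And>x. \<bar>f x\<bar> \<le> C" using f by (auto simp: bounded_iff)
  have C0: "0 \<le> C" using C[of 0] by linarith
  have "(\<lambda>n. outer_exp M (\<lambda>\<omega>. f (X n \<omega>)) - expectation (\<lambda>\<omega>. f (Y n \<omega>))) \<longlonglongrightarrow> 0"
  proof (rule LIMSEQ_I)
    fix e :: real assume e: "e > 0"
    \<comment> \<open>The exceptional set has probability below 2 d, so the error is at most d + 4 C
      d, which is less than e.\<close>
    define d where "d = e / (4 * C + 2)"
    have d: "d > 0" "d * (4 * C + 2) = e" using e C0 by (auto simp: d_def)
    obtain R where R: "R > 0" "\<And>n. prob {\<omega> \<in> space M. norm (Y n \<omega>) > R} \<le> d" using tight[OF d(1)] by blast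
    have "uniformly_continuous_on (cball 0 (R + 1)) f"
      using f by (intro compact_uniformly_continuous compact_cball) (auto intro: continuous_on_subset)
    from this[unfolded uniformly_continuous_on_def, rule_format, OF d(1)]
    obtain \<delta> where \<delta>: "\<delta> > 0"
      "\<forall>x\<in>cball 0 (R + 1). \<forall>y\<in>cball 0 (R + 1). dist y x < \<delta> \<longrightarrow> dist (f y) (f x) < d"
      by (elim exE conjE)
    \<comment> \<open>At most 1 keeps X in the ball of radius R + 1; half of \<delta> turns the weak
      inequality valid off \<open>B n\<close> into a strict one.\<close>
    define \<delta>' where "\<delta>' = min 1 (\<delta> / 2)"
    have \<delta>': "\<delta>' > 0" "\<delta>' \<le> 1" "\<delta>' < \<delta>" using \<delta>(1) by (auto simp: \<delta>'_def)
    from small[unfolded op_small_def, rule_format, OF \<delta>'(1)]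
    obtain B where B: "\<forall>n. B n \<in> sets M \<and> {\<omega> \<in> space M. \<delta>' * 1 < \<bar>norm (X n \<omega> - Y n \<omega>)\<bar>} \<subseteq> B n"
      "(\<lambda>n. prob (B n)) \<longlonglongrightarrow> 0"
      by (elim exE conjE)
    obtain n0 where n0: "\<And>n. n \<ge> n0 \<Longrightarrow> prob (B n) < d"
      using LIMSEQ_D[OF B(2) d(1)] by auto
    show "\<exists>no. \<forall>n\<ge>no. norm (outer_exp M (\<lambda>\<omega>. f (X n \<omega>)) - expectation (\<lambda>\<omega>. f (Y n \<omega>)) - 0) < e"
    proof (intro exI allI impI)
      fix n assume n: "n \<ge> n0"
      define D where "D = B n \<union> {\<omega> \<in> space M. norm (Y n \<omega>) > R}"
      have [measurable]: "B n \<in> sets M" using B(1) by blast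
      have D [measurable]: "D \<in> sets M" unfolding D_def by measurable
      have "prob D \<le> prob (B n) + prob {\<omega> \<in> space M. norm (Y n \<omega>) > R}"
        unfolding D_def by (rule measure_Un_le) measurable
      then have PD: "prob D < 2 * d" using n0[OF n] R(2)[of n] by simp
      have "\<bar>outer_exp M (\<lambda>\<omega>. f (X n \<omega>)) - expectation (\<lambda>\<omega>. f (Y n \<omega>))\<bar>
          \<le> expectation (\<lambda>\<omega>. d + 2 * C * indicator D \<omega>)"
      proof (rule outer_exp_near)
        show "integrable M (\<lambda>\<omega>. f (Y n \<omega>))" by (rule integrable_const_bound[where B=C]) (use C in auto)
        show "integrable M (\<lambda>\<omega>. d + 2 * C * indicator D \<omega>)" by (auto simp: less_top[symmetric])
        fix \<omega> assume \<omega>: "\<omega> \<in> space M"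
        show "\<bar>f (X n \<omega>) - f (Y n \<omega>)\<bar> \<le> d + 2 * C * indicator D \<omega>"
        proof (cases "\<omega> \<in> D")
          case True
          then show ?thesis using C[of "X n \<omega>"] C[of "Y n \<omega>"] d(1) by simp
        next
          case False
          then have 1: "norm (Y n \<omega>) \<le> R" "norm (X n \<omega> - Y n \<omega>) \<le> \<delta>'"
            using \<omega> spec[OF B(1), of n] by (auto simp: D_def not_less)
          then have "norm (X n \<omega>) \<le> R + 1"
            using norm_triangle_sub[of "X n \<omega>" "Y n \<omega>"] \<delta>'(2) by linarith
          then have "X n \<omega> \<in> cball 0 (R + 1)" by simp
          moreover have "Y n \<omega> \<in> cball 0 (R + 1)" using 1(1) by simp
          moreover have "dist (X n \<omega>) (Y n \<omega>) < \<delta>" using 1(2) \<delta>'(3) unfolding dist_norm by linarith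
          ultimately have "dist (f (X n \<omega>)) (f (Y n \<omega>)) < d" using \<delta>(2) by blast
          then show ?thesis using False by (simp add: dist_real_def)
        qed
      qed
      also have "\<dots> = d + 2 * C * prob D" by (simp add: prob_space less_top[symmetric])
      also have "\<dots> \<le> d + 2 * C * (2 * d)" using PD C0 by (intro add_left_mono mult_left_mono) auto
      also have "\<dots> < e" using d by (simp add: algebra_simps)
      finally show "norm (outer_exp M (\<lambda>\<omega>. f (X n \<omega>)) - expectation (\<lambda>\<omega>. f (Y n \<omega>)) - 0) < e" by simp
    qed
  qed
  from tendsto_add[OF this conv[of f]] f
  show "(\<lambda>n. outer_exp M (\<lambda>\<omega>. f (X n \<omega>))) \<longlonglongrightarrow> integral\<^sup>L L f" by simp
qed

end

section \<open>Stochastic order and square integrable functions\<close>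

text \<open>An outer probability at most \<delta> for all large n; the failure set need not be
  measurable and is therefore covered. Keeping the level explicit makes intersections of events a
  matter of adding levels, and \<open>op_small\<close> is recovered by allowing every level.\<close>

definition fails_rarely :: "'a measure \<Rightarrow> real \<Rightarrow> (nat \<Rightarrow> 'a \<Rightarrow> bool) \<Rightarrow> bool" where
  "fails_rarely M \<delta> P \<longleftrightarrow>
    (\<forall>\<^sub>F n in sequentially. \<exists>B\<in>sets M. {\<omega> \<in> space M. \<not> P n \<omega>} \<subseteq> B \<and> measure M B \<le> \<delta>)"

context prob_space begin

lemma fails_rarely_mono:
  assumes "fails_rarely M \<delta> P" "\<forall>\<^sub>F n in sequentially. \<forall>\<omega>\<in>space M. P n \<omega> \<longrightarrow> R n \<omega>"
  shows "fails_rarely M \<delta> R"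
  using assms unfolding fails_rarely_def
proof eventually_elim
  case (elim n)
  then obtain B where "B \<in> sets M" "{\<omega> \<in> space M. \<not> P n \<omega>} \<subseteq> B" "measure M B \<le> \<delta>" by blast
  with elim(2) show ?case by (intro bexI[of _ B]) auto
qed

lemma fails_rarely_conj:
  assumes "fails_rarely M \<delta> P" "fails_rarely M \<delta>' R"
  shows "fails_rarely M (\<delta> + \<delta>') (\<lambda>n \<omega>. P n \<omega> \<and> R n \<omega>)"
  using assms unfolding fails_rarely_def
proof eventually_elim
  case (elim n)
  then obtain B B' where B: "B \<in> sets M" "{\<omega> \<in> space M. \<not> P n \<omega>} \<subseteq> B" "measure M B \<le> \<delta>"
    "B' \<in> sets M" "{\<omega> \<in> space M. \<not> R n \<omega>} \<subseteq> B'" "measure M B' \<le> \<delta>'" by blast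
  have "measure M (B \<union> B') \<le> \<delta> + \<delta>'" using measure_Un_le[OF B(1,4)] B(3,6) by linarith
  with B show ?case by (intro bexI[of _ "B \<union> B'"]) auto
qed

lemma fails_rarely_finite:
  assumes "finite I" "\<And>i \<delta>. i \<in> I \<Longrightarrow> 0 < \<delta> \<Longrightarrow> fails_rarely M \<delta> (P i)" "0 < \<delta>"
  shows "fails_rarely M \<delta> (\<lambda>n \<omega>. \<forall>i\<in>I. P i n \<omega>)"
  using assms
proof (induction I arbitrary: \<delta> rule: finite_induct)
  case empty
  then show ?case unfolding fails_rarely_def by (intro always_eventually allI bexI[of _ "{}"]) auto
next
  case (insert i I)
  have "fails_rarely M (\<delta> / 2 + \<delta> / 2) (\<lambda>n \<omega>. P i n \<omega> \<and> (\<forall>i\<in>I. P i n \<omega>))"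
    using insert by (intro fails_rarely_conj) auto
  then show ?case by simp
qed

text \<open>The failure set of a nonrandom statement is empty or the whole space, and the latter has
  probability 1. Deterministic facts can thus be read off from events of merely positive
  probability.\<close>

lemma fails_rarely_const:
  assumes "fails_rarely M \<delta> (\<lambda>n \<omega>. R n)" "\<delta> < 1"
  shows "\<forall>\<^sub>F n in sequentially. R n"
  using assms(1) unfolding fails_rarely_def
proof eventually_elim
  case (elim n)
  then obtain B where B: "B \<in> sets M" "{\<omega> \<in> space M. \<not> R n} \<subseteq> B" "measure M B \<le> \<delta>" by blast
  show ?case
  proof (rule ccontr)
    assume "\<not> R n"
    then have "B = space M" using B(2) sets.sets_into_space[OF B(1)] by auto
    then show False using B(3) assms(2) prob_space by simp
  qed
qed

lemma fails_rarely_markov: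
  assumes "\<forall>\<^sub>F n in sequentially. integrable M (X n) \<and> (\<forall>\<omega>\<in>space M. 0 \<le> X n \<omega>)
      \<and> 0 < b n \<and> expectation (X n) \<le> \<delta> * b n"
  shows "fails_rarely M \<delta> (\<lambda>n \<omega>. X n \<omega> \<le> b n)"
  using assms unfolding fails_rarely_def
proof eventually_elim
  case (elim n)
  then have [measurable]: "X n \<in> borel_measurable M" by (simp add: borel_measurable_integrable)
  have "measure M {\<omega> \<in> space M. b n \<le> X n \<omega>} \<le> expectation (X n) / b n"
    using elim by (intro integral_Markov_inequality_measure[where A="space M"]) auto
  also have "\<dots> \<le> \<delta>" using elim by (simp add: pos_divide_le_eq)
  finally show ?case by (intro bexI[of _ "{\<omega> \<in> space M. b n \<le> X n \<omega>}"]) auto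
qed

lemma fails_rarely_op_small:
  assumes "op_small M X a" "0 < \<epsilon>" "0 < \<delta>"
  shows "fails_rarely M \<delta> (\<lambda>n \<omega>. \<bar>X n \<omega>\<bar> \<le> \<epsilon> * a n)"
proof -
  from assms(1)[unfolded op_small_def, rule_format, OF assms(2)]
  obtain B where B: "\<forall>n. B n \<in> sets M \<and> {\<omega> \<in> space M. \<epsilon> * a n < \<bar>X n \<omega>\<bar>} \<subseteq> B n"
    "(\<lambda>n. prob (B n)) \<longlonglongrightarrow> 0" by (elim exE conjE)
  from order_tendstoD(2)[OF B(2) assms(3)] show ?thesis
    unfolding fails_rarely_def
  proof eventually_elim
    case (elim n)
    then show ?case using spec[OF B(1), of n] by (intro bexI[of _ "B n"]) (auto simp: not_le)
  qed
qed

text \<open>Near-minimal measurable covers give a single sequence that works for all levels.\<close>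

lemma fails_rarely_cover:
  assumes "\<And>\<delta>. 0 < \<delta> \<Longrightarrow> fails_rarely M \<delta> P"
  shows "\<exists>B. (\<forall>n. B n \<in> sets M \<and> {\<omega> \<in> space M. \<not> P n \<omega>} \<subseteq> B n) \<and> (\<lambda>n. prob (B n)) \<longlonglongrightarrow> 0"
proof -
  define C where "C n = {B \<in> sets M. {\<omega> \<in> space M. \<not> P n \<omega>} \<subseteq> B}" for n
  have "\<exists>B. B \<in> C n \<and> (\<forall>B'\<in>C n. prob B \<le> prob B' + 1 / real (Suc n))" for n
  proof -
    have "space M \<in> C n" by (auto simp: C_def)
    then have ne: "prob ` C n \<noteq> {}" by blast
    have bdd: "bdd_below (prob ` C n)" by (rule bdd_belowI[of _ 0]) auto
    have "Inf (prob ` C n) < Inf (prob ` C n) + 1 / real (Suc n)" by simp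
    then obtain B where B: "B \<in> C n" "prob B < Inf (prob ` C n) + 1 / real (Suc n)"
      using cInf_lessD[OF ne] by blast
    have "prob B \<le> prob B' + 1 / real (Suc n)" if "B' \<in> C n" for B'
      using B(2) cInf_lower[OF imageI[OF that, of prob] bdd] by linarith
    then show ?thesis using B(1) by blast
  qed
  then obtain B where B: "\<And>n. B n \<in> C n" "\<And>n B'. B' \<in> C n \<Longrightarrow> prob (B n) \<le> prob B' + 1 / real (Suc n)"
    by metis
  have "(\<lambda>n. prob (B n)) \<longlonglongrightarrow> 0"
  proof (rule tendstoI)
    fix e :: real assume e: "0 < e"
    have "\<forall>\<^sub>F n in sequentially. \<exists>B\<in>sets M. {\<omega> \<in> space M. \<not> P n \<omega>} \<subseteq> B \<and> prob B \<le> e / 2"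
      using assms[of "e / 2"] e by (simp add: fails_rarely_def)
    moreover have "\<forall>\<^sub>F n in sequentially. 1 / real (Suc n) < e / 2"
      using order_tendstoD(2)[OF LIMSEQ_inverse_real_of_nat, of "e / 2"] e by (simp add: inverse_eq_divide)
    ultimately show "\<forall>\<^sub>F n in sequentially. dist (prob (B n)) 0 < e"
    proof eventually_elim
      case (elim n)
      then obtain B' where "B' \<in> C n" "prob B' \<le> e / 2" by (auto simp: C_def)
      then show ?case using B(2)[of B' n] elim(2) by simp
    qed
  qed
  then show ?thesis using B(1) by (intro exI[of _ B]) (auto simp: C_def)
qed

text \<open>\<open>op_small\<close> asks for one sequence of covers whose probabilities tend to 0,
  whereas the right-hand side provides separate covers for each level;
  \<open>fails_rarely_cover\<close> bridges the gap.\<close>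

lemma op_small_iff_fails_rarely:
  "op_small M X a \<longleftrightarrow> (\<forall>\<epsilon>>0. \<forall>\<delta>>0. fails_rarely M \<delta> (\<lambda>n \<omega>. \<bar>X n \<omega>\<bar> \<le> \<epsilon> * a n))"
proof
  assume "\<forall>\<epsilon>>0. \<forall>\<delta>>0. fails_rarely M \<delta> (\<lambda>n \<omega>. \<bar>X n \<omega>\<bar> \<le> \<epsilon> * a n)"
  then show "op_small M X a"
    unfolding op_small_def using fails_rarely_cover[of "\<lambda>n \<omega>. \<bar>X n \<omega>\<bar> \<le> _ * a n"] by (simp only: not_le) blast
qed (use fails_rarely_op_small in blast)

end

section \<open>Square integrable functions\<close>

definition L2_on :: "'z measure \<Rightarrow> ('z \<Rightarrow> real) \<Rightarrow> bool" where
  "L2_on Q f \<longleftrightarrow> f \<in> borel_measurable Q \<and> integrable Q (\<lambda>z. (f z)\<^sup>2)"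

lemma L2_onD [dest]: "L2_on Q f \<Longrightarrow> f \<in> borel_measurable Q" "L2_on Q f \<Longrightarrow> integrable Q (\<lambda>z. (f z)\<^sup>2)"
  by (auto simp: L2_on_def)

lemma L2_on_prod:
  assumes "L2_on Q f" "L2_on Q g"
  shows "integrable Q (\<lambda>z. f z * g z)"
proof (rule Bochner_Integration.integrable_bound)
  show "integrable Q (\<lambda>z. (f z)\<^sup>2 + (g z)\<^sup>2)" using assms by (auto simp: L2_on_def)
  show "(\<lambda>z. f z * g z) \<in> borel_measurable Q" using assms by (auto simp: L2_on_def)
  show "AE z in Q. norm (f z * g z) \<le> norm ((f z)\<^sup>2 + (g z)\<^sup>2)"
  proof (rule AE_I2)
    fix z
    have "2 * \<bar>f z\<bar> * \<bar>g z\<bar> \<le> (f z)\<^sup>2 + (g z)\<^sup>2" using sum_squares_bound[of "\<bar>f z\<bar>" "\<bar>g z\<bar>"] by simp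
    moreover have "0 \<le> \<bar>f z\<bar> * \<bar>g z\<bar>" by simp
    ultimately show "norm (f z * g z) \<le> norm ((f z)\<^sup>2 + (g z)\<^sup>2)"
      unfolding real_norm_def abs_mult by linarith
  qed
qed

lemma L2_on_scale: "L2_on Q f \<Longrightarrow> L2_on Q (\<lambda>z. c * f z)"
  by (auto simp: L2_on_def power_mult_distrib)

lemma L2_on_add:
  assumes "L2_on Q f" "L2_on Q g"
  shows "L2_on Q (\<lambda>z. f z + g z)"
proof -
  have "integrable Q (\<lambda>z. (f z)\<^sup>2 + (g z)\<^sup>2 + 2 * (f z * g z))"
    using L2_on_prod[OF assms] assms by (auto simp: L2_on_def)
  then show ?thesis using assms by (auto simp: L2_on_def power2_sum mult.assoc)
qed

lemma L2_on_diff: "L2_on Q f \<Longrightarrow> L2_on Q g \<Longrightarrow> L2_on Q (\<lambda>z. f z - g z)"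
  using L2_on_add[of Q f "\<lambda>z. - 1 * g z"] L2_on_scale[of Q g "-1"] by simp

lemma L2_on_sum:
  "(\<And>k. k \<in> I \<Longrightarrow> L2_on Q (f k)) \<Longrightarrow> finite I \<Longrightarrow> L2_on Q (\<lambda>z. \<Sum>k\<in>I. f k z)"
proof (induction I rule: infinite_finite_induct)
  case empty
  then show ?case by (simp add: L2_on_def)
qed (auto intro: L2_on_add)

lemma L2_on_integrable: "finite_measure Q \<Longrightarrow> L2_on Q f \<Longrightarrow> integrable Q f"
  using L2_on_prod[of Q f "\<lambda>_. 1"] by (simp add: L2_on_def finite_measure.integrable_const)

lemma integral_square_ge:
  assumes "prob_space Q" "L2_on Q f"
  shows "(integral\<^sup>L Q f)\<^sup>2 \<le> integral\<^sup>L Q (\<lambda>z. (f z)\<^sup>2)"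
proof -
  interpret prob_space Q by fact
  have "0 \<le> integral\<^sup>L Q (\<lambda>z. (f z - integral\<^sup>L Q f)\<^sup>2)" by simp
  also have "\<dots> = integral\<^sup>L Q (\<lambda>z. (f z)\<^sup>2) - (integral\<^sup>L Q f)\<^sup>2"
    using assms(2) L2_on_integrable[OF finite_measure assms(2)] by (intro variance_eq) (auto simp: L2_on_def)
  finally show ?thesis by simp
qed

section \<open>The weak law of large numbers\<close>

context iid_sample begin

lemmas L2_integrable = L2_on_integrable[OF Q.finite_measure_axioms]

lemma expectation_mean:
  assumes "integrable Q g" "0 < n"
  shows "integrable M (\<lambda>\<omega>. (\<Sum>j<n. g (Z j \<omega>)) / real n)"
    "expectation (\<lambda>\<omega>. (\<Sum>j<n. g (Z j \<omega>)) / real n) = (integral\<^sup>L Q g :: real)"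
  using integrable_comp_Z[OF assms(1)] integral_comp_Z[OF borel_measurable_integrable[OF assms(1)]] assms(2)
  by (auto simp: Bochner_Integration.integral_sum)

lemma mean_second_moment:
  assumes "L2_on Q f" "integral\<^sup>L Q f = 0"
  shows "integrable M (\<lambda>\<omega>. ((\<Sum>j<n. f (Z j \<omega>)) / real n)\<^sup>2)"
    "expectation (\<lambda>\<omega>. ((\<Sum>j<n. f (Z j \<omega>)) / real n)\<^sup>2) = integral\<^sup>L Q (\<lambda>z. (f z)\<^sup>2) / real n"
proof -
  note s = iid_sum_second_moment[OF L2_onD[OF assms(1)] assms(2), of n]
  show "integrable M (\<lambda>\<omega>. ((\<Sum>j<n. f (Z j \<omega>)) / real n)\<^sup>2)"
    unfolding power_divide using s(1) by simp
  show "expectation (\<lambda>\<omega>. ((\<Sum>j<n. f (Z j \<omega>)) / real n)\<^sup>2) = integral\<^sup>L Q (\<lambda>z. (f z)\<^sup>2) / real n"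
    unfolding power_divide using s by (simp add: power2_eq_square)
qed

lemma truncation_error_tendsto:
  assumes f: "integrable Q f"
  shows "(\<lambda>K::nat. integral\<^sup>L Q (\<lambda>z. \<bar>f z - max (- real K) (min (real K) (f z))\<bar>)) \<longlonglongrightarrow> (0::real)"
proof -
  note [measurable] = borel_measurable_integrable[OF f]
  have "(\<lambda>K::nat. integral\<^sup>L Q (\<lambda>z. \<bar>f z - max (- real K) (min (real K) (f z))\<bar>)) \<longlonglongrightarrow> integral\<^sup>L Q (\<lambda>z. 0 :: real)"
  proof (rule integral_dominated_convergence[where w="\<lambda>z. \<bar>f z\<bar>"])
    show "AE z in Q. (\<lambda>K. \<bar>f z - max (- real K) (min (real K) (f z))\<bar>) \<longlonglongrightarrow> 0"
    proof (rule AE_I2)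
      fix z
      obtain K0 :: nat where "\<bar>f z\<bar> \<le> real K0" using real_arch_simple by blast
      then have "\<forall>K\<ge>K0. \<bar>f z - max (- real K) (min (real K) (f z))\<bar> = 0" by (auto simp: max_def min_def)
      then show "(\<lambda>K. \<bar>f z - max (- real K) (min (real K) (f z))\<bar>) \<longlonglongrightarrow> 0"
        by (intro tendsto_eventually) (auto simp: eventually_sequentially)
    qed
    show "AE z in Q. norm \<bar>f z - max (- real K) (min (real K) (f z))\<bar> \<le> \<bar>f z\<bar>" for K
      by (rule AE_I2) (auto simp: max_def min_def)
  qed (use f in auto)
  then show ?thesis by simp
qed

text \<open>The law is applied to products of two square integrable functions, which are merely
  integrable. Hence truncation: Chebyshev handles the bounded part and Markov the tail.\<close>

theorem weak_law_of_large_numbers: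
  assumes f: "integrable Q f" and \<epsilon>: "0 < \<epsilon>" and \<delta>: "0 < \<delta>"
  shows "fails_rarely M \<delta> (\<lambda>n \<omega>. \<bar>(\<Sum>j<n. f (Z j \<omega>)) / real n - integral\<^sup>L Q f\<bar> \<le> \<epsilon>)"
proof -
  note [measurable] = borel_measurable_integrable[OF f]
  \<comment> \<open>One third of the tolerance goes to the centred truncated mean, one to the mean
    of the tail, one to the shift of the integral. The second bound lets Markov assign level
    \<delta> / 2 to the tail.\<close>
  define \<eta> where "\<eta> = min (\<epsilon> / 3) (\<delta> / 2 * (\<epsilon> / 3))"
  have \<eta>: "0 < \<eta>" "\<eta> \<le> \<epsilon> / 3" "\<eta> \<le> \<delta> / 2 * (\<epsilon> / 3)" using \<epsilon> \<delta> by (auto simp: \<eta>_def)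
  obtain K :: nat where K: "integral\<^sup>L Q (\<lambda>z. \<bar>f z - max (- real K) (min (real K) (f z))\<bar>) < \<eta>"
    using order_tendstoD(2)[OF truncation_error_tendsto[OF f] \<eta>(1)] by (auto simp: eventually_sequentially)
  define t where "t z = max (- real K) (min (real K) (f z))" for z
  have tb: "\<bar>t z\<bar> \<le> real K" for z by (auto simp: t_def)
  have [measurable]: "t \<in> borel_measurable Q" unfolding t_def by measurable
  have ti: "integrable Q t" by (rule Q.integrable_const_bound[where B="real K"]) (use tb in auto)
  define g where "g z = \<bar>f z - t z\<bar>" for z
  have g: "integrable Q g" "integral\<^sup>L Q g < \<eta>" 
    using f ti K unfolding g_def[abs_def] t_def[abs_def] by (auto intro!: integrable_abs Bochner_Integration.integrable_diff)
  define h where "h z = t z - integral\<^sup>L Q t" for z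
  have hb: "\<bar>h z\<bar> \<le> 2 * real K" for z
  proof -
    have "\<bar>integral\<^sup>L Q t\<bar> \<le> integral\<^sup>L Q (\<lambda>z. \<bar>t z\<bar>)" by (rule integral_abs_bound)
    also have "\<dots> \<le> integral\<^sup>L Q (\<lambda>z. real K)" using ti tb by (intro integral_mono) auto
    finally show ?thesis using tb[of z] unfolding h_def by (simp add: Q.prob_space)
  qed
  have [measurable]: "h \<in> borel_measurable Q" unfolding h_def by measurable
  have h2: "(h z)\<^sup>2 \<le> (2 * real K)\<^sup>2" for z using power_mono[OF hb[of z], of 2] by simp
  have "integrable Q (\<lambda>z. (h z)\<^sup>2)"
    by (rule Q.integrable_const_bound[where B="(2 * real K)\<^sup>2"]) (use h2 in auto)
  then have h: "L2_on Q h" "integral\<^sup>L Q h = 0"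
    using ti by (simp_all add: L2_on_def h_def[abs_def] Q.prob_space)
  have hI: "integral\<^sup>L Q (\<lambda>z. (h z)\<^sup>2) \<le> (2 * real K)\<^sup>2"
    using integral_mono[OF L2_onD(2)[OF h(1)], of "\<lambda>_. (2 * real K)\<^sup>2"] h2 by (simp add: Q.prob_space)
  have A: "fails_rarely M (\<delta> / 2) (\<lambda>n \<omega>. (\<Sum>j<n. g (Z j \<omega>)) / real n \<le> \<epsilon> / 3)"
  proof (rule fails_rarely_markov, rule eventually_mono[OF eventually_gt_at_top[of 0]])
    fix n :: nat assume n: "0 < n"
    show "integrable M (\<lambda>\<omega>. (\<Sum>j<n. g (Z j \<omega>)) / real n) \<and> (\<forall>\<omega>\<in>space M. 0 \<le> (\<Sum>j<n. g (Z j \<omega>)) / real n)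
      \<and> 0 < \<epsilon> / 3 \<and> expectation (\<lambda>\<omega>. (\<Sum>j<n. g (Z j \<omega>)) / real n) \<le> \<delta> / 2 * (\<epsilon> / 3)"
      using expectation_mean[OF g(1) n] g(2) \<eta> \<epsilon> by (auto simp: g_def intro!: divide_nonneg_nonneg sum_nonneg)
  qed
  have "(\<lambda>n. (2 * real K)\<^sup>2 / real n) \<longlonglongrightarrow> 0" by (rule lim_const_over_n)
  then have "\<forall>\<^sub>F n in sequentially. (2 * real K)\<^sup>2 / real n < \<delta> / 2 * (\<epsilon> / 3)\<^sup>2"
    using \<epsilon> \<delta> by (intro order_tendstoD) auto
  then have B: "fails_rarely M (\<delta> / 2) (\<lambda>n \<omega>. ((\<Sum>j<n. h (Z j \<omega>)) / real n)\<^sup>2 \<le> (\<epsilon> / 3)\<^sup>2)"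
  proof (intro fails_rarely_markov, eventually_elim)
    case (elim n)
    have "expectation (\<lambda>\<omega>. ((\<Sum>j<n. h (Z j \<omega>)) / real n)\<^sup>2) \<le> \<delta> / 2 * (\<epsilon> / 3)\<^sup>2"
      unfolding mean_second_moment(2)[OF h]
      using divide_right_mono[OF hI, of "real n"] elim by linarith
    then show ?case using mean_second_moment(1)[OF h] \<epsilon> by simp
  qed
  have "fails_rarely M (\<delta> / 2 + \<delta> / 2) (\<lambda>n \<omega>. \<bar>(\<Sum>j<n. f (Z j \<omega>)) / real n - integral\<^sup>L Q f\<bar> \<le> \<epsilon>)"
  proof (rule fails_rarely_mono[OF fails_rarely_conj[OF A B]], rule eventually_mono[OF eventually_gt_at_top[of 0]], intro ballI impI)
    fix n :: nat and \<omega> assume n: "0 < n"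
      and *: "(\<Sum>j<n. g (Z j \<omega>)) / real n \<le> \<epsilon> / 3 \<and> ((\<Sum>j<n. h (Z j \<omega>)) / real n)\<^sup>2 \<le> (\<epsilon> / 3)\<^sup>2"
    have 1: "\<bar>(\<Sum>j<n. h (Z j \<omega>)) / real n\<bar> \<le> \<epsilon> / 3" 
      using * abs_le_square_iff[of "(\<Sum>j<n. h (Z j \<omega>)) / real n" "\<epsilon> / 3"] \<epsilon> by linarith
    have 2: "\<bar>(\<Sum>j<n. f (Z j \<omega>) - t (Z j \<omega>)) / real n\<bar> \<le> \<epsilon> / 3"
      using mean_abs[of "\<lambda>j. f (Z j \<omega>) - t (Z j \<omega>)" n] * unfolding g_def by linarith
    have 3: "\<bar>integral\<^sup>L Q t - integral\<^sup>L Q f\<bar> \<le> \<epsilon> / 3"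
    proof -
      have "\<bar>integral\<^sup>L Q (\<lambda>z. f z - t z)\<bar> \<le> integral\<^sup>L Q g" unfolding g_def by (rule integral_abs_bound)
      then have "\<bar>integral\<^sup>L Q f - integral\<^sup>L Q t\<bar> \<le> integral\<^sup>L Q g" using f ti by simp
      then show ?thesis using g(2) \<eta>(2) by linarith
    qed
    have "(\<Sum>j<n. f (Z j \<omega>)) / real n - integral\<^sup>L Q f = (\<Sum>j<n. h (Z j \<omega>)) / real n
        + (\<Sum>j<n. f (Z j \<omega>) - t (Z j \<omega>)) / real n + (integral\<^sup>L Q t - integral\<^sup>L Q f)"
      using n by (simp add: h_def sum_subtractf diff_divide_distrib)
    then show "\<bar>(\<Sum>j<n. f (Z j \<omega>)) / real n - integral\<^sup>L Q f\<bar> \<le> \<epsilon>"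
      using 1 2 3 by linarith
  qed
  then show ?thesis by simp
qed

end

section \<open>Estimated constraint functions\<close>

lemma opnorm_entry:
  assumes "i < p" "k < p"
  shows "\<bar>A i k\<bar> \<le> opnorm p A"
proof -
  let ?e = "\<lambda>j. if j = k then 1 else 0 :: real"
  have "mvec p A ?e i = A i k"
    using assms by (simp add: mvec_def if_distrib cong: if_cong)
  then show ?thesis
    using component_le_vnorm[OF assms(1), of "mvec p A ?e"] opnorm_bound[of p A ?e] vnorm_unit[OF assms(2)] by simp
qed

lemma nonsingular_solve:
  assumes "nonsingular p A"
  shows "\<exists>a. \<forall>k<p. mvec p A a k = g k"
proof -
  obtain B where B: "\<forall>i<p. \<forall>j<p. mmul p A B i j = idm i j \<and> mmul p B A i j = idm i j"
    using assms unfolding nonsingular_def by (elim exE)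
  have "mvec p A (mvec p B g) k = g k" if "k < p" for k
  proof -
    have "mvec p A (mvec p B g) k = (\<Sum>i<p. \<Sum>j<p. A k i * B i j * g j)"
      by (simp add: mvec_def sum_distrib_left mult.assoc)
    also have "\<dots> = (\<Sum>j<p. mmul p A B k j * g j)"
      by (subst sum.swap) (simp add: mmul_def sum_distrib_right)
    also have "\<dots> = (\<Sum>j<p. if k = j then g j else 0)"
      using B that by (intro sum.cong) (auto simp: idm_def)
    finally show ?thesis using that by simp
  qed
  then show ?thesis by blast
qed

text \<open>Homogeneity removes the normalisation of the vector. \<open>max C 0\<close> ensures a
  nonnegative constant, which C alone would not be forced to be if every m n were 0 and there were
  no unit vectors.\<close>

lemma regular_seq_quadratic:
  assumes "regular_seq m W"
  shows "\<exists>c C. 0 < c \<and> 0 \<le> C \<and> (\<forall>n a. c * (vnorm (m n) a)\<^sup>2 \<le> dotp (m n) a (mvec (m n) (W n) a)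
    \<and> dotp (m n) a (mvec (m n) (W n) a) \<le> C * (vnorm (m n) a)\<^sup>2)"
proof -
  from assms[unfolded regular_seq_def]
  obtain c C where c0: "0 < c" "\<forall>n a. vnorm (m n) a = 1 \<longrightarrow> c \<le> dotp (m n) a (mvec (m n) (W n) a)"
    and C0: "\<forall>n a. vnorm (m n) a = 1 \<longrightarrow> dotp (m n) a (mvec (m n) (W n) a) \<le> C"
    by (elim conjE exE)
  note c = c0(1) c0(2)[rule_format] and C = C0[rule_format]
  have q: "c * (vnorm (m n) a)\<^sup>2 \<le> dotp (m n) a (mvec (m n) (W n) a)
      \<and> dotp (m n) a (mvec (m n) (W n) a) \<le> max C 0 * (vnorm (m n) a)\<^sup>2" for n a
  proof (cases "vnorm (m n) a = 0")
    case True
    then have "dotp (m n) a (mvec (m n) (W n) a) = 0"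
      using vnorm_eq_0D[OF True] by (simp add: dotp_def)
    then show ?thesis using True by simp
  next
    case False
    let ?s = "vnorm (m n) a"
    define b where "b = (\<lambda>k. inverse ?s * a k)"
    have b1: "vnorm (m n) b = 1" unfolding b_def vnorm_scale using False by (simp add: abs_of_pos order_less_le)
    have "dotp (m n) b (mvec (m n) (W n) b) = (inverse ?s)\<^sup>2 * dotp (m n) a (mvec (m n) (W n) a)"
      unfolding b_def mvec_scale dotp_scale_right
      by (subst dotp_commute, subst dotp_scale_right, subst dotp_commute) (simp add: power2_eq_square)
    then have "dotp (m n) a (mvec (m n) (W n) a) = ?s\<^sup>2 * dotp (m n) b (mvec (m n) (W n) b)"
      using False by (simp add: field_simps)
    then show ?thesis
      using mult_left_mono[OF c(2)[OF b1] zero_le_power2[of ?s]]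
        mult_left_mono[OF order_trans[OF C[OF b1] max.cobounded1[of C 0]] zero_le_power2[of ?s]]
      by (simp add: mult.commute)
  qed
  show ?thesis by (rule exI[of _ c], rule exI[of _ "max C 0"]) (use c(1) q in auto)
qed

lemma integral_mult_sum:
  assumes "L2_on Q f" "\<And>k. L2_on Q (v k)"
  shows "integral\<^sup>L Q (\<lambda>z. f z * (\<Sum>k<p. c k * v k z)) = (\<Sum>k<p. c k * integral\<^sup>L Q (\<lambda>z. f z * v k z))"
proof -
  have "integral\<^sup>L Q (\<lambda>z. f z * (\<Sum>k<p. c k * v k z)) = integral\<^sup>L Q (\<lambda>z. \<Sum>k<p. c k * (f z * v k z))"
    by (simp add: sum_distrib_left mult_ac)
  also have "\<dots> = (\<Sum>k<p. integral\<^sup>L Q (\<lambda>z. c k * (f z * v k z)))"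
    by (intro Bochner_Integration.integral_sum integrable_mult_right L2_on_prod assms)
  finally show ?thesis by simp
qed

lemma L2_on_lincomb: "(\<And>k. L2_on Q (v k)) \<Longrightarrow> L2_on Q (\<lambda>z. \<Sum>k<p. c k * v k z)" for p :: nat
  by (intro L2_on_sum L2_on_scale) auto

lemma integral_square_diff:
  assumes "L2_on Q f" "L2_on Q g"
  shows "integral\<^sup>L Q (\<lambda>z. (f z - g z)\<^sup>2)
    = integral\<^sup>L Q (\<lambda>z. (f z)\<^sup>2) - 2 * integral\<^sup>L Q (\<lambda>z. f z * g z) + integral\<^sup>L Q (\<lambda>z. (g z)\<^sup>2)"
proof -
  have "integral\<^sup>L Q (\<lambda>z. (f z - g z)\<^sup>2) = integral\<^sup>L Q (\<lambda>z. (f z)\<^sup>2 - 2 * (f z * g z) + (g z)\<^sup>2)"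
    by (simp add: power2_diff algebra_simps)
  also have "\<dots> = integral\<^sup>L Q (\<lambda>z. (f z)\<^sup>2 - 2 * (f z * g z)) + integral\<^sup>L Q (\<lambda>z. (g z)\<^sup>2)"
    using L2_on_prod[OF assms] assms
    by (intro Bochner_Integration.integral_add Bochner_Integration.integrable_diff integrable_mult_right) (auto simp: L2_on_def)
  also have "integral\<^sup>L Q (\<lambda>z. (f z)\<^sup>2 - 2 * (f z * g z))
      = integral\<^sup>L Q (\<lambda>z. (f z)\<^sup>2) - integral\<^sup>L Q (\<lambda>z. 2 * (f z * g z))"
    using L2_on_prod[OF assms] assms
    by (intro Bochner_Integration.integral_diff integrable_mult_right) (auto simp: L2_on_def)
  finally show ?thesis by simp
qed

text \<open>The hypothesis is the system of normal equations, so q is the orthogonal projection of f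
  onto the span of the first p functions. The first claim is Bessel's inequality, as the form equals
  <f, q> = |q|^2; the second is best approximation, stated for shorter combinations so that one
  fixed approximant serves all large p.\<close>

lemma lincomb_projection:
  fixes v :: "nat \<Rightarrow> 'z \<Rightarrow> real"
  assumes f: "L2_on Q f" and v: "\<And>k. L2_on Q (v k)"
    and \<alpha>: "\<And>k. k < p \<Longrightarrow> mvec p (gram Q v) \<alpha> k = integral\<^sup>L Q (\<lambda>z. f z * v k z)"
  defines "q \<equiv> \<lambda>z. \<Sum>k<p. \<alpha> k * v k z"
  shows "dotp p \<alpha> (mvec p (gram Q v) \<alpha>) \<le> integral\<^sup>L Q (\<lambda>z. (f z)\<^sup>2)"
    and "K \<le> p \<Longrightarrow> integral\<^sup>L Q (\<lambda>z. (f z - q z)\<^sup>2) \<le> integral\<^sup>L Q (\<lambda>z. (f z - (\<Sum>k<K. b k * v k z))\<^sup>2)"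
proof -
  have q: "L2_on Q q" unfolding q_def by (rule L2_on_lincomb[OF v])
  have qv: "integral\<^sup>L Q (\<lambda>z. q z * v k z) = integral\<^sup>L Q (\<lambda>z. f z * v k z)" if "k < p" for k
  proof -
    have "integral\<^sup>L Q (\<lambda>z. q z * v k z) = integral\<^sup>L Q (\<lambda>z. v k z * (\<Sum>l<p. \<alpha> l * v l z))"
      by (simp add: q_def mult.commute)
    also have "\<dots> = mvec p (gram Q v) \<alpha> k"
      unfolding integral_mult_sum[OF v v] by (simp add: mvec_def gram_def mult.commute)
    finally show ?thesis using \<alpha>[OF that] by simp
  qed
  have qq: "integral\<^sup>L Q (\<lambda>z. (q z)\<^sup>2) = integral\<^sup>L Q (\<lambda>z. f z * q z)"
  proof -
    have "integral\<^sup>L Q (\<lambda>z. (q z)\<^sup>2) = integral\<^sup>L Q (\<lambda>z. q z * (\<Sum>k<p. \<alpha> k * v k z))"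
      by (simp add: q_def power2_eq_square)
    also have "\<dots> = (\<Sum>k<p. \<alpha> k * integral\<^sup>L Q (\<lambda>z. f z * v k z))"
      unfolding integral_mult_sum[OF q v] using qv by simp
    also have "\<dots> = integral\<^sup>L Q (\<lambda>z. f z * q z)"
      unfolding q_def integral_mult_sum[OF f v] ..
    finally show ?thesis .
  qed
  have "dotp p \<alpha> (mvec p (gram Q v) \<alpha>) = (\<Sum>k<p. \<alpha> k * integral\<^sup>L Q (\<lambda>z. f z * v k z))"
    using \<alpha> by (simp add: dotp_def)
  also have "\<dots> = integral\<^sup>L Q (\<lambda>z. f z * q z)" unfolding q_def integral_mult_sum[OF f v] ..
  finally have d: "dotp p \<alpha> (mvec p (gram Q v) \<alpha>) = integral\<^sup>L Q (\<lambda>z. f z * q z)" .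
  have "0 \<le> integral\<^sup>L Q (\<lambda>z. (f z - q z)\<^sup>2)" by simp
  then show "dotp p \<alpha> (mvec p (gram Q v) \<alpha>) \<le> integral\<^sup>L Q (\<lambda>z. (f z)\<^sup>2)"
    unfolding integral_square_diff[OF f q] qq d by simp
  show "integral\<^sup>L Q (\<lambda>z. (f z - q z)\<^sup>2) \<le> integral\<^sup>L Q (\<lambda>z. (f z - (\<Sum>k<K. b k * v k z))\<^sup>2)" if K: "K \<le> p"
  proof -
    let ?h = "\<lambda>z. \<Sum>k<K. b k * v k z"
    have h: "L2_on Q ?h" by (rule L2_on_lincomb[OF v])
    have 1: "integral\<^sup>L Q (\<lambda>z. f z * ?h z) = integral\<^sup>L Q (\<lambda>z. q z * ?h z)"
      unfolding integral_mult_sum[OF f v] integral_mult_sum[OF q v] using qv K by (intro sum.cong) auto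
    have "0 \<le> integral\<^sup>L Q (\<lambda>z. (q z - ?h z)\<^sup>2)" by simp
    then show ?thesis
      unfolding integral_square_diff[OF f q] integral_square_diff[OF f h] integral_square_diff[OF q h] qq 1 by simp
  qed
qed

text \<open>\<open>x n \<omega> j\<close> stands for the estimator at the j-th observation. Every
  condition involves the estimator through these values only, so the estimator as a function
  disappears from the analysis.\<close>

locale estimated_constraints = iid_sample M Q Z
  for M :: "'a measure" and Q :: "'z measure" and Z :: "nat \<Rightarrow> 'a \<Rightarrow> 'z" +
  fixes psi :: "'z \<Rightarrow> real^'r" and m :: "nat \<Rightarrow> nat"
    and u :: "nat \<Rightarrow> 'z \<Rightarrow> real"
    and v :: "nat \<Rightarrow> 'z \<Rightarrow> real" and phi :: "'z \<Rightarrow> real^'r"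
    and x :: "nat \<Rightarrow> 'a \<Rightarrow> nat \<Rightarrow> nat \<Rightarrow> real"
  assumes psi: "\<And>i. L2_on Q (\<lambda>z. psi z $ i)"
    and m_lim: "filterlim m at_top sequentially"
    and W_nonsing: "\<And>n. nonsingular (m n) (gram Q u)"
    and W_regular: "regular_seq m (\<lambda>_. gram Q u)"
    and cond_i: "op_small M (\<lambda>n \<omega>. Max ((\<lambda>j. vnorm (m n) (x n \<omega> j)) ` {..<n}))
                   (\<lambda>n. real (m n) powr (-3/2) * real n powr (1/2))"
    and cond_ii: "op_small M (\<lambda>n \<omega>. opnorm (m n) (\<lambda>i k. emp_gram n (x n \<omega>) i k - gram Q u i k))
                   (\<lambda>n. real (m n) powr (-1))"
    and cond_iii_int: "\<And>n j i k. j < n \<Longrightarrow> k < m n \<Longrightarrow> integrable M (\<lambda>\<omega>. psi (Z j \<omega>) $ i * x n \<omega> j k)"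
    and cond_iii: "op_small M (\<lambda>n \<omega>. sqrt (\<Sum>i\<in>UNIV. \<Sum>k<m n.
                   ((\<Sum>j<n. psi (Z j \<omega>) $ i * x n \<omega> j k
                       - integral\<^sup>L M (\<lambda>\<omega>'. psi (Z j \<omega>') $ i * x n \<omega>' j k)) / real n)\<^sup>2))
                   (\<lambda>n. real (m n) powr (-1/2))"
    and v: "\<And>k. L2_on Q (v k)"
    and v_mean: "\<And>k. integral\<^sup>L Q (v k) = 0"
    and cond_iv_int: "\<And>n j. j < n \<Longrightarrow>
                   integrable M (\<lambda>\<omega>. (vnorm (m n) (\<lambda>k. x n \<omega> j k - v k (Z j \<omega>)))\<^sup>2)"
    and cond_iv: "(\<lambda>n. (\<Sum>j<n. integral\<^sup>L M
                     (\<lambda>\<omega>. (vnorm (m n) (\<lambda>k. x n \<omega> j k - v k (Z j \<omega>)))\<^sup>2)) / real n)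
                   \<in> o(\<lambda>n. real (m n) powr (-1))"
    and cond_v: "op_small M (\<lambda>n \<omega>. vnorm (m n)
                     (\<lambda>k. (\<Sum>j<n. x n \<omega> j k) / real n - (\<Sum>j<n. v k (Z j \<omega>)) / real n))
                   (\<lambda>n. real (m n) powr (-1/2) * real n powr (-1/2))"
    and phi_proj: "\<And>i. l2_proj Q v (\<lambda>z. psi z $ i) (\<lambda>z. phi z $ i)"
begin

abbreviation "dist_v n \<omega> j \<equiv> vnorm (m n) (\<lambda>k. x n \<omega> j k - v k (Z j \<omega>))"
abbreviation "vbar n \<omega> \<equiv> \<lambda>k. (\<Sum>j<n. v k (Z j \<omega>)) / real n"
abbreviation "cross_v i k \<equiv> integral\<^sup>L Q (\<lambda>z. psi z $ i * v k z)"
abbreviation "sol_unique n \<omega> \<equiv> \<exists>!\<zeta>. el_sol (m n) n (x n \<omega>) \<zeta>"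
abbreviation "zeta n \<omega> \<equiv> THE \<zeta>. el_sol (m n) n (x n \<omega>) \<zeta>"

lemma eventually_m_gt: "\<forall>\<^sub>F n in sequentially. k < m n"
  using m_lim unfolding filterlim_at_top by (auto dest: spec[of _ "Suc k"] simp: Suc_le_eq)

lemma phi: "L2_on Q (\<lambda>z. phi z $ i)"
  and phi_psi: "integral\<^sup>L Q (\<lambda>z. phi z $ i * v k z) = cross_v i k"
proof -
  show p: "L2_on Q (\<lambda>z. phi z $ i)"
    using phi_proj[of i] by (auto simp: l2_proj_def in_closed_span_def L2_on_def)
  have "integral\<^sup>L Q (\<lambda>z. (psi z $ i - phi z $ i) * v k z) = 0"
    using phi_proj[of i] by (auto simp: l2_proj_def)
  then show "integral\<^sup>L Q (\<lambda>z. phi z $ i * v k z) = cross_v i k"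
    using L2_on_prod[OF p v] L2_on_prod[OF psi v] by (simp add: left_diff_distrib)
qed

lemma phi_approx: "0 < e \<Longrightarrow> \<exists>K c. integral\<^sup>L Q (\<lambda>z. (phi z $ i - (\<Sum>k<K. c k * v k z))\<^sup>2) < e"
  using phi_proj[of i] by (auto simp: l2_proj_def in_closed_span_def)

text \<open>phi is a mean square limit of combinations of the centred functions v, and the integral
  is continuous in mean square by \<open>integral_square_ge\<close>.\<close>

lemma phi_mean: "integral\<^sup>L Q (\<lambda>z. phi z $ i) = 0"
proof -
  have "(integral\<^sup>L Q (\<lambda>z. phi z $ i))\<^sup>2 < e" if e: "0 < e" for e
  proof -
    obtain K c where K: "integral\<^sup>L Q (\<lambda>z. (phi z $ i - (\<Sum>k<K. c k * v k z))\<^sup>2) < e"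
      using phi_approx[OF e] by blast
    let ?q = "\<lambda>z. \<Sum>k<K. c k * v k z"
    have q: "L2_on Q ?q" by (rule L2_on_lincomb[OF v])
    have "integral\<^sup>L Q ?q = (\<Sum>k<K. c k * integral\<^sup>L Q (v k))"
      using L2_integrable[OF v] by (simp add: Bochner_Integration.integral_sum)
    then have "integral\<^sup>L Q ?q = 0" by (simp add: v_mean)
    then have "integral\<^sup>L Q (\<lambda>z. phi z $ i) = integral\<^sup>L Q (\<lambda>z. phi z $ i - ?q z)"
      using L2_integrable[OF phi] L2_integrable[OF q] by simp
    then show ?thesis
      using integral_square_ge[OF Q.prob_space_axioms L2_on_diff[OF phi q, of i]] K by simp
  qed
  note less = this
  show ?thesis
  proof (rule ccontr)
    assume "\<not> ?thesis"
    then show False using less[of "(integral\<^sup>L Q (\<lambda>z. phi z $ i))\<^sup>2"] by simp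
  qed
qed

lemma mean_distance_small:
  assumes "0 < \<eta>" "0 < \<delta>"
  shows "fails_rarely M \<delta> (\<lambda>n \<omega>. (\<Sum>j<n. (dist_v n \<omega> j)\<^sup>2) / real n \<le> \<eta>)"
proof (rule fails_rarely_markov)
  have "\<forall>\<^sub>F n in sequentially. norm ((\<Sum>j<n. integral\<^sup>L M (\<lambda>\<omega>. (dist_v n \<omega> j)\<^sup>2)) / real n)
      \<le> (\<delta> * \<eta>) * norm (real (m n) powr (-1))"
    using assms by (intro landau_o.smallD[OF cond_iv]) simp
  then show "\<forall>\<^sub>F n in sequentially.
      integrable M (\<lambda>\<omega>. (\<Sum>j<n. (dist_v n \<omega> j)\<^sup>2) / real n) \<and>
      (\<forall>\<omega>\<in>space M. 0 \<le> (\<Sum>j<n. (dist_v n \<omega> j)\<^sup>2) / real n) \<and> 0 < \<eta> \<and>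
      expectation (\<lambda>\<omega>. (\<Sum>j<n. (dist_v n \<omega> j)\<^sup>2) / real n) \<le> \<delta> * \<eta>"
    using eventually_m_gt[of 0]
  proof eventually_elim
    case (elim n)
    have "real (m n) powr (-1) \<le> 1" using elim(2) by (simp add: powr_minus inverse_le_1_iff)
    then have "(\<delta> * \<eta>) * norm (real (m n) powr (-1)) \<le> \<delta> * \<eta>"
      using assms by (intro mult_left_le) auto
    moreover have "expectation (\<lambda>\<omega>. (\<Sum>j<n. (dist_v n \<omega> j)\<^sup>2) / real n)
        = (\<Sum>j<n. integral\<^sup>L M (\<lambda>\<omega>. (dist_v n \<omega> j)\<^sup>2)) / real n"
      using cond_iv_int by (simp add: Bochner_Integration.integral_sum)
    ultimately have "expectation (\<lambda>\<omega>. (\<Sum>j<n. (dist_v n \<omega> j)\<^sup>2) / real n) \<le> \<delta> * \<eta>"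
      using elim(1) unfolding real_norm_def by linarith
    moreover have "integrable M (\<lambda>\<omega>. (\<Sum>j<n. (dist_v n \<omega> j)\<^sup>2) / real n)"
      using cond_iv_int by (intro integrable_divide Bochner_Integration.integrable_sum) auto
    ultimately show ?case
      using assms(1) by (auto intro!: divide_nonneg_nonneg sum_nonneg)
  qed
qed

text \<open>The functions u and v do not depend on n. Hence the law of large numbers for each fixed
  entry, combined with (ii) and (iv), makes the two Gram matrices coincide exactly.\<close>

lemma gram_eq: "gram Q u i k = gram Q v i k"
proof -
  \<comment> \<open>B^2 bounds the empirical second moments of \<open>v i\<close> and
    \<open>v k\<close> once these are within 1 of their expectations.\<close>
  define B where "B = sqrt (gram Q v i i + gram Q v k k + 1)"
  have diag: "0 \<le> gram Q v j j" for j by (simp add: gram_def)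
  have B: "B\<^sup>2 = gram Q v i i + gram Q v k k + 1" "0 \<le> B"
    using diag[of i] diag[of k] by (auto simp: B_def)
  have LLN: "fails_rarely M (1/8) (\<lambda>n \<omega>. \<bar>(\<Sum>j<n. v a (Z j \<omega>) * v b (Z j \<omega>)) / real n - gram Q v a b\<bar> \<le> \<epsilon>)"
    if "0 < \<epsilon>" for a b \<epsilon>
    unfolding gram_def by (rule weak_law_of_large_numbers[OF L2_on_prod[OF v v] that]) simp
  have "\<bar>gram Q u i k - gram Q v i k\<bar> \<le> 3 * \<epsilon>" if \<epsilon>: "0 < \<epsilon>" for \<epsilon>
  proof -
    \<comment> \<open>Replacing x by v in a product of two coordinates costs at most 2 B \<eta> +
      \<eta>^2 on average, which this choice keeps below \<epsilon>.\<close>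
    define \<eta> where "\<eta> = min 1 (\<epsilon> / (2 * B + 1))"
    have "0 < 2 * B + 1" using B by simp
    moreover have "\<eta> \<le> \<epsilon> / (2 * B + 1)" by (simp add: \<eta>_def)
    ultimately have "\<eta> * (2 * B + 1) \<le> \<epsilon>" by (simp only: pos_le_divide_eq)
    moreover have \<eta>: "0 < \<eta>" "\<eta> \<le> 1" using \<epsilon> \<open>0 < 2 * B + 1\<close> by (auto simp: \<eta>_def)
    moreover have "\<eta> * \<eta> \<le> \<eta>" using mult_left_mono[of \<eta> 1 \<eta>] \<eta> by simp
    moreover have "\<eta> * (2 * B + 1) = B * \<eta> + \<eta> * B + \<eta>" by (simp add: algebra_simps)
    ultimately have \<eta>\<epsilon>: "B * \<eta> + \<eta> * B + \<eta> * \<eta> \<le> \<epsilon>" by linarith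
    let ?d = "\<lambda>n \<omega> j a. x n \<omega> j a - v a (Z j \<omega>)"
    let ?E = "\<lambda>n \<omega>. \<bar>(\<Sum>j<n. v i (Z j \<omega>) * v k (Z j \<omega>)) / real n - gram Q v i k\<bar> \<le> \<epsilon>
      \<and> \<bar>(\<Sum>j<n. v i (Z j \<omega>) * v i (Z j \<omega>)) / real n - gram Q v i i\<bar> \<le> 1
      \<and> \<bar>(\<Sum>j<n. v k (Z j \<omega>) * v k (Z j \<omega>)) / real n - gram Q v k k\<bar> \<le> 1
      \<and> (\<Sum>j<n. (vnorm (m n) (?d n \<omega> j))\<^sup>2) / real n \<le> \<eta>\<^sup>2
      \<and> \<bar>opnorm (m n) (\<lambda>i k. emp_gram n (x n \<omega>) i k - gram Q u i k)\<bar> \<le> \<epsilon> * real (m n) powr (-1)"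
    \<comment> \<open>The levels add up to 5/8 < 1, which is all that
      \<open>fails_rarely_const\<close> asks for: the five events need only be compatible at some
      sample point.\<close>
    have "fails_rarely M (1/8 + (1/8 + (1/8 + (1/8 + 1/8)))) ?E"
      using \<epsilon> \<eta> by (intro fails_rarely_conj LLN mean_distance_small fails_rarely_op_small[OF cond_ii]) auto
    moreover have "\<forall>\<^sub>F n in sequentially. i < m n \<and> k < m n \<and> 0 < m n"
      by (intro eventually_conj eventually_m_gt)
    then have "\<forall>\<^sub>F n in sequentially. \<forall>\<omega>\<in>space M. ?E n \<omega> \<longrightarrow> \<bar>gram Q u i k - gram Q v i k\<bar> \<le> 3 * \<epsilon>"
    proof (rule eventually_mono, intro ballI impI, elim conjE)
      fix n \<omega>
      let ?v = "\<lambda>j a. v a (Z j \<omega>)" and ?e = "\<lambda>j a. x n \<omega> j a - v a (Z j \<omega>)"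
      assume ik: "i < m n" "k < m n" and m: "0 < m n"
        and 1: "\<bar>(\<Sum>j<n. v i (Z j \<omega>) * v k (Z j \<omega>)) / real n - gram Q v i k\<bar> \<le> \<epsilon>"
        and 2: "\<bar>(\<Sum>j<n. v i (Z j \<omega>) * v i (Z j \<omega>)) / real n - gram Q v i i\<bar> \<le> 1"
        and 3: "\<bar>(\<Sum>j<n. v k (Z j \<omega>) * v k (Z j \<omega>)) / real n - gram Q v k k\<bar> \<le> 1"
        and 4: "(\<Sum>j<n. (vnorm (m n) (?e j))\<^sup>2) / real n \<le> \<eta>\<^sup>2"
        and 5: "\<bar>opnorm (m n) (\<lambda>i k. emp_gram n (x n \<omega>) i k - gram Q u i k)\<bar> \<le> \<epsilon> * real (m n) powr (-1)"
      have vB: "(\<Sum>j<n. (?v j i)\<^sup>2) / real n \<le> B\<^sup>2" "(\<Sum>j<n. (?v j k)\<^sup>2) / real n \<le> B\<^sup>2"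
        using 2 3 diag[of i] diag[of k] unfolding B(1) power2_eq_square[of "v _ _"] by linarith+
      have eB: "(\<Sum>j<n. (?e j a)\<^sup>2) / real n \<le> \<eta>\<^sup>2" if "a < m n" for a
      proof (rule order_trans[OF mean_mono 4])
        fix j
        show "(?e j a)\<^sup>2 \<le> (vnorm (m n) (?e j))\<^sup>2"
          using power_mono[OF component_le_vnorm[OF that, of "?e j"], of 2] by simp
      qed
      have "\<bar>emp_gram n (x n \<omega>) i k - (\<Sum>j<n. ?v j i * ?v j k) / real n\<bar>
          = \<bar>(\<Sum>j<n. x n \<omega> j i * x n \<omega> j k - ?v j i * ?v j k) / real n\<bar>"
        by (simp add: emp_gram_def sum_subtractf diff_divide_distrib)
      also have "\<dots> \<le> (\<Sum>j<n. \<bar>?v j i\<bar> * \<bar>?e j k\<bar> + \<bar>?e j i\<bar> * \<bar>?v j k\<bar> + \<bar>?e j i\<bar> * \<bar>?e j k\<bar>) / real n"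
      proof (rule order_trans[OF mean_abs mean_mono])
        fix j
        have "x n \<omega> j i * x n \<omega> j k - ?v j i * ?v j k = ?v j i * ?e j k + ?e j i * ?v j k + ?e j i * ?e j k"
          by (simp add: algebra_simps)
        then show "\<bar>x n \<omega> j i * x n \<omega> j k - ?v j i * ?v j k\<bar>
            \<le> \<bar>?v j i\<bar> * \<bar>?e j k\<bar> + \<bar>?e j i\<bar> * \<bar>?v j k\<bar> + \<bar>?e j i\<bar> * \<bar>?e j k\<bar>"
          unfolding abs_mult[symmetric] by linarith
      qed
      also have "\<dots> = (\<Sum>j<n. \<bar>?v j i\<bar> * \<bar>?e j k\<bar>) / real n + (\<Sum>j<n. \<bar>?e j i\<bar> * \<bar>?v j k\<bar>) / real n
          + (\<Sum>j<n. \<bar>?e j i\<bar> * \<bar>?e j k\<bar>) / real n"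
        by (simp only: sum.distrib add_divide_distrib)
      also have "\<dots> \<le> B * \<eta> + \<eta> * B + \<eta> * \<eta>"
        using \<eta> B(2) vB eB ik by (intro add_mono mean_cauchy_schwarz) auto
      finally have 6: "\<bar>emp_gram n (x n \<omega>) i k - (\<Sum>j<n. ?v j i * ?v j k) / real n\<bar> \<le> \<epsilon>"
        using \<eta>\<epsilon> by linarith
      have "real (m n) powr (-1) \<le> 1" using m by (simp add: powr_minus inverse_le_1_iff)
      then have "\<epsilon> * real (m n) powr (-1) \<le> \<epsilon>" using \<epsilon> by (intro mult_left_le) auto
      then have "\<bar>emp_gram n (x n \<omega>) i k - gram Q u i k\<bar> \<le> \<epsilon>"
        using opnorm_entry[OF ik, of "\<lambda>i k. emp_gram n (x n \<omega>) i k - gram Q u i k"] 5 by linarith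
      then show "\<bar>gram Q u i k - gram Q v i k\<bar> \<le> 3 * \<epsilon>" using 1 6 by linarith
    qed
    ultimately have "fails_rarely M (1/8 + (1/8 + (1/8 + (1/8 + 1/8)))) (\<lambda>n \<omega>. \<bar>gram Q u i k - gram Q v i k\<bar> \<le> 3 * \<epsilon>)"
      by (rule fails_rarely_mono)
    from fails_rarely_const[OF this] show ?thesis by simp
  qed
  note close = this
  have "\<bar>gram Q u i k - gram Q v i k\<bar> \<le> 0 + e" if "0 < e" for e using close[of "e / 3"] that by simp
  then have "\<bar>gram Q u i k - gram Q v i k\<bar> \<le> 0" by (rule field_le_epsilon)
  then show ?thesis by simp
qed

end

text \<open>Plays the role of Cauchy-Schwarz under an integral: the weight l is chosen to balance
  the two terms, so integrals are compared linearly and no roots of expectations occur.\<close>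

lemma weighted_am_gm:
  fixes a b l :: real
  assumes "0 < l"
  shows "a * b \<le> (l * a\<^sup>2 + b\<^sup>2 / l) / 2"
proof -
  have "0 \<le> (l * a - b)\<^sup>2 / l" using assms by simp
  also have "\<dots> = l * a\<^sup>2 + b\<^sup>2 / l - 2 * (a * b)"
    using assms by (simp add: power2_eq_square field_simps)
  finally show ?thesis by simp
qed

lemma powr_neg_half: "0 \<le> x \<Longrightarrow> x powr (-1/2) = 1 / sqrt x"
  using powr_minus_divide[of x "1/2"] by (simp add: powr_half_sqrt)

lemma mean_affine:
  fixes e :: "nat \<Rightarrow> real"
  assumes "0 < n"
  shows "(\<Sum>j<n. c * ((a + e j / l) / 2)) / real n = c * ((a + ((\<Sum>j<n. e j) / real n) / l) / 2)"
proof -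
  have "(\<Sum>j<n. c * ((a + e j / l) / 2)) = c * ((real n * a + (\<Sum>j<n. e j) / l) / 2)"
    by (simp only: sum_distrib_left[symmetric] sum_divide_distrib[symmetric] sum.distrib sum_constant card_lessThan)
  also have "real n * a + (\<Sum>j<n. e j) / l = real n * (a + ((\<Sum>j<n. e j) / real n) / l)"
    using assms by (simp add: distrib_left)
  finally show ?thesis using assms by simp
qed

section \<open>Projection coefficients and stochastic bounds\<close>

context estimated_constraints begin

lemma gram_u_v: "gram Q u = gram Q v"
  using gram_eq by (intro ext)

text \<open>Coordinates of the projection of a component of psi onto the first m n functions v,
  since \<open>gram Q u\<close> equals \<open>gram Q v\<close>. The equations determine them only
  below m n, hence the choice by \<open>SOME\<close>.\<close>

definition coef :: "'r \<Rightarrow> nat \<Rightarrow> nat \<Rightarrow> real" where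
  "coef i n = (SOME a. \<forall>k<m n. mvec (m n) (gram Q u) a k = cross_v i k)"

lemma coef: "k < m n \<Longrightarrow> mvec (m n) (gram Q u) (coef i n) k = cross_v i k"
  using someI_ex[OF nonsingular_solve[OF W_nonsing[of n], of "\<lambda>k. cross_v i k"]]
  unfolding coef_def by blast

lemma coef_quadratic: "dotp (m n) (coef i n) (mvec (m n) (gram Q u) (coef i n)) \<le> integral\<^sup>L Q (\<lambda>z. (psi z $ i)\<^sup>2)"
  unfolding gram_u_v by (rule lincomb_projection(1)[OF psi v]) (rule coef[unfolded gram_u_v])

text \<open>phi and psi have the same inner products with v, so \<open>coef\<close> also gives the
  projection of phi. A combination of K functions close to phi is at least matched by it as soon as
  m n exceeds K.\<close>

lemma projection_error:
  assumes "0 < e"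
  shows "\<forall>\<^sub>F n in sequentially. integral\<^sup>L Q (\<lambda>z. (phi z $ i - (\<Sum>k<m n. coef i n k * v k z))\<^sup>2) < e"
proof -
  obtain K b where K: "integral\<^sup>L Q (\<lambda>z. (phi z $ i - (\<Sum>k<K. b k * v k z))\<^sup>2) < e"
    using phi_approx[OF assms] by blast
  show ?thesis
    using eventually_m_gt[of K]
  proof eventually_elim
    case (elim n)
    have "integral\<^sup>L Q (\<lambda>z. (phi z $ i - (\<Sum>k<m n. coef i n k * v k z))\<^sup>2)
        \<le> integral\<^sup>L Q (\<lambda>z. (phi z $ i - (\<Sum>k<K. b k * v k z))\<^sup>2)"
      using elim coef[unfolded gram_u_v]
      by (intro lincomb_projection(2)[OF phi v]) (auto simp: phi_psi)
    then show ?case using K by simp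
  qed
qed

text \<open>Up to sign the difference is the sample mean of a centred function whose variance tends
  to 0 by \<open>projection_error\<close>; Chebyshev then gives o_p(n^(-1/2)).\<close>

lemma projection_mean_error:
  assumes "0 < \<eta>" "0 < \<delta>"
  shows "fails_rarely M \<delta> (\<lambda>n \<omega>. \<bar>dotp (m n) (coef i n) (vbar n \<omega>)
      - (\<Sum>j<n. phi (Z j \<omega>) $ i) / real n\<bar> \<le> \<eta> / sqrt (real n))"
proof -
  define h where "h n z = phi z $ i - (\<Sum>k<m n. coef i n k * v k z)" for n z
  have q: "L2_on Q (\<lambda>z. \<Sum>k<m n. coef i n k * v k z)" for n by (rule L2_on_lincomb[OF v])
  have h: "L2_on Q (h n)" for n unfolding h_def[abs_def] by (rule L2_on_diff[OF phi q])
  have h0: "integral\<^sup>L Q (h n) = 0" for n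
  proof -
    have "integral\<^sup>L Q (\<lambda>z. \<Sum>k<m n. coef i n k * v k z) = (\<Sum>k<m n. coef i n k * integral\<^sup>L Q (v k))"
      using L2_integrable[OF v] by (simp add: Bochner_Integration.integral_sum)
    then show ?thesis
      unfolding h_def[abs_def]
      using L2_integrable[OF phi] L2_integrable[OF q]
      by (simp add: v_mean phi_mean)
  qed
  have "fails_rarely M \<delta> (\<lambda>n \<omega>. ((\<Sum>j<n. h n (Z j \<omega>)) / real n)\<^sup>2 \<le> \<eta>\<^sup>2 / real n)"
  proof (rule fails_rarely_markov)
    have "\<forall>\<^sub>F n in sequentially. integral\<^sup>L Q (\<lambda>z. (h n z)\<^sup>2) < \<delta> * \<eta>\<^sup>2"
      unfolding h_def using assms by (intro projection_error) simp
    then show "\<forall>\<^sub>F n in sequentially. integrable M (\<lambda>\<omega>. ((\<Sum>j<n. h n (Z j \<omega>)) / real n)\<^sup>2) \<and>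
        (\<forall>\<omega>\<in>space M. 0 \<le> ((\<Sum>j<n. h n (Z j \<omega>)) / real n)\<^sup>2) \<and> 0 < \<eta>\<^sup>2 / real n \<and>
        expectation (\<lambda>\<omega>. ((\<Sum>j<n. h n (Z j \<omega>)) / real n)\<^sup>2) \<le> \<delta> * (\<eta>\<^sup>2 / real n)"
      using eventually_gt_at_top[of 0]
    proof eventually_elim
      case (elim n)
      have "expectation (\<lambda>\<omega>. ((\<Sum>j<n. h n (Z j \<omega>)) / real n)\<^sup>2) \<le> \<delta> * \<eta>\<^sup>2 / real n"
        unfolding mean_second_moment(2)[OF h h0] using elim by (intro divide_right_mono) auto
      then show ?case using mean_second_moment(1)[OF h h0] assms elim by simp
    qed
  qed
  then show ?thesis
  proof (rule fails_rarely_mono, intro always_eventually allI ballI impI)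
    fix n \<omega> assume *: "((\<Sum>j<n. h n (Z j \<omega>)) / real n)\<^sup>2 \<le> \<eta>\<^sup>2 / real n"
    have "dotp (m n) (coef i n) (vbar n \<omega>) = (\<Sum>j<n. \<Sum>k<m n. coef i n k * v k (Z j \<omega>)) / real n"
      unfolding dotp_commute[of _ "coef i n"] dotp_mean1 by (simp add: dotp_def mult.commute)
    then have "dotp (m n) (coef i n) (vbar n \<omega>) - (\<Sum>j<n. phi (Z j \<omega>) $ i) / real n
        = - ((\<Sum>j<n. h n (Z j \<omega>)) / real n)"
      by (simp add: h_def sum_subtractf diff_divide_distrib)
    moreover have "\<bar>(\<Sum>j<n. h n (Z j \<omega>)) / real n\<bar> \<le> \<bar>\<eta> / sqrt (real n)\<bar>"
      unfolding abs_le_square_iff using * by (simp add: power_divide)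
    ultimately show "\<bar>dotp (m n) (coef i n) (vbar n \<omega>)
      - (\<Sum>j<n. phi (Z j \<omega>) $ i) / real n\<bar> \<le> \<eta> / sqrt (real n)" using assms by simp
  qed
qed

text \<open>The expected squared norm is the trace of the Gram matrix of v divided by n. Each
  diagonal entry is the quadratic form at a unit vector, hence at most C because W is that Gram
  matrix. This is where the order of the radius comes from.\<close>

lemma mean_v_bounded:
  assumes "0 < \<delta>"
  obtains K where "0 < K"
    "fails_rarely M \<delta> (\<lambda>n \<omega>. vnorm (m n) (vbar n \<omega>) \<le> K * (sqrt (real (m n)) / sqrt (real n)))"
proof -
  from regular_seq_quadratic[OF W_regular]
  obtain c C where C: "0 \<le> C"
    and quad: "\<forall>n a. c * (vnorm (m n) a)\<^sup>2 \<le> dotp (m n) a (mvec (m n) (gram Q u) a)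
      \<and> dotp (m n) a (mvec (m n) (gram Q u) a) \<le> C * (vnorm (m n) a)\<^sup>2"
    by (elim exE conjE)
  have V: "gram Q v k k \<le> C" if "k < m n" for k n
    using quad[rule_format, of n "\<lambda>i. if i = k then 1 else 0"]
    unfolding dotp_mvec_unit[OF that] vnorm_unit[OF that] gram_u_v by simp
  \<comment> \<open>Markov requires C <= \<delta> K^2; the added 1 keeps K positive if C =
    0.\<close>
  define K where "K = sqrt (C / \<delta> + 1)"
  have K: "0 < K" "K\<^sup>2 = C / \<delta> + 1" using C assms by (auto simp: K_def add_nonneg_pos)
  have "fails_rarely M \<delta> (\<lambda>n \<omega>. (vnorm (m n) (vbar n \<omega>))\<^sup>2 \<le> K\<^sup>2 * (real (m n) / real n))"
  proof (rule fails_rarely_markov)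
    show "\<forall>\<^sub>F n in sequentially. integrable M (\<lambda>\<omega>. (vnorm (m n) (vbar n \<omega>))\<^sup>2) \<and>
        (\<forall>\<omega>\<in>space M. 0 \<le> (vnorm (m n) (vbar n \<omega>))\<^sup>2) \<and> 0 < K\<^sup>2 * (real (m n) / real n) \<and>
        expectation (\<lambda>\<omega>. (vnorm (m n) (vbar n \<omega>))\<^sup>2) \<le> \<delta> * (K\<^sup>2 * (real (m n) / real n))"
      using eventually_m_gt[of 0] eventually_gt_at_top[of 0]
    proof eventually_elim
      case (elim n)
      have "expectation (\<lambda>\<omega>. \<Sum>k<m n. ((\<Sum>j<n. v k (Z j \<omega>)) / real n)\<^sup>2) = (\<Sum>k<m n. gram Q v k k / real n)"
        using mean_second_moment[OF v v_mean]
        by (simp add: Bochner_Integration.integral_sum gram_def power2_eq_square[of "v _ _"])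
      also have "\<dots> \<le> (\<Sum>k<m n. C / real n)" using V by (intro sum_mono divide_right_mono) auto
      also have "\<dots> = C * (real (m n) / real n)" by simp
      also have "\<dots> \<le> \<delta> * K\<^sup>2 * (real (m n) / real n)"
      proof (rule mult_right_mono)
        have "\<delta> * K\<^sup>2 = C + \<delta>" unfolding K(2) using assms by (simp add: distrib_left)
        then show "C \<le> \<delta> * K\<^sup>2" using assms by linarith
      qed simp
      finally have "expectation (\<lambda>\<omega>. (vnorm (m n) (vbar n \<omega>))\<^sup>2) \<le> \<delta> * (K\<^sup>2 * (real (m n) / real n))"
        unfolding vnorm_sq by (simp only: mult.assoc)
      moreover have "integrable M (\<lambda>\<omega>. (vnorm (m n) (vbar n \<omega>))\<^sup>2)"
        unfolding vnorm_sq by (rule Bochner_Integration.integrable_sum) (rule mean_second_moment(1)[OF v v_mean])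
      moreover have "0 < K\<^sup>2 * (real (m n) / real n)" using elim K(1) by simp
      ultimately show ?case by (intro conjI ballI zero_le_power2)
    qed
  qed
  then have "fails_rarely M \<delta> (\<lambda>n \<omega>. vnorm (m n) (vbar n \<omega>) \<le> K * (sqrt (real (m n)) / sqrt (real n)))"
  proof (rule fails_rarely_mono, intro always_eventually allI ballI impI)
    fix n \<omega> assume *: "(vnorm (m n) (vbar n \<omega>))\<^sup>2 \<le> K\<^sup>2 * (real (m n) / real n)"
    have "(K * (sqrt (real (m n)) / sqrt (real n)))\<^sup>2 = K\<^sup>2 * (real (m n) / real n)"
      by (simp add: power_mult_distrib power_divide)
    with * have "(vnorm (m n) (vbar n \<omega>))\<^sup>2
        \<le> (K * (sqrt (real (m n)) / sqrt (real n)))\<^sup>2" by (simp only:)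
    then show "vnorm (m n) (vbar n \<omega>) \<le> K * (sqrt (real (m n)) / sqrt (real n))"
      by (rule power2_le_imp_le) (use K(1) in simp)
  qed
  from that[OF K(1) this] show ?thesis .
qed

lemma mean_psi_sq_bounded:
  assumes "0 < \<delta>"
  obtains F where "0 < F" "fails_rarely M \<delta> (\<lambda>n \<omega>. (\<Sum>j<n. (psi (Z j \<omega>) $ i)\<^sup>2) / real n \<le> F\<^sup>2)"
proof -
  let ?P = "integral\<^sup>L Q (\<lambda>z. (psi z $ i)\<^sup>2)"
  define F where "F = sqrt (?P / \<delta> + 1)"
  have F: "0 < F" "F\<^sup>2 = ?P / \<delta> + 1" using assms by (auto simp: F_def add_nonneg_pos)
  have "fails_rarely M \<delta> (\<lambda>n \<omega>. (\<Sum>j<n. (psi (Z j \<omega>) $ i)\<^sup>2) / real n \<le> F\<^sup>2)"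
  proof (rule fails_rarely_markov, rule eventually_mono[OF eventually_gt_at_top[of 0]])
    fix n :: nat assume n: "0 < n"
    have "\<delta> * F\<^sup>2 = ?P + \<delta>" unfolding F(2) using assms by (simp add: distrib_left)
    then have "?P \<le> \<delta> * F\<^sup>2" using assms by linarith
    then show "integrable M (\<lambda>\<omega>. (\<Sum>j<n. (psi (Z j \<omega>) $ i)\<^sup>2) / real n) \<and>
        (\<forall>\<omega>\<in>space M. 0 \<le> (\<Sum>j<n. (psi (Z j \<omega>) $ i)\<^sup>2) / real n) \<and> 0 < F\<^sup>2 \<and>
        expectation (\<lambda>\<omega>. (\<Sum>j<n. (psi (Z j \<omega>) $ i)\<^sup>2) / real n) \<le> \<delta> * F\<^sup>2"
      unfolding expectation_mean(2)[OF L2_onD(2)[OF psi[of i]] n]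
      using expectation_mean(1)[OF L2_onD(2)[OF psi[of i]] n] F(1)
      by (intro conjI ballI divide_nonneg_nonneg sum_nonneg zero_le_power2 zero_less_power of_nat_0_le_iff)
  qed
  from that[OF F(1) this] show ?thesis .
qed

text \<open>Condition (iii) centres at expectations involving the estimator, while the expansion
  needs cross moments with v. The gap is the average of E[psi (uhat - v)], which (iv) makes
  o(m^(-1/2)); it is bounded by pairing it with itself and applying \<open>weighted_am_gm\<close>
  under the expectation.\<close>

lemma cross_moment_bias:
  assumes "0 < \<eta>"
  shows "\<forall>\<^sub>F n in sequentially. vnorm (m n) (\<lambda>k. (\<Sum>j<n. expectation (\<lambda>\<omega>. psi (Z j \<omega>) $ i * x n \<omega> j k)) / real n
      - cross_v i k) \<le> \<eta> / sqrt (real (m n))"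
proof -
  let ?P = "integral\<^sup>L Q (\<lambda>z. (psi z $ i)\<^sup>2)"
  have P: "0 \<le> ?P" by simp
  \<comment> \<open>Chosen so that the final bound \<kappa> (P + 1) / (2 sqrt p) equals \<eta> /
    sqrt p.\<close>
  define \<kappa> where "\<kappa> = 2 * \<eta> / (?P + 1)"
  have "0 < ?P + 1" using P by linarith
  then have \<kappa>: "0 < \<kappa>" "\<kappa> * (?P + 1) = 2 * \<eta>" using assms by (auto simp: \<kappa>_def)
  let ?D = "\<lambda>n \<omega> j. dist_v n \<omega> j"
  have "\<forall>\<^sub>F n in sequentially. norm ((\<Sum>j<n. expectation (\<lambda>\<omega>. (?D n \<omega> j)\<^sup>2)) / real n) \<le> \<kappa>\<^sup>2 * norm (real (m n) powr (-1))"
    using \<kappa> by (intro landau_o.smallD[OF cond_iv]) simp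
  then show ?thesis
    using eventually_m_gt[of 0] eventually_gt_at_top[of 0]
  proof eventually_elim
    case (elim n)
    let ?p = "m n"
    define b where "b = (\<lambda>k. (\<Sum>j<n. expectation (\<lambda>\<omega>. psi (Z j \<omega>) $ i * x n \<omega> j k)) / real n
      - cross_v i k)"
    define E where "E j k = expectation (\<lambda>\<omega>. psi (Z j \<omega>) $ i * (x n \<omega> j k - v k (Z j \<omega>)))" for j k
    \<comment> \<open>By (iv) the average expected squared distance is at most \<kappa>^2 / p = l^2,
      so both terms of the weighted inequality are of order l.\<close>
    define l where "l = \<kappa> / sqrt (real ?p)"
    have l: "0 < l" using \<kappa> elim by (simp add: l_def)
    have pv: "integrable M (\<lambda>\<omega>. psi (Z j \<omega>) $ i * v k (Z j \<omega>))"
      "expectation (\<lambda>\<omega>. psi (Z j \<omega>) $ i * v k (Z j \<omega>)) = cross_v i k" for j k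
      using integrable_comp_Z[OF L2_on_prod[OF psi v]] integral_comp_Z[OF borel_measurable_integrable[OF L2_on_prod[OF psi v]]]
      by auto
    have pd: "integrable M (\<lambda>\<omega>. psi (Z j \<omega>) $ i * (x n \<omega> j k - v k (Z j \<omega>)))" if "j < n" "k < ?p" for j k
      using cond_iii_int[OF that] pv(1) by (simp add: right_diff_distrib)
    have E: "E j k = expectation (\<lambda>\<omega>. psi (Z j \<omega>) $ i * x n \<omega> j k) - cross_v i k"
      if "j < n" "k < ?p" for j k
      unfolding E_def using cond_iii_int[OF that] pv by (simp add: right_diff_distrib)
    have bE: "b k = (\<Sum>j<n. E j k) / real n" if "k < ?p" for k
      using E[OF _ that] elim by (simp add: b_def sum_subtractf diff_divide_distrib)
    have Eb: "dotp ?p (E j) b \<le> vnorm ?p b * ((l * ?P + expectation (\<lambda>\<omega>. (?D n \<omega> j)\<^sup>2) / l) / 2)" if j: "j < n" for j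
    proof -
      have psq: "integrable M (\<lambda>\<omega>. (psi (Z j \<omega>) $ i)\<^sup>2)" "expectation (\<lambda>\<omega>. (psi (Z j \<omega>) $ i)\<^sup>2) = ?P"
        using integrable_comp_Z[OF L2_onD(2)[OF psi]] integral_comp_Z[OF borel_measurable_integrable[OF L2_onD(2)[OF psi]]]
        by auto
      have "dotp ?p (E j) b = expectation (\<lambda>\<omega>. \<Sum>k<?p. psi (Z j \<omega>) $ i * (x n \<omega> j k - v k (Z j \<omega>)) * b k)"
        unfolding dotp_def E_def using pd[OF j] by (subst Bochner_Integration.integral_sum) auto
      also have "\<dots> \<le> expectation (\<lambda>\<omega>. vnorm ?p b * ((l * (psi (Z j \<omega>) $ i)\<^sup>2 + (?D n \<omega> j)\<^sup>2 / l) / 2))"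
      proof (rule integral_mono)
        show "integrable M (\<lambda>\<omega>. \<Sum>k<?p. psi (Z j \<omega>) $ i * (x n \<omega> j k - v k (Z j \<omega>)) * b k)"
          using pd[OF j] by (intro Bochner_Integration.integrable_sum integrable_mult_left) auto
        show "integrable M (\<lambda>\<omega>. vnorm ?p b * ((l * (psi (Z j \<omega>) $ i)\<^sup>2 + (?D n \<omega> j)\<^sup>2 / l) / 2))"
          using psq(1) cond_iv_int[OF j]
          by (intro integrable_mult_right integrable_divide Bochner_Integration.integrable_add)
        fix \<omega>
        let ?a = "psi (Z j \<omega>) $ i" and ?d = "\<lambda>k. x n \<omega> j k - v k (Z j \<omega>)"
        have "(\<Sum>k<?p. ?a * ?d k * b k) = ?a * dotp ?p ?d b"
          by (simp add: dotp_def sum_distrib_left mult.assoc)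
        also have "\<dots> \<le> \<bar>?a\<bar> * (vnorm ?p ?d * vnorm ?p b)"
          using mult_left_mono[OF dotp_le[of ?p ?d b], of "\<bar>?a\<bar>"] by (simp add: abs_mult[symmetric])
        also have "\<dots> = vnorm ?p b * (\<bar>?a\<bar> * vnorm ?p ?d)" by simp
        also have "\<dots> \<le> vnorm ?p b * ((l * \<bar>?a\<bar>\<^sup>2 + (vnorm ?p ?d)\<^sup>2 / l) / 2)"
          by (intro mult_left_mono weighted_am_gm l) simp
        finally show "(\<Sum>k<?p. ?a * ?d k * b k) \<le> vnorm ?p b * ((l * ?a\<^sup>2 + (vnorm ?p ?d)\<^sup>2 / l) / 2)" by simp
      qed
      also have "\<dots> = vnorm ?p b * ((l * ?P + expectation (\<lambda>\<omega>. (?D n \<omega> j)\<^sup>2) / l) / 2)"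
        using psq cond_iv_int[OF j] by simp
      finally show ?thesis .
    qed
    have dist: "(\<Sum>j<n. expectation (\<lambda>\<omega>. (?D n \<omega> j)\<^sup>2)) / real n \<le> \<kappa>\<^sup>2 / real ?p"
      using elim(1,2) by (simp add: powr_minus divide_inverse)
    have "(vnorm ?p b)\<^sup>2 = dotp ?p (\<lambda>k. (\<Sum>j<n. E j k) / real n) b"
      unfolding dotp_self[symmetric] using bE by (intro dotp_cong) auto
    also have "\<dots> = (\<Sum>j<n. dotp ?p (E j) b) / real n" by (rule dotp_mean1)
    also have "\<dots> \<le> (\<Sum>j<n. vnorm ?p b * ((l * ?P + expectation (\<lambda>\<omega>. (?D n \<omega> j)\<^sup>2) / l) / 2)) / real n"
      by (rule mean_mono[OF Eb])
    also have "\<dots> = vnorm ?p b * ((l * ?P + ((\<Sum>j<n. expectation (\<lambda>\<omega>. (?D n \<omega> j)\<^sup>2)) / real n) / l) / 2)"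
      by (rule mean_affine) (use elim in simp)
    also have "\<dots> \<le> vnorm ?p b * ((l * ?P + (\<kappa>\<^sup>2 / real ?p) / l) / 2)"
      using dist l by (intro mult_left_mono divide_right_mono add_left_mono) auto
    also have "(\<kappa>\<^sup>2 / real ?p) / l = l"
      using \<kappa>(1) elim by (simp add: l_def power2_eq_square field_simps)
    also have "(l * ?P + l) / 2 = \<kappa> * (?P + 1) / (2 * sqrt (real ?p))"
    proof -
      have "l * ?P + l = l * (?P + 1)" by (simp add: distrib_left)
      then show ?thesis by (simp only: l_def times_divide_eq_left divide_divide_eq_left mult.commute[of 2])
    qed
    also have "\<dots> = \<eta> / sqrt (real ?p)" unfolding \<kappa>(2) by simp
    finally have "(vnorm ?p b)\<^sup>2 \<le> (\<eta> / sqrt (real ?p)) * vnorm ?p b" by (simp add: mult.commute)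
    then have "vnorm ?p b \<le> \<eta> / sqrt (real ?p)" by (rule vnorm_le_of_dotp) (use assms in simp)
    then show ?case by (simp add: b_def)
  qed
qed

text \<open>Half of \<eta> covers the fluctuation in (iii), where one row is bounded by the
  Frobenius norm over all components of psi; the other half covers the bias.\<close>

lemma cross_moment_error:
  assumes "0 < \<eta>" "0 < \<delta>"
  shows "fails_rarely M \<delta> (\<lambda>n \<omega>. vnorm (m n) (\<lambda>k. (\<Sum>j<n. psi (Z j \<omega>) $ i * x n \<omega> j k) / real n
      - cross_v i k) \<le> \<eta> / sqrt (real (m n)))"
proof (rule fails_rarely_mono)
  let ?S = "\<lambda>n \<omega>. \<Sum>i\<in>UNIV. \<Sum>k<m n. ((\<Sum>j<n. psi (Z j \<omega>) $ i * x n \<omega> j k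
      - integral\<^sup>L M (\<lambda>\<omega>'. psi (Z j \<omega>') $ i * x n \<omega>' j k)) / real n)\<^sup>2"
  show "fails_rarely M \<delta> (\<lambda>n \<omega>. \<bar>sqrt (?S n \<omega>)\<bar> \<le> \<eta> / 2 * real (m n) powr (-1/2))"
    using assms by (intro fails_rarely_op_small[OF cond_iii]) auto
  show "\<forall>\<^sub>F n in sequentially. \<forall>\<omega>\<in>space M. \<bar>sqrt (?S n \<omega>)\<bar> \<le> \<eta> / 2 * real (m n) powr (-1/2) \<longrightarrow>
      vnorm (m n) (\<lambda>k. (\<Sum>j<n. psi (Z j \<omega>) $ i * x n \<omega> j k) / real n
      - cross_v i k) \<le> \<eta> / sqrt (real (m n))"
    using cross_moment_bias[OF half_gt_zero[OF assms(1)], of i] eventually_m_gt[of 0]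
  proof (eventually_elim, intro ballI impI)
    fix n \<omega>
    let ?E = "\<lambda>k. (\<Sum>j<n. expectation (\<lambda>\<omega>. psi (Z j \<omega>) $ i * x n \<omega> j k)) / real n"
    let ?G = "\<lambda>k. (\<Sum>j<n. psi (Z j \<omega>) $ i * x n \<omega> j k) / real n"
    assume b: "vnorm (m n) (\<lambda>k. ?E k - cross_v i k) \<le> \<eta> / 2 / sqrt (real (m n))"
      and m: "0 < m n" and s: "\<bar>sqrt (?S n \<omega>)\<bar> \<le> \<eta> / 2 * real (m n) powr (-1/2)"
    have "vnorm (m n) (\<lambda>k. ?G k - ?E k) \<le> sqrt (?S n \<omega>)"
    proof -
      have "(\<Sum>k<m n. (?G k - ?E k)\<^sup>2) = (\<Sum>k<m n. ((\<Sum>j<n. psi (Z j \<omega>) $ i * x n \<omega> j k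
          - integral\<^sup>L M (\<lambda>\<omega>'. psi (Z j \<omega>') $ i * x n \<omega>' j k)) / real n)\<^sup>2)"
        by (simp add: sum_subtractf diff_divide_distrib)
      also have "\<dots> \<le> ?S n \<omega>" by (rule member_le_sum) (auto intro: sum_nonneg)
      finally show ?thesis by (simp add: vnorm_def)
    qed
    also have "\<dots> \<le> \<eta> / 2 / sqrt (real (m n))"
      using s[unfolded powr_neg_half[OF of_nat_0_le_iff] times_divide_eq_right mult_1_right] by linarith
    finally have a: "vnorm (m n) (\<lambda>k. ?G k - ?E k) \<le> \<eta> / 2 / sqrt (real (m n))" .
    have "vnorm (m n) (\<lambda>k. ?G k - cross_v i k)
      \<le> vnorm (m n) (\<lambda>k. ?G k - ?E k) + vnorm (m n) (\<lambda>k. ?E k - cross_v i k)"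
      using vnorm_triangle[of "m n" "\<lambda>k. ?G k - ?E k" "\<lambda>k. ?E k - cross_v i k"] by simp
    then show "vnorm (m n) (\<lambda>k. ?G k - cross_v i k) \<le> \<eta> / sqrt (real (m n))"
      using a b by linarith
  qed
qed

end

text \<open>Here a and b are the roots of m and n. With the rates inserted every term is a constant
  times \<eta> / b, with a spare factor of at most 1 / a in all but one: the cross moment error
  times the radius, which has exactly the order required.\<close>

lemma linearization_rate:
  fixes a b :: real
  assumes "1 \<le> a" "0 < b" "0 \<le> \<eta>" "0 \<le> \<rho>" "0 \<le> F" "0 \<le> s" "0 \<le> A" "0 \<le> D"
  shows "2 * (\<eta> * b / a ^ 3) * (\<rho> * a / b)\<^sup>2 * F * s + (\<eta> / a) * (\<rho> * a / b)
      + A * (\<eta> / (a * b) + 2 * (\<eta> * b / a ^ 3) * (\<rho> * a / b)\<^sup>2 * D + (\<eta> / a\<^sup>2) * (\<rho> * a / b))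
    \<le> (2 * \<rho>\<^sup>2 * F * s + \<rho> + A * (1 + 2 * \<rho>\<^sup>2 * D + \<rho>)) * (\<eta> / b)"
proof -
  define y w where "y = \<eta> / b" and "w = 1 / a"
  have w: "0 \<le> w" "w \<le> 1" and y: "0 \<le> y" using assms by (auto simp: w_def y_def)
  have e: "(\<eta> * b / a ^ 3) * (\<rho> * a / b)\<^sup>2 = \<rho>\<^sup>2 * y * w" "(\<eta> / a) * (\<rho> * a / b) = \<rho> * y"
    "\<eta> / (a * b) = y * w" "(\<eta> / a\<^sup>2) * (\<rho> * a / b) = \<rho> * y * w"
    using assms by (auto simp: y_def w_def power2_eq_square power3_eq_cube field_simps)
  have "2 * (\<rho>\<^sup>2 * y * w) * F * s + \<rho> * y + A * (y * w + 2 * (\<rho>\<^sup>2 * y * w) * D + \<rho> * y * w)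
      = (2 * \<rho>\<^sup>2 * F * s + A * (1 + 2 * \<rho>\<^sup>2 * D + \<rho>)) * y * w + \<rho> * y" by (simp add: algebra_simps)
  also have "\<dots> \<le> (2 * \<rho>\<^sup>2 * F * s + A * (1 + 2 * \<rho>\<^sup>2 * D + \<rho>)) * y + \<rho> * y"
    using assms w y by (intro add_right_mono mult_left_le) auto
  also have "\<dots> = (2 * \<rho>\<^sup>2 * F * s + \<rho> + A * (1 + 2 * \<rho>\<^sup>2 * D + \<rho>)) * y" by (simp add: algebra_simps)
  finally show ?thesis
    unfolding mult.assoc[of 2 "\<eta> * b / a ^ 3"] e y_def[symmetric] by (simp only: mult.assoc)
qed

lemma rate_powr:
  assumes "0 < p" "0 < n"
  shows "real p powr (-3/2) * real n powr (1/2) = sqrt (real n) / sqrt (real p) ^ 3"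
    and "real p powr (-1) = 1 / (sqrt (real p))\<^sup>2"
    and "real p powr (-1/2) * real n powr (-1/2) = 1 / (sqrt (real p) * sqrt (real n))"
proof -
  have "sqrt (real p) ^ 3 = sqrt (real p) powr 3" using assms by simp
  also have "\<dots> = real p powr (3/2)"
    unfolding powr_half_sqrt[OF of_nat_0_le_iff, symmetric] powr_powr by simp
  finally have "real p powr (-3/2) = 1 / sqrt (real p) ^ 3"
    using powr_minus_divide[of "real p" "3/2"] by simp
  then show "real p powr (-3/2) * real n powr (1/2) = sqrt (real n) / sqrt (real p) ^ 3"
    by (simp add: powr_half_sqrt)
  show "real p powr (-1) = 1 / (sqrt (real p))\<^sup>2" using assms by (simp add: powr_minus_divide)
  show "real p powr (-1/2) * real n powr (-1/2) = 1 / (sqrt (real p) * sqrt (real n))"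
    unfolding powr_neg_half[OF of_nat_0_le_iff] by simp
qed

section \<open>From the deterministic bound to the stochastic linearization\<close>

context estimated_constraints begin

text \<open>On the intersection of seven events the estimates of \<open>el_data\<close> hold. Unique
  solvability is asserted for the same event, because only there does the \<open>THE\<close> in
  \<open>zeta\<close> denote a solution.\<close>

theorem el_mean_linearization:
  assumes "0 < \<epsilon>" "0 < \<delta>"
  shows "fails_rarely M \<delta> (\<lambda>n \<omega>. (sol_unique n \<omega>) \<and>
    \<bar>(\<Sum>j<n. psi (Z j \<omega>) $ i / (1 + dotp (m n) (x n \<omega> j) (zeta n \<omega>))) / real n
      - ((\<Sum>j<n. psi (Z j \<omega>) $ i) / real n - (\<Sum>j<n. phi (Z j \<omega>) $ i) / real n)\<bar> \<le> \<epsilon> / sqrt (real n))"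
proof -
  from regular_seq_quadratic[OF W_regular]
  obtain c C where c: "0 < c" and C: "0 \<le> C"
    and quad: "\<forall>n a. c * (vnorm (m n) a)\<^sup>2 \<le> dotp (m n) a (mvec (m n) (gram Q u) a)
      \<and> dotp (m n) a (mvec (m n) (gram Q u) a) \<le> C * (vnorm (m n) a)\<^sup>2"
    by (elim exE conjE)
  have d7: "0 < \<delta> / 7" using assms by simp
  obtain K where K: "0 < K" and K_event: "fails_rarely M (\<delta> / 7)
      (\<lambda>n \<omega>. vnorm (m n) (vbar n \<omega>) \<le> K * (sqrt (real (m n)) / sqrt (real n)))"
    using mean_v_bounded[OF d7] .
  obtain F where F: "0 < F" and F_event: "fails_rarely M (\<delta> / 7) (\<lambda>n \<omega>. (\<Sum>j<n. (psi (Z j \<omega>) $ i)\<^sup>2) / real n \<le> F\<^sup>2)"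
    using mean_psi_sq_bounded[OF d7] .
  let ?P = "integral\<^sup>L Q (\<lambda>z. (psi z $ i)\<^sup>2)"
  \<comment> \<open>Bessel's inequality \<open>coef_quadratic\<close> and the lower bound c for W
    keep the coefficient vector bounded uniformly in n.\<close>
  define A where "A = sqrt (?P / c)"
  have A: "0 \<le> A" "A\<^sup>2 = ?P / c" using c by (auto simp: A_def)
  have coefA: "vnorm (m n) (coef i n) \<le> A" for n
  proof (rule power2_le_imp_le[OF _ A(1)])
    have "c * (vnorm (m n) (coef i n))\<^sup>2 \<le> ?P"
      using quad coef_quadratic[of n i] order_trans by blast
    then show "(vnorm (m n) (coef i n))\<^sup>2 \<le> A\<^sup>2"
      unfolding A(2) using c by (simp add: pos_le_divide_eq mult.commute)
  qed
  \<comment> \<open>The mean of x is at most (K + 1) a / b, and \<open>el_data\<close> wants it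
    strictly below c / 3 times the radius \<rho> a / b; the last summand 1 gives strictness.\<close>
  define \<rho> where "\<rho> = 3 * (K + 1) / c + 1"
  have "0 \<le> 3 * (K + 1) / c" using K c by simp
  then have \<rho>: "0 < \<rho>" "c / 3 * \<rho> = K + 1 + c / 3" using c by (auto simp: \<rho>_def field_simps)
  define s where "s = sqrt (C + 1)"
  define T where "T = 2 * \<rho>\<^sup>2 * F * s + \<rho> + A * (1 + 2 * \<rho>\<^sup>2 * (C + 1) + \<rho>)"
  have s: "0 \<le> s" using C by (simp add: s_def)
  have "0 < T" unfolding T_def using \<rho>(1) F s A(1) C
    by (intro add_pos_nonneg add_nonneg_pos mult_nonneg_nonneg add_nonneg_nonneg) auto
  \<comment> \<open>The four bounds serve in turn d <= 1 and the mean of x, X r <= 1/2, d <= c / 2,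
    and the total error.\<close>
  define \<eta> where "\<eta> = Min {1, 1 / (2 * \<rho>), c / 2, \<epsilon> / (T + 1)}"
  have \<eta>: "0 < \<eta>" "\<eta> \<le> 1" "\<eta> \<le> 1 / (2 * \<rho>)" "\<eta> \<le> c / 2" "\<eta> \<le> \<epsilon> / (T + 1)"
    using \<rho>(1) c assms \<open>0 < T\<close> unfolding \<eta>_def by (simp_all only: Min_le finite.intros insert_iff simp_thms) (simp add: divide_pos_pos)
  have \<eta>\<rho>: "\<eta> * \<rho> \<le> 1/2" using mult_right_mono[OF \<eta>(3), of \<rho>] \<rho>(1) by simp
  have \<eta>T: "(T + 1) * \<eta> \<le> \<epsilon>" using \<eta>(5) \<open>0 < T\<close> by (simp add: pos_le_divide_eq mult.commute)
  let ?xb = "\<lambda>n \<omega> k. (\<Sum>j<n. x n \<omega> j k) / real n"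
  let ?E = "\<lambda>n \<omega>. \<bar>Max ((\<lambda>j. vnorm (m n) (x n \<omega> j)) ` {..<n})\<bar> \<le> \<eta> * (real (m n) powr (-3/2) * real n powr (1/2))
    \<and> \<bar>opnorm (m n) (\<lambda>i k. emp_gram n (x n \<omega>) i k - gram Q u i k)\<bar> \<le> \<eta> * real (m n) powr (-1)
    \<and> vnorm (m n) (\<lambda>k. (\<Sum>j<n. psi (Z j \<omega>) $ i * x n \<omega> j k) / real n - cross_v i k) \<le> \<eta> / sqrt (real (m n))
    \<and> \<bar>vnorm (m n) (\<lambda>k. ?xb n \<omega> k - vbar n \<omega> k)\<bar> \<le> \<eta> * (real (m n) powr (-1/2) * real n powr (-1/2))
    \<and> vnorm (m n) (vbar n \<omega>) \<le> K * (sqrt (real (m n)) / sqrt (real n))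
    \<and> (\<Sum>j<n. (psi (Z j \<omega>) $ i)\<^sup>2) / real n \<le> F\<^sup>2
    \<and> \<bar>dotp (m n) (coef i n) (vbar n \<omega>) - (\<Sum>j<n. phi (Z j \<omega>) $ i) / real n\<bar> \<le> \<eta> / sqrt (real n)"
  have "fails_rarely M (\<delta>/7 + (\<delta>/7 + (\<delta>/7 + (\<delta>/7 + (\<delta>/7 + (\<delta>/7 + \<delta>/7)))))) ?E"
    using \<eta>(1) d7
    by (intro fails_rarely_conj fails_rarely_op_small[OF cond_i] fails_rarely_op_small[OF cond_ii]
        fails_rarely_op_small[OF cond_v] cross_moment_error K_event F_event projection_mean_error)
  then have "fails_rarely M \<delta> ?E" by simp
  then show ?thesis
  proof (rule fails_rarely_mono)
    show "\<forall>\<^sub>F n in sequentially. \<forall>\<omega>\<in>space M. ?E n \<omega> \<longrightarrow> (sol_unique n \<omega>) \<and>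
      \<bar>(\<Sum>j<n. psi (Z j \<omega>) $ i / (1 + dotp (m n) (x n \<omega> j) (zeta n \<omega>))) / real n
      - ((\<Sum>j<n. psi (Z j \<omega>) $ i) / real n - (\<Sum>j<n. phi (Z j \<omega>) $ i) / real n)\<bar> \<le> \<epsilon> / sqrt (real n)"
      using eventually_m_gt[of 0] eventually_gt_at_top[of 0]
    proof (eventually_elim, intro ballI impI)
      fix n \<omega>
      assume mn: "0 < m n" "0 < n" and E: "?E n \<omega>"
      define a b where "a = sqrt (real (m n))" and "b = sqrt (real n)"
      have ab: "1 \<le> a" "0 < b" "0 < a" using mn by (auto simp: a_def b_def)
      note powr = rate_powr[OF mn, folded a_def b_def]
      from E[unfolded powr, folded a_def b_def] have e:
        "\<bar>Max ((\<lambda>j. vnorm (m n) (x n \<omega> j)) ` {..<n})\<bar> \<le> \<eta> * (b / a ^ 3)"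
        "\<bar>opnorm (m n) (\<lambda>i k. emp_gram n (x n \<omega>) i k - gram Q u i k)\<bar> \<le> \<eta> * (1 / a\<^sup>2)"
        "vnorm (m n) (\<lambda>k. (\<Sum>j<n. psi (Z j \<omega>) $ i * x n \<omega> j k) / real n - cross_v i k) \<le> \<eta> / a"
        "\<bar>vnorm (m n) (\<lambda>k. ?xb n \<omega> k - vbar n \<omega> k)\<bar> \<le> \<eta> * (1 / (a * b))"
        "vnorm (m n) (vbar n \<omega>) \<le> K * (a / b)" "(\<Sum>j<n. (psi (Z j \<omega>) $ i)\<^sup>2) / real n \<le> F\<^sup>2"
        "\<bar>dotp (m n) (coef i n) (vbar n \<omega>) - (\<Sum>j<n. phi (Z j \<omega>) $ i) / real n\<bar> \<le> \<eta> / b"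
        by blast+
      have a2: "1 \<le> a\<^sup>2" using ab(1) by (simp add: one_le_power)
      interpret el_data n "m n" "x n \<omega>" "gram Q u" "\<eta> * b / a ^ 3" "\<rho> * a / b" c C "\<eta> / a\<^sup>2"
      proof unfold_locales
        show "0 < n" "0 < m n" "0 < c" "0 \<le> C" by fact+
        show "0 < \<rho> * a / b" using ab \<rho> by simp
        show "vnorm (m n) (x n \<omega> j) \<le> \<eta> * b / a ^ 3" if "j < n" for j
        proof -
          have "vnorm (m n) (x n \<omega> j) \<le> Max ((\<lambda>j. vnorm (m n) (x n \<omega> j)) ` {..<n})"
            using that by (intro Max_ge) auto
          then show ?thesis using e(1) by simp
        qed
        have "\<eta> * b / a ^ 3 * (\<rho> * a / b) = \<eta> * \<rho> / a\<^sup>2"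
          using ab by (simp add: power2_eq_square power3_eq_cube)
        also have "\<dots> \<le> \<eta> * \<rho> / 1" using a2 \<eta>(1) \<rho>(1) by (intro divide_left_mono) auto
        finally show "\<eta> * b / a ^ 3 * (\<rho> * a / b) \<le> 1 / 2" using \<eta>\<rho> by simp
        show "c * (vnorm (m n) a)\<^sup>2 \<le> dotp (m n) a (mvec (m n) (gram Q u) a)"
          "dotp (m n) a (mvec (m n) (gram Q u) a) \<le> C * (vnorm (m n) a)\<^sup>2" for a using quad by blast+
        show "opnorm (m n) (\<lambda>i k. emp_gram n (x n \<omega>) i k - gram Q u i k) \<le> \<eta> / a\<^sup>2" using e(2) by simp
        have "\<eta> / a\<^sup>2 \<le> \<eta>" using divide_left_mono[OF a2, of \<eta>] \<eta>(1) ab(3) by simp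
        then show "\<eta> / a\<^sup>2 \<le> c / 2" "\<eta> / a\<^sup>2 \<le> 1" using \<eta>(2,4) by linarith+
        have "vnorm (m n) (?xb n \<omega>) \<le> \<eta> * (1 / (a * b)) + K * (a / b)"
          using vnorm_triangle_diff[of "m n" "?xb n \<omega>" "vbar n \<omega>"] e(4,5) by linarith
        also have "\<eta> * (1 / (a * b)) \<le> 1 * (a / b)"
        proof (rule mult_mono[OF \<eta>(2)])
          have "1 / a \<le> a" using ab by (simp add: pos_divide_le_eq power2_eq_square[symmetric] a2)
          then show "1 / (a * b) \<le> a / b" using divide_right_mono[of "1 / a" a b] ab by simp
        qed (use ab in auto)
        also have "1 * (a / b) + K * (a / b) = (K + 1) * (a / b)" by (simp only: distrib_right add.commute)
        also have "\<dots> < (c / 3 * \<rho>) * (a / b)"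
          unfolding \<rho>(2) using ab c by (intro mult_strict_right_mono) auto
        finally show "vnorm (m n) (?xb n \<omega>) < c / 3 * (\<rho> * a / b)" by simp
      qed
      have ex: "sol_unique n \<omega>" by (rule solution)
      let ?th = "(\<Sum>j<n. psi (Z j \<omega>) $ i / (1 + dotp (m n) (x n \<omega> j) (zeta n \<omega>))) / real n"
      have "\<bar>?th - ((\<Sum>j<n. psi (Z j \<omega>) $ i) / real n - dotp (m n) (coef i n) (vbar n \<omega>))\<bar>
          \<le> 2 * (\<eta> * b / a ^ 3) * (\<rho> * a / b)\<^sup>2 * F * sqrt (C + 1) + (\<eta> / a) * (\<rho> * a / b)
            + A * (\<eta> / (a * b) + 2 * (\<eta> * b / a ^ 3) * (\<rho> * a / b)\<^sup>2 * (C + 1) + (\<eta> / a\<^sup>2) * (\<rho> * a / b))"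
      proof (rule linearization[where g="\<lambda>k. cross_v i k"])
        show "gram Q u i k = gram Q u k i" for i k by (simp add: gram_def mult.commute)
        show "el_sol (m n) n (x n \<omega>) (zeta n \<omega>)" by (rule theI'[OF ex])
        show "vnorm (m n) (\<lambda>k. ?xb n \<omega> k - vbar n \<omega> k) \<le> \<eta> / (a * b)" using e(4) by simp
      qed (use coef coefA e F in auto)
      also have "\<dots> \<le> T * (\<eta> / b)"
        unfolding T_def s_def using ab \<eta> \<rho> F A C by (intro linearization_rate) auto
      \<comment> \<open>The extra \<eta> / b pays for replacing the mean of the finite projection by
        that of phi, which explains T + 1 in the choice of \<eta>.\<close>
      finally have "\<bar>?th - ((\<Sum>j<n. psi (Z j \<omega>) $ i) / real n - (\<Sum>j<n. phi (Z j \<omega>) $ i) / real n)\<bar> \<le> T * (\<eta> / b) + \<eta> / b"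
        using e(7) by linarith
      also have "\<dots> = (T + 1) * \<eta> / b" by (simp add: distrib_right add_divide_distrib)
      also have "\<dots> \<le> \<epsilon> / b" using \<eta>T ab by (intro divide_right_mono) auto
      finally show "(sol_unique n \<omega>) \<and>
        \<bar>?th - ((\<Sum>j<n. psi (Z j \<omega>) $ i) / real n - (\<Sum>j<n. phi (Z j \<omega>) $ i) / real n)\<bar> \<le> \<epsilon> / sqrt (real n)"
        using ex by (simp add: b_def)
    qed
  qed
qed

end

section \<open>The limiting covariance and asymptotic normality\<close>

lemma vec_expansion: "x = (\<Sum>i\<in>UNIV. x $ i *\<^sub>R axis i (1::real))"
  by (simp add: vec_eq_iff axis_def if_distrib cong: if_cong)

lemma L2_vec:
  fixes f :: "'z \<Rightarrow> real^'r"
  assumes "finite_measure Q" "\<And>i. L2_on Q (\<lambda>z. f z $ i)"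
  shows "f \<in> borel_measurable Q" "integrable Q f" "integrable Q (\<lambda>z. (norm (f z))\<^sup>2)"
    "\<And>i. integral\<^sup>L Q f $ i = integral\<^sup>L Q (\<lambda>z. f z $ i)"
proof -
  have e: "f = (\<lambda>z. \<Sum>i\<in>UNIV. f z $ i *\<^sub>R axis i (1::real))"
    by (rule ext) (rule vec_expansion)
  have [measurable]: "(\<lambda>z. f z $ i) \<in> borel_measurable Q" for i using assms(2) by blast
  show "f \<in> borel_measurable Q" by (subst e) measurable
  show int: "integrable Q f"
    using L2_on_integrable[OF assms] by (subst e) (intro Bochner_Integration.integrable_sum integrable_scaleR_left, auto)
  have "(norm (f z))\<^sup>2 = (\<Sum>i\<in>UNIV. (f z $ i)\<^sup>2)" for z
    unfolding norm_vec_def L2_set_def by (simp add: sum_nonneg)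
  then show "integrable Q (\<lambda>z. (norm (f z))\<^sup>2)" using assms(2) by (simp add: L2_on_def)
  show "integral\<^sup>L Q f $ i = integral\<^sup>L Q (\<lambda>z. f z $ i)" for i
    using integral_bounded_linear[OF bounded_linear_vec_nth int] by simp
qed

lemma inner_matrix_vector: "t \<bullet> (S *v t) = (\<Sum>i\<in>UNIV. \<Sum>j\<in>UNIV. t $ i * t $ j * S $ i $ j)"
  for S :: "real^'r^'r"
  by (simp add: inner_vec_def matrix_vector_mult_def sum_distrib_left mult_ac)

text \<open>With a symmetric root A of S the form is |A t|^2; if it vanished, S t = A (A t) would
  vanish too.\<close>

lemma psd_invertible_pos:
  fixes S :: "real^'r^'r"
  assumes S: "transpose S = S" "\<And>x. 0 \<le> x \<bullet> (S *v x)" and inv: "invertible S" and t: "t \<noteq> 0"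
  shows "0 < t \<bullet> (S *v t)"
proof -
  obtain A where A: "transpose A = A" "A ** A = S"
    using psd_sqrt_exists[OF S] by blast
  have "t \<bullet> (S *v t) = (A *v t) \<bullet> (A *v t)"
    unfolding symmetric_matrix_inner[OF A(1)] by (simp add: matrix_vector_mul_assoc A(2))
  moreover have "A *v t \<noteq> 0"
  proof
    assume "A *v t = 0"
    then have "S *v t = 0" unfolding A(2)[symmetric] matrix_vector_mul_assoc[symmetric] by simp
    then show False using t inv invertible_def matrix_left_invertible_ker by blast
  qed
  ultimately show ?thesis by simp
qed

context estimated_constraints begin

text \<open>The projection property gives orthogonality to each v only. Approximating phi by
  combinations of v leaves the product with a function of squared norm below l^2, which
  \<open>weighted_am_gm\<close> bounds by a multiple of the arbitrary l.\<close>

lemma residual_orthogonal_phi: "integral\<^sup>L Q (\<lambda>z. (psi z $ i - phi z $ i) * phi z $ j) = 0"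
proof -
  let ?w = "\<lambda>z. psi z $ i - phi z $ i"
  let ?B = "integral\<^sup>L Q (\<lambda>z. (?w z)\<^sup>2) + 1"
  have w: "L2_on Q ?w" by (rule L2_on_diff[OF psi phi])
  have wv: "integral\<^sup>L Q (\<lambda>z. ?w z * v k z) = 0" for k
    using L2_on_prod[OF phi v] L2_on_prod[OF psi v] phi_psi by (simp add: left_diff_distrib)
  have bound: "\<bar>integral\<^sup>L Q (\<lambda>z. ?w z * phi z $ j)\<bar> \<le> l * (?B / 2)" if l: "0 < l" for l
  proof -
    have "0 < l\<^sup>2" using l by simp
    from phi_approx[OF this, of j] obtain K b
      where K: "integral\<^sup>L Q (\<lambda>z. (phi z $ j - (\<Sum>k<K. b k * v k z))\<^sup>2) < l\<^sup>2" by (elim exE)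
    define g where "g z = phi z $ j - (\<Sum>k<K. b k * v k z)" for z
    have q: "L2_on Q (\<lambda>z. \<Sum>k<K. b k * v k z)" by (rule L2_on_lincomb[OF v])
    have g: "L2_on Q g" unfolding g_def[abs_def] by (rule L2_on_diff[OF phi q])
    have "integral\<^sup>L Q (\<lambda>z. ?w z * phi z $ j) = integral\<^sup>L Q (\<lambda>z. ?w z * g z + ?w z * (\<Sum>k<K. b k * v k z))"
      by (simp add: g_def right_diff_distrib)
    also have "\<dots> = integral\<^sup>L Q (\<lambda>z. ?w z * g z) + integral\<^sup>L Q (\<lambda>z. ?w z * (\<Sum>k<K. b k * v k z))"
      by (rule Bochner_Integration.integral_add[OF L2_on_prod[OF w g] L2_on_prod[OF w q]])
    also have "integral\<^sup>L Q (\<lambda>z. ?w z * (\<Sum>k<K. b k * v k z)) = 0"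
      unfolding integral_mult_sum[OF w v] wv by simp
    finally have "\<bar>integral\<^sup>L Q (\<lambda>z. ?w z * phi z $ j)\<bar> \<le> integral\<^sup>L Q (\<lambda>z. \<bar>?w z * g z\<bar>)"
      using integral_abs_bound[of Q "\<lambda>z. ?w z * g z"] by simp
    also have "\<dots> \<le> integral\<^sup>L Q (\<lambda>z. (l * (?w z)\<^sup>2 + (g z)\<^sup>2 / l) / 2)"
    proof (rule integral_mono)
      show "integrable Q (\<lambda>z. \<bar>?w z * g z\<bar>)" using L2_on_prod[OF w g] by (rule integrable_abs)
      show "integrable Q (\<lambda>z. (l * (?w z)\<^sup>2 + (g z)\<^sup>2 / l) / 2)"
        by (intro integrable_divide Bochner_Integration.integrable_add integrable_mult_right L2_onD(2)[OF w] L2_onD(2)[OF g])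
      show "\<bar>?w z * g z\<bar> \<le> (l * (?w z)\<^sup>2 + (g z)\<^sup>2 / l) / 2" for z
        using weighted_am_gm[OF l, of "\<bar>?w z\<bar>" "\<bar>g z\<bar>"] by (simp add: abs_mult)
    qed
    also have "\<dots> = (l * integral\<^sup>L Q (\<lambda>z. (?w z)\<^sup>2) + integral\<^sup>L Q (\<lambda>z. (g z)\<^sup>2) / l) / 2"
      using L2_onD(2)[OF w] L2_onD(2)[OF g] by simp
    also have "\<dots> \<le> (l * integral\<^sup>L Q (\<lambda>z. (?w z)\<^sup>2) + l) / 2"
    proof -
      have "integral\<^sup>L Q (\<lambda>z. (g z)\<^sup>2) \<le> l * l" using K by (simp add: g_def power2_eq_square)
      then have "integral\<^sup>L Q (\<lambda>z. (g z)\<^sup>2) / l \<le> l" using l by (simp add: pos_divide_le_eq)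
      then show ?thesis by (intro divide_right_mono add_left_mono) simp_all
    qed
    also have "\<dots> = l * (?B / 2)" by (simp add: distrib_left)
    finally show ?thesis .
  qed
  have B: "0 < ?B / 2"
    by (intro half_gt_zero add_nonneg_pos integral_nonneg_AE AE_I2 zero_le_power2 zero_less_one)
  have "\<bar>integral\<^sup>L Q (\<lambda>z. ?w z * phi z $ j)\<bar> \<le> 0 + e" if "0 < e" for e
    using bound[of "e / (?B / 2)"] that B by simp
  then have "\<bar>integral\<^sup>L Q (\<lambda>z. ?w z * phi z $ j)\<bar> \<le> 0" by (rule field_le_epsilon)
  then show ?thesis by simp
qed

text \<open>For n > 0 its sample mean is psibar - phibar - theta. It is centred because phi
  integrates to 0, and its covariance is \<open>Sig\<close>.\<close>

definition influence :: "'z \<Rightarrow> real^'r" where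
  "influence z = psi z - phi z - integral\<^sup>L Q psi"

lemmas integrable_psi = L2_vec(2)[OF Q.finite_measure_axioms psi]
  and integrable_phi = L2_vec(2)[OF Q.finite_measure_axioms phi]

lemma integral_psi: "integral\<^sup>L Q psi $ i = integral\<^sup>L Q (\<lambda>z. psi z $ i)"
  and integral_phi: "integral\<^sup>L Q phi = 0"
  using L2_vec(4)[OF Q.finite_measure_axioms psi] L2_vec(4)[OF Q.finite_measure_axioms phi] phi_mean
  by (simp_all add: vec_eq_iff)

lemma L2_influence: "L2_on Q (\<lambda>z. influence z $ i)"
  unfolding influence_def vector_minus_component
  by (intro L2_on_diff psi phi) (simp add: L2_on_def)

lemma integral_influence: "integral\<^sup>L Q influence = 0"
proof -
  have "integral\<^sup>L Q influence = integral\<^sup>L Q (\<lambda>z. psi z - phi z) - integral\<^sup>L Q psi"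
    unfolding influence_def[abs_def]
    using integrable_psi integrable_phi
    by (simp add: Q.prob_space)
  then show ?thesis
    using integrable_psi integrable_phi
    by (simp add: integral_phi)
qed

abbreviation "Sig \<equiv> covmat Q psi - covmat Q phi"

lemma integral_shift_prod:
  assumes "L2_on Q f" "L2_on Q g"
  shows "integral\<^sup>L Q (\<lambda>z. (f z - integral\<^sup>L Q f) * (g z - integral\<^sup>L Q g))
    = integral\<^sup>L Q (\<lambda>z. f z * g z) - integral\<^sup>L Q f * integral\<^sup>L Q g"
proof -
  have "integral\<^sup>L Q (\<lambda>z. (f z - integral\<^sup>L Q f) * (g z - integral\<^sup>L Q g))
      = integral\<^sup>L Q (\<lambda>z. f z * g z - integral\<^sup>L Q g * f z - integral\<^sup>L Q f * g z + integral\<^sup>L Q f * integral\<^sup>L Q g)"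
    by (simp add: algebra_simps)
  then show ?thesis
    using L2_on_prod[OF assms] L2_integrable[OF assms(1)]
      L2_integrable[OF assms(2)]
    by (simp add: Q.prob_space)
qed

text \<open>Pythagoras for covariances: psi - phi is orthogonal to phi, so Var(psi - phi) = Var(psi)
  - Var(phi). As phi is centred, its covariance is its matrix of second moments.\<close>

lemma Sig_entry: "Sig $ i $ j = integral\<^sup>L Q (\<lambda>z. influence z $ i * influence z $ j)"
proof -
  let ?w = "\<lambda>i z. psi z $ i - phi z $ i"
  have w: "L2_on Q (?w i)" for i by (rule L2_on_diff[OF psi phi])
  have wm: "integral\<^sup>L Q (?w i) = integral\<^sup>L Q psi $ i" for i
    using L2_integrable[OF psi] L2_integrable[OF phi]
    by (simp add: integral_psi phi_mean)
  have "integral\<^sup>L Q (\<lambda>z. influence z $ i * influence z $ j)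
      = integral\<^sup>L Q (\<lambda>z. (?w i z - integral\<^sup>L Q (?w i)) * (?w j z - integral\<^sup>L Q (?w j)))"
    unfolding wm by (simp add: influence_def)
  also have "\<dots> = integral\<^sup>L Q (\<lambda>z. ?w i z * ?w j z) - integral\<^sup>L Q psi $ i * integral\<^sup>L Q psi $ j"
    unfolding wm by (rule integral_shift_prod[OF w w, unfolded wm])
  also have "integral\<^sup>L Q (\<lambda>z. ?w i z * ?w j z)
      = integral\<^sup>L Q (\<lambda>z. ?w i z * psi z $ j) - integral\<^sup>L Q (\<lambda>z. ?w i z * phi z $ j)"
    unfolding right_diff_distrib[of "?w i _"]
    by (rule Bochner_Integration.integral_diff[OF L2_on_prod[OF w psi] L2_on_prod[OF w phi]])
  also have "\<dots> = integral\<^sup>L Q (\<lambda>z. psi z $ i * psi z $ j) - integral\<^sup>L Q (\<lambda>z. phi z $ i * psi z $ j)"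
    unfolding residual_orthogonal_phi left_diff_distrib[of _ _ "psi _ $ j"] diff_0_right
    by (rule Bochner_Integration.integral_diff[OF L2_on_prod[OF psi psi] L2_on_prod[OF phi psi]])
  also have "integral\<^sup>L Q (\<lambda>z. phi z $ i * psi z $ j) = integral\<^sup>L Q (\<lambda>z. phi z $ i * phi z $ j)"
  proof -
    have "integral\<^sup>L Q (\<lambda>z. phi z $ i * psi z $ j) - integral\<^sup>L Q (\<lambda>z. phi z $ i * phi z $ j)
        = integral\<^sup>L Q (\<lambda>z. (psi z $ j - phi z $ j) * phi z $ i)"
      using Bochner_Integration.integral_diff[OF L2_on_prod[OF phi psi] L2_on_prod[OF phi phi], of i j i j]
      by (simp add: algebra_simps)
    then show ?thesis by (simp add: residual_orthogonal_phi)
  qed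
  finally have "integral\<^sup>L Q (\<lambda>z. influence z $ i * influence z $ j)
      = integral\<^sup>L Q (\<lambda>z. psi z $ i * psi z $ j) - integral\<^sup>L Q (\<lambda>z. phi z $ i * phi z $ j)
        - integral\<^sup>L Q psi $ i * integral\<^sup>L Q psi $ j" .
  moreover have "covmat Q psi $ i $ j = integral\<^sup>L Q (\<lambda>z. psi z $ i * psi z $ j) - integral\<^sup>L Q psi $ i * integral\<^sup>L Q psi $ j"
    unfolding covmat_def vec_lambda_beta integral_psi by (rule integral_shift_prod[OF psi psi])
  moreover have "covmat Q phi $ i $ j = integral\<^sup>L Q (\<lambda>z. phi z $ i * phi z $ j)"
    unfolding covmat_def vec_lambda_beta integral_phi by simp
  ultimately show ?thesis by simp
qed

lemma Sig_symmetric: "transpose Sig = Sig"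
  unfolding vec_eq_iff transpose_def vec_lambda_beta Sig_entry by (simp add: mult.commute)

lemma Sig_quadratic: "integral\<^sup>L Q (\<lambda>z. (t \<bullet> influence z)\<^sup>2) = t \<bullet> (Sig *v t)"
proof -
  have "integral\<^sup>L Q (\<lambda>z. (t \<bullet> influence z)\<^sup>2)
      = integral\<^sup>L Q (\<lambda>z. \<Sum>i\<in>UNIV. \<Sum>j\<in>UNIV. t $ i * t $ j * (influence z $ i * influence z $ j))"
    by (simp add: inner_vec_def power2_eq_square sum_product mult_ac)
  also have "\<dots> = (\<Sum>i\<in>UNIV. \<Sum>j\<in>UNIV. integral\<^sup>L Q (\<lambda>z. t $ i * t $ j * (influence z $ i * influence z $ j)))"
    by (subst Bochner_Integration.integral_sum, intro Bochner_Integration.integrable_sum integrable_mult_right L2_on_prod L2_influence)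
       (intro sum.cong refl Bochner_Integration.integral_sum integrable_mult_right L2_on_prod L2_influence)
  also have "\<dots> = t \<bullet> (Sig *v t)"
    unfolding inner_matrix_vector Sig_entry by simp
  finally show ?thesis .
qed

definition thetahat :: "nat \<Rightarrow> 'a \<Rightarrow> real^'r" where
  "thetahat n \<omega> = (1 / real n) *\<^sub>R (\<Sum>j<n. (1 / (1 + dotp (m n) (x n \<omega> j)
     (zeta n \<omega>))) *\<^sub>R psi (Z j \<omega>))"

lemma thetahat_linearization:
  "op_small M (\<lambda>n \<omega>. norm (thetahat n \<omega> - ((1 / real n) *\<^sub>R (\<Sum>j<n. psi (Z j \<omega>)) - (1 / real n) *\<^sub>R (\<Sum>j<n. phi (Z j \<omega>)))))
    (\<lambda>n. real n powr (-1/2))"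
  unfolding op_small_iff_fails_rarely
proof (intro allI impI)
  fix \<epsilon> \<delta> :: real assume \<epsilon>: "0 < \<epsilon>" and \<delta>: "0 < \<delta>"
  \<comment> \<open>The Euclidean norm is at most the sum of the absolute components, so each of the
    CARD('r) components receives an equal share of \<epsilon>.\<close>
  define e where "e = \<epsilon> / real CARD('r)"
  have e: "0 < e" using \<epsilon> by (simp add: e_def)
  let ?D = "\<lambda>n \<omega>. thetahat n \<omega> - ((1 / real n) *\<^sub>R (\<Sum>j<n. psi (Z j \<omega>)) - (1 / real n) *\<^sub>R (\<Sum>j<n. phi (Z j \<omega>)))"
  let ?t = "\<lambda>n \<omega> i. (\<Sum>j<n. psi (Z j \<omega>) $ i / (1 + dotp (m n) (x n \<omega> j) (zeta n \<omega>))) / real n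
      - ((\<Sum>j<n. psi (Z j \<omega>) $ i) / real n - (\<Sum>j<n. phi (Z j \<omega>) $ i) / real n)"
  have comp: "?D n \<omega> $ i = ?t n \<omega> i" for n \<omega> i
    by (simp add: thetahat_def sum_component)
  have "fails_rarely M \<delta> (\<lambda>n \<omega>. \<forall>i\<in>UNIV. \<bar>?t n \<omega> i\<bar> \<le> e / sqrt (real n))"
  proof (rule fails_rarely_finite[OF finite _ \<delta>])
    fix i :: 'r and \<delta> :: real assume "0 < \<delta>"
    from el_mean_linearization[OF e this, of i]
    show "fails_rarely M \<delta> (\<lambda>n \<omega>. \<bar>?t n \<omega> i\<bar> \<le> e / sqrt (real n))"
      by (rule fails_rarely_mono) (intro always_eventually allI ballI impI, elim conjE)
  qed
  then show "fails_rarely M \<delta> (\<lambda>n \<omega>. \<bar>norm (?D n \<omega>)\<bar> \<le> \<epsilon> * real n powr (-1/2))"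
  proof (rule fails_rarely_mono, intro always_eventually allI ballI impI)
    fix n \<omega> assume *: "\<forall>i\<in>UNIV. \<bar>?t n \<omega> i\<bar> \<le> e / sqrt (real n)"
    have "norm (?D n \<omega>) \<le> (\<Sum>i\<in>UNIV. \<bar>?D n \<omega> $ i\<bar>)" by (rule norm_le_l1_cart)
    also have "\<dots> \<le> (\<Sum>i\<in>(UNIV::'r set). e / sqrt (real n))" unfolding comp using * by (intro sum_mono) blast
    also have "\<dots> = \<epsilon> * (1 / sqrt (real n))" by (simp add: e_def)
    finally show "\<bar>norm (?D n \<omega>)\<bar> \<le> \<epsilon> * real n powr (-1/2)"
      unfolding powr_neg_half[OF of_nat_0_le_iff] by simp
  qed
qed

text \<open>Unique solvability need not be a measurable event. \<open>fails_rarely_cover\<close>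
  supplies one sequence of measurable covers of its failure, and their complements are the events
  wanted.\<close>

lemma el_sol_with_high_probability:
  "\<exists>A. (\<forall>n. A n \<in> sets M \<and> A n \<subseteq> {\<omega> \<in> space M. sol_unique n \<omega>}) \<and> (\<lambda>n. measure M (A n)) \<longlonglongrightarrow> 1"
proof -
  have fr: "fails_rarely M \<delta> (\<lambda>n \<omega>. sol_unique n \<omega>)" if \<delta>: "0 < \<delta>" for \<delta>
    by (rule fails_rarely_mono[OF el_mean_linearization[OF zero_less_one \<delta>]])
       (intro always_eventually allI ballI impI, elim conjE)
  have "\<exists>B. (\<forall>n. B n \<in> sets M \<and> {\<omega> \<in> space M. \<not> (sol_unique n \<omega>)} \<subseteq> B n)
      \<and> (\<lambda>n. prob (B n)) \<longlonglongrightarrow> 0"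
    by (rule fails_rarely_cover) (rule fr)
  then obtain B where B: "\<forall>n. B n \<in> sets M \<and> {\<omega> \<in> space M. \<not> (sol_unique n \<omega>)} \<subseteq> B n"
    and lim: "(\<lambda>n. prob (B n)) \<longlonglongrightarrow> 0" by (elim exE conjE)
  have "(\<lambda>n. prob (space M - B n)) \<longlonglongrightarrow> 1"
    using tendsto_diff[OF tendsto_const[of 1] lim] B by (simp add: prob_compl)
  then show ?thesis using B by (intro exI[of _ "\<lambda>n. space M - B n"]) blast
qed

lemma thetahat_normality:
  assumes "invertible Sig"
  shows "weak_conv_outer M (\<lambda>n \<omega>. sqrt (real n) *\<^sub>R (thetahat n \<omega> - integral\<^sup>L Q psi)) (mvnormal Sig)"
proof -
  have psd: "0 \<le> t \<bullet> (Sig *v t)" for t unfolding Sig_quadratic[symmetric] by simp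
  note inf = L2_vec[OF Q.finite_measure_axioms L2_influence]
  note clt = clt_multivariate[OF inf(1,3) integral_influence Sig_symmetric Sig_quadratic
      psd_invertible_pos[OF Sig_symmetric psd assms]]
  let ?Y = "\<lambda>n \<omega>. (1 / sqrt (real n)) *\<^sub>R (\<Sum>j<n. influence (Z j \<omega>))"
  show ?thesis
  proof (rule slutsky_outer[where Y="?Y", OF _ clt])
    show "?Y n \<in> borel_measurable M" for n
      using measurable_compose[OF Z(1) inf(1)] by (intro borel_measurable_scaleR borel_measurable_sum) auto
    show "op_small M (\<lambda>n \<omega>. norm (sqrt (real n) *\<^sub>R (thetahat n \<omega> - integral\<^sup>L Q psi) - ?Y n \<omega>)) (\<lambda>_. 1)"
      unfolding op_small_iff_fails_rarely
    proof (intro allI impI)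
      fix \<epsilon> \<delta> :: real assume "0 < \<epsilon>" "0 < \<delta>"
      from fails_rarely_op_small[OF thetahat_linearization this]
      show "fails_rarely M \<delta> (\<lambda>n \<omega>. \<bar>norm (sqrt (real n) *\<^sub>R (thetahat n \<omega> - integral\<^sup>L Q psi) - ?Y n \<omega>)\<bar> \<le> \<epsilon> * 1)"
      proof (rule fails_rarely_mono, intro eventually_mono[OF eventually_gt_at_top[of 0]] ballI impI)
        fix n :: nat and \<omega>
        let ?D = "thetahat n \<omega> - ((1 / real n) *\<^sub>R (\<Sum>j<n. psi (Z j \<omega>)) - (1 / real n) *\<^sub>R (\<Sum>j<n. phi (Z j \<omega>)))"
        assume n: "0 < n" and *: "\<bar>norm ?D\<bar> \<le> \<epsilon> * real n powr (-1/2)"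
        have "(\<Sum>j<n. influence (Z j \<omega>)) = (\<Sum>j<n. psi (Z j \<omega>)) - (\<Sum>j<n. phi (Z j \<omega>)) - real n *\<^sub>R integral\<^sup>L Q psi"
          by (simp add: influence_def sum_subtractf scaleR_conv_of_real sum_constant_scaleR)
        moreover have "1 / sqrt (real n) = sqrt (real n) * (1 / real n)"
          using n by (simp add: real_div_sqrt divide_simps)
        ultimately have "sqrt (real n) *\<^sub>R (thetahat n \<omega> - integral\<^sup>L Q psi) - ?Y n \<omega> = sqrt (real n) *\<^sub>R ?D"
          using n by (simp only: scaleR_scaleR[symmetric] scaleR_diff_right[symmetric]) (simp add: algebra_simps)
        then have "norm (sqrt (real n) *\<^sub>R (thetahat n \<omega> - integral\<^sup>L Q psi) - ?Y n \<omega>) = sqrt (real n) * norm ?D"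
          by simp
        also have "\<dots> \<le> sqrt (real n) * (\<epsilon> * (1 / sqrt (real n)))"
          using *[unfolded powr_neg_half[OF of_nat_0_le_iff]] by (intro mult_left_mono) auto
        also have "\<dots> = \<epsilon>" using n by simp
        finally show "\<bar>norm (sqrt (real n) *\<^sub>R (thetahat n \<omega> - integral\<^sup>L Q psi) - ?Y n \<omega>)\<bar> \<le> \<epsilon> * 1" by simp
      qed
    qed
  qed
qed

end

theorem theorem4:
  fixes M :: "'a measure" and Q :: "'z measure" and Z :: "nat \<Rightarrow> 'a \<Rightarrow> 'z"
    and psi :: "'z \<Rightarrow> real^'r" and m :: "nat \<Rightarrow> nat"
    and u :: "nat \<Rightarrow> 'z \<Rightarrow> real" and uhat :: "nat \<Rightarrow> 'a \<Rightarrow> 'z \<Rightarrow> nat \<Rightarrow> real"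
    and v :: "nat \<Rightarrow> 'z \<Rightarrow> real" and phi :: "'z \<Rightarrow> real^'r"
  defines "W \<equiv> \<lambda>n::nat. gram Q u"
    and "V \<equiv> \<lambda>n::nat. gram Q v"
    and "What \<equiv> \<lambda>n \<omega> i k. (\<Sum>j<n. uhat n \<omega> (Z j \<omega>) i * uhat n \<omega> (Z j \<omega>) k) / real n"
    and "U \<equiv> \<lambda>n. mmul (m n) (mmul (m n) (inv_sqrt (m n) (gram Q u)) (gram Q v)) (inv_sqrt (m n) (gram Q u))"
    and "thetahat \<equiv> \<lambda>n \<omega>. (1 / real n) *\<^sub>R
            (\<Sum>j<n. (1 / (1 + dotp (m n) (uhat n \<omega> (Z j \<omega>))
                 (THE \<zeta>. el_sol (m n) n (\<lambda>j. uhat n \<omega> (Z j \<omega>)) \<zeta>))) *\<^sub>R psi (Z j \<omega>))"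
    and "psibar \<equiv> \<lambda>n \<omega>. (1 / real n) *\<^sub>R (\<Sum>j<n. psi (Z j \<omega>))"
    and "phibar \<equiv> \<lambda>n \<omega>. (1 / real n) *\<^sub>R (\<Sum>j<n. phi (Z j \<omega>))"
    and "theta \<equiv> integral\<^sup>L Q psi"
    and "Sig \<equiv> covmat Q psi - covmat Q phi"
  assumes M: "prob_space M"
    and Z_meas: "\<And>j. Z j \<in> measurable M Q"
    and Z_distr: "\<And>j. distr M Q (Z j) = Q"
    and Z_indep: "prob_space.indep_vars M (\<lambda>_. Q) Z UNIV"
    and psi_meas: "psi \<in> borel_measurable Q"
    and psi_L2: "integrable Q (\<lambda>z. (norm (psi z))\<^sup>2)"
    and m_lim: "filterlim m at_top sequentially"
    and u_meas: "\<And>k. u k \<in> borel_measurable Q"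
    and u_L2: "\<And>n. integrable Q (\<lambda>z. \<Sum>k<m n. (u k z)\<^sup>2)"
    and u_mean: "\<And>n k. k < m n \<Longrightarrow> integral\<^sup>L Q (u k) = 0"
    and W_nonsing: "\<And>n. nonsingular (m n) (W n)"
    and W_regular: "regular_seq m W"
    and cond_i: "op_small M (\<lambda>n \<omega>. Max ((\<lambda>j. vnorm (m n) (uhat n \<omega> (Z j \<omega>))) ` {..<n}))
                   (\<lambda>n. real (m n) powr (-3/2) * real n powr (1/2))"
    and cond_ii: "op_small M (\<lambda>n \<omega>. opnorm (m n) (\<lambda>i k. What n \<omega> i k - W n i k))
                   (\<lambda>n. real (m n) powr (-1))"
    and cond_iii_int: "\<And>n j i k. j < n \<Longrightarrow> k < m n \<Longrightarrow>
                   integrable M (\<lambda>\<omega>. psi (Z j \<omega>) $ i * uhat n \<omega> (Z j \<omega>) k)"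
    and cond_iii: "op_small M (\<lambda>n \<omega>. sqrt (\<Sum>i\<in>UNIV. \<Sum>k<m n.
                   ((\<Sum>j<n. psi (Z j \<omega>) $ i * uhat n \<omega> (Z j \<omega>) k
                       - integral\<^sup>L M (\<lambda>\<omega>'. psi (Z j \<omega>') $ i * uhat n \<omega>' (Z j \<omega>') k)) / real n)\<^sup>2))
                   (\<lambda>n. real (m n) powr (-1/2))"
    and v_meas: "\<And>k. v k \<in> borel_measurable Q"
    and v_L2: "\<And>n. integrable Q (\<lambda>z. \<Sum>k<m n. (v k z)\<^sup>2)"
    and v_mean: "\<And>n k. k < m n \<Longrightarrow> integral\<^sup>L Q (v k) = 0"
    and V_nonsing: "\<And>n. nonsingular (m n) (V n)"
    and U_bounded: "\<exists>C. \<forall>\<^sub>F n in sequentially. opnorm (m n) (U n) \<le> C"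
    and cond_iv_int: "\<And>n j. j < n \<Longrightarrow>
                   integrable M (\<lambda>\<omega>. (vnorm (m n) (\<lambda>k. uhat n \<omega> (Z j \<omega>) k - v k (Z j \<omega>)))\<^sup>2)"
    and cond_iv: "(\<lambda>n. (\<Sum>j<n. integral\<^sup>L M
                     (\<lambda>\<omega>. (vnorm (m n) (\<lambda>k. uhat n \<omega> (Z j \<omega>) k - v k (Z j \<omega>)))\<^sup>2)) / real n)
                   \<in> o(\<lambda>n. real (m n) powr (-1))"
    and cond_v: "op_small M (\<lambda>n \<omega>. vnorm (m n)
                     (\<lambda>k. (\<Sum>j<n. uhat n \<omega> (Z j \<omega>) k) / real n - (\<Sum>j<n. v k (Z j \<omega>)) / real n))
                   (\<lambda>n. real (m n) powr (-1/2) * real n powr (-1/2))"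
    and phi_proj: "\<And>i. l2_proj Q v (\<lambda>z. psi z $ i) (\<lambda>z. phi z $ i)"
  shows "(\<exists>A. (\<forall>n. A n \<in> sets M \<and> A n \<subseteq> {\<omega> \<in> space M. \<exists>!\<zeta>. el_sol (m n) n (\<lambda>j. uhat n \<omega> (Z j \<omega>)) \<zeta>})
              \<and> (\<lambda>n. measure M (A n)) \<longlonglongrightarrow> 1)
         \<and> op_small M (\<lambda>n \<omega>. norm (thetahat n \<omega> - (psibar n \<omega> - phibar n \<omega>)))
              (\<lambda>n. real n powr (-1/2))
         \<and> (invertible Sig \<longrightarrow>
              weak_conv_outer M (\<lambda>n \<omega>. sqrt (real n) *\<^sub>R (thetahat n \<omega> - theta)) (mvnormal Sig))"
proof -
  interpret prob_space M by (rule M)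
  \<comment> \<open>As m is unbounded, the hypotheses on v stated for indices below m n reach every
    index.\<close>
  have m_gt: "\<exists>n. k < m n" for k
    using filterlim_at_top[THEN iffD1, OF m_lim, rule_format, of "Suc k"]
    by (auto simp: eventually_sequentially Suc_le_eq)
  have psi_comp: "L2_on Q (\<lambda>z. psi z $ i)" for i
    unfolding L2_on_def
  proof (intro conjI Bochner_Integration.integrable_bound[OF psi_L2] AE_I2)
    show "(\<lambda>z. psi z $ i) \<in> borel_measurable Q"
      using borel_measurable_inner[OF psi_meas borel_measurable_const, of "axis i 1"] by (simp add: inner_axis)
    then show "(\<lambda>z. (psi z $ i)\<^sup>2) \<in> borel_measurable Q" by (rule borel_measurable_power)
    show "norm ((psi z $ i)\<^sup>2) \<le> norm ((norm (psi z))\<^sup>2)" for z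
      using power_mono[OF component_le_norm_cart[of "psi z" i] abs_ge_zero, of 2] by simp
  qed
  have v_comp: "L2_on Q (v k)" for k
  proof -
    obtain n where n: "k < m n" using m_gt by blast
    show ?thesis
      unfolding L2_on_def
    proof (intro conjI Bochner_Integration.integrable_bound[OF v_L2[of n]] AE_I2)
      show "v k \<in> borel_measurable Q" by (rule v_meas)
      then show "(\<lambda>z. (v k z)\<^sup>2) \<in> borel_measurable Q" by (rule borel_measurable_power)
      show "norm ((v k z)\<^sup>2) \<le> norm (\<Sum>k<m n. (v k z)\<^sup>2)" for z
        using member_le_sum[of k "{..<m n}" "\<lambda>k. (v k z)\<^sup>2"] n by (simp add: sum_nonneg)
    qed
  qed
  have v_mean0: "integral\<^sup>L Q (v k) = 0" for k using m_gt[of k] v_mean by blast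
  interpret E: estimated_constraints M Q Z psi m u v phi "\<lambda>n \<omega> j. uhat n \<omega> (Z j \<omega>)"
  proof unfold_locales
    show "indep_vars (\<lambda>_. Q) Z UNIV" by (rule Z_indep)
    show "nonsingular (m n) (gram Q u)" for n using W_nonsing[of n] by (simp only: W_def)
    show "regular_seq m (\<lambda>_. gram Q u)" using W_regular by (simp only: W_def)
    show "op_small M (\<lambda>n \<omega>. opnorm (m n) (\<lambda>i k. emp_gram n (\<lambda>j. uhat n \<omega> (Z j \<omega>)) i k - gram Q u i k))
        (\<lambda>n. real (m n) powr (-1))"
      using cond_ii by (simp only: W_def What_def emp_gram_def)
  qed (fact Z_meas Z_distr psi_comp m_lim cond_i cond_iii_int cond_iii v_comp v_mean0 cond_iv_int cond_iv cond_v phi_proj)+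
  have "thetahat = E.thetahat" unfolding thetahat_def E.thetahat_def[abs_def] ..
  then show ?thesis
    unfolding psibar_def phibar_def theta_def Sig_def
    using E.el_sol_with_high_probability E.thetahat_linearization E.thetahat_normality by blast
qed


end
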